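(* The following statements are equivalent over $\mathrm{RCA}_0$: (1) $\mathrm{ACA}_0$; (2) (the Hennessy–Milner theorem for modally saturated models) for any two modally saturated pointed models $(M,w)$ and $(M',w')$, $(M,w)$ and $(M',w')$ are modally equivalent if and only if they are bisimilar; (3) (the Hennessy–Milner theorem) for any two image-finite pointed models $(M,w)$ and $(M',w')$, $(M,w)$ and $(M',w')$ are modally equivalent if and only if they are bisimilar.
   Context: $\mathrm{RCA}_0$ is the usual base theory of second-order arithmetic (Robinson arithmetic, $\Sigma^0_1$-induction, $\Delta^0_1$-comprehension); $\mathrm{ACA}_0$ is $\mathrm{RCA}_0$ plus comprehension for all arithmetical formulas. All definitions below are made inside $\mathrm{RCA}_0$, with syntactic objects coded by natural numbers. $\mathrm{Prop}$ is an infinite set of propositional variables and $\mathrm{Fml}$ is the set of all modal formulas built from $\mathrm{Prop}\cup\{\bot\}$ using $\rightarrow$ and $\Box$; $\neg,\wedge,\vee,\top$ and $\Diamond=\neg\Box\neg$ are the usual abbreviations. A Kripke model is a triple $M=(W,R,V)$ where $W\subseteq\mathbb{N}$ is non-empty, $R\subseteq W\times W$, and $V:W\times\mathrm{Fml}\to\{0,1\}$ is a (full) valuation, i.e. for all $w\in W$ and $\varphi,\psi\in\mathrm{Fml}$: $V(w,\bot)=0$; $V(w,\varphi\rightarrow\psi)=1-V(w,\varphi)(1-V(w,\psi))$; and $V(w,\Box\varphi)=1\iff\forall v\in W(wRv\rightarrow V(v,\varphi)=1)$. A pointed model is a pair $(M,w)$ with $w\in W$. Write $M,w\Vdash\varphi$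 for $V(w,\varphi)=1$, $M,w\Vdash\Gamma$ if $M,w\Vdash\varphi$ for all $\varphi\in\Gamma$, and $wR=\{v\in W\mid wRv\}$. $M$ is image-finite if $wR$ is a finite set for all $w\in W$. $M$ is modally saturated if for every $w\in W$ and every set $\Gamma$ of modal formulas: if $M,w\Vdash\Diamond\bigwedge\Gamma_0$ for all finite $\Gamma_0\subseteq\Gamma$, then there is $u\in wR$ with $M,u\Vdash\Gamma$. A pointed model $(M,w)$ is called image-finite (modally saturated) if $M$ is. Pointed models $(M,w)$, $(M',w')$ with $M=(W,R,V)$, $M'=(W',R',V')$ are modally equivalent if for all $\varphi\in\mathrm{Fml}$, $V(w,\varphi)=1$ iff $V'(w',\varphi)=1$. A bisimulation between $M$ and $M'$ is a non-empty set $Z\subseteq W\times W'$ such that: (i) $vZv'$ implies $V(v,p)=1\leftrightarrow V'(v',p)=1$ for all $p\in\mathrm{Prop}$; (ii) if $vZv'$ and $vRu$, then there is $u'$ with $uZu'$ and $v'R'u'$; (iii) if $vZv'$ and $v'R'u'$, then there is $u$ with $uZu'$ and $vRu$. $(M,w)$ and $(M',w')$ are bisimilar if there exists a bisimulation $Z$ between $M$ and $M'$ with $wZw'$. *)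

theory Defs
  imports Main
begin

section \<open>The language of second-order arithmetic\<close>

text \<open>Number variables and set variables are two separate sorts, both named by natural numbers:
  \<open>Mem t X\<close> is the atomic formula saying that the number \<open>t\<close> belongs to the set named by the set
  variable \<open>X\<close>.\<close>

datatype l2_term = Var nat | Zero | One | Add l2_term l2_term | Mul l2_term l2_term

datatype l2_formula =
    Eq l2_term l2_term
  | Less l2_term l2_term
  | Mem l2_term nat
  | Neg l2_formula
  | Conj l2_formula l2_formula
  | Disj l2_formula l2_formula
  | Imp l2_formula l2_formula
  | AllN nat l2_formula
  | ExN nat l2_formula
  | AllS nat l2_formula
  | ExS nat l2_formula

primrec term_vars :: "l2_term \<Rightarrow> nat set" where
  "term_vars (Var x) = {x}"
| "term_vars Zero = {}"
| "term_vars One = {}"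
| "term_vars (Add s t) = term_vars s \<union> term_vars t"
| "term_vars (Mul s t) = term_vars s \<union> term_vars t"

text \<open>Formulas all of whose quantifiers are bounded number quantifiers; set variables may occur
  as parameters.\<close>

inductive bounded_fm :: "l2_formula \<Rightarrow> bool" where
  "bounded_fm (Eq s t)"
| "bounded_fm (Less s t)"
| "bounded_fm (Mem t X)"
| "bounded_fm \<phi> \<Longrightarrow> bounded_fm (Neg \<phi>)"
| "bounded_fm \<phi> \<Longrightarrow> bounded_fm \<psi> \<Longrightarrow> bounded_fm (Conj \<phi> \<psi>)"
| "bounded_fm \<phi> \<Longrightarrow> bounded_fm \<psi> \<Longrightarrow> bounded_fm (Disj \<phi> \<psi>)"
| "bounded_fm \<phi> \<Longrightarrow> bounded_fm \<psi> \<Longrightarrow> bounded_fm (Imp \<phi> \<psi>)"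
| "bounded_fm \<phi> \<Longrightarrow> x \<notin> term_vars t \<Longrightarrow> bounded_fm (AllN x (Imp (Less (Var x) t) \<phi>))"
| "bounded_fm \<phi> \<Longrightarrow> x \<notin> term_vars t \<Longrightarrow> bounded_fm (ExN x (Conj (Less (Var x) t) \<phi>))"

definition sigma01 :: "l2_formula \<Rightarrow> bool" where
  "sigma01 \<phi> \<longleftrightarrow> (\<exists>x \<theta>. bounded_fm \<theta> \<and> \<phi> = ExN x \<theta>)"

definition pi01 :: "l2_formula \<Rightarrow> bool" where
  "pi01 \<phi> \<longleftrightarrow> (\<exists>x \<theta>. bounded_fm \<theta> \<and> \<phi> = AllN x \<theta>)"

primrec arithmetical :: "l2_formula \<Rightarrow> bool" where
  "arithmetical (Eq s t) = True"
| "arithmetical (Less s t) = True"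
| "arithmetical (Mem t X) = True"
| "arithmetical (Neg \<phi>) = arithmetical \<phi>"
| "arithmetical (Conj \<phi> \<psi>) = (arithmetical \<phi> \<and> arithmetical \<psi>)"
| "arithmetical (Disj \<phi> \<psi>) = (arithmetical \<phi> \<and> arithmetical \<psi>)"
| "arithmetical (Imp \<phi> \<psi>) = (arithmetical \<phi> \<and> arithmetical \<psi>)"
| "arithmetical (AllN x \<phi>) = arithmetical \<phi>"
| "arithmetical (ExN x \<phi>) = arithmetical \<phi>"
| "arithmetical (AllS X \<phi>) = False"
| "arithmetical (ExS X \<phi>) = False"


section \<open>Structures for the language\<close>

text \<open>The first-order part of a structure is the whole type \<open>'a\<close>, so it may be nonstandard; the
  second-order part is an arbitrary collection \<open>sets_of M\<close> of subsets of it, so set quantifiers have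
  Henkin semantics. As \<open>'a\<close> is a type variable, a theorem about all \<open>M :: 'a l2_structure\<close> is a
  theorem about all structures for the language, hence (by the completeness theorem) about
  provability.\<close>

record 'a l2_structure =
  zero_of :: 'a
  one_of :: 'a
  add_of :: "'a \<Rightarrow> 'a \<Rightarrow> 'a"
  mul_of :: "'a \<Rightarrow> 'a \<Rightarrow> 'a"
  less_of :: "'a \<Rightarrow> 'a \<Rightarrow> bool"
  sets_of :: "'a set set"

text \<open>The coded data of a Kripke model: sets \<open>W\<close> and \<open>R\<close>, and the graph of the valuation.\<close>

record 'a kripke =
  Wld :: "'a set"
  Acc :: "'a set"
  Val :: "'a set"

text \<open>The locale carries no assumptions: outside it, every constant below takes the structure \<open>M\<close>
  as an explicit argument.\<close>

locale l2 =
  fixes M :: "'a l2_structure"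
begin

abbreviation num_zero :: 'a ("\<zero>") where "\<zero> \<equiv> zero_of M"
abbreviation num_one :: 'a ("\<one>") where "\<one> \<equiv> one_of M"
abbreviation nadd :: "'a \<Rightarrow> 'a \<Rightarrow> 'a" (infixl "\<oplus>" 65) where "x \<oplus> y \<equiv> add_of M x y"
abbreviation nmul :: "'a \<Rightarrow> 'a \<Rightarrow> 'a" (infixl "\<otimes>" 70) where "x \<otimes> y \<equiv> mul_of M x y"
abbreviation nless :: "'a \<Rightarrow> 'a \<Rightarrow> bool" (infix "\<lhd>" 50) where "x \<lhd> y \<equiv> less_of M x y"
abbreviation SS :: "'a set set" where "SS \<equiv> sets_of M"

primrec eval_term :: "(nat \<Rightarrow> 'a) \<Rightarrow> l2_term \<Rightarrow> 'a" where
  "eval_term e (Var x) = e x"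
| "eval_term e Zero = \<zero>"
| "eval_term e One = \<one>"
| "eval_term e (Add s t) = eval_term e s \<oplus> eval_term e t"
| "eval_term e (Mul s t) = eval_term e s \<otimes> eval_term e t"

primrec sat :: "(nat \<Rightarrow> 'a) \<Rightarrow> (nat \<Rightarrow> 'a set) \<Rightarrow> l2_formula \<Rightarrow> bool" where
  "sat e E (Eq s t) \<longleftrightarrow> eval_term e s = eval_term e t"
| "sat e E (Less s t) \<longleftrightarrow> eval_term e s \<lhd> eval_term e t"
| "sat e E (Mem t X) \<longleftrightarrow> eval_term e t \<in> E X"
| "sat e E (Neg \<phi>) \<longleftrightarrow> \<not> sat e E \<phi>"
| "sat e E (Conj \<phi> \<psi>) \<longleftrightarrow> sat e E \<phi> \<and> sat e E \<psi>"
| "sat e E (Disj \<phi> \<psi>) \<longleftrightarrow> sat e E \<phi> \<or> sat e E \<psi>"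
| "sat e E (Imp \<phi> \<psi>) \<longleftrightarrow> (sat e E \<phi> \<longrightarrow> sat e E \<psi>)"
| "sat e E (AllN x \<phi>) \<longleftrightarrow> (\<forall>a. sat (e(x := a)) E \<phi>)"
| "sat e E (ExN x \<phi>) \<longleftrightarrow> (\<exists>a. sat (e(x := a)) E \<phi>)"
| "sat e E (AllS X \<phi>) \<longleftrightarrow> (\<forall>A\<in>SS. sat e (E(X := A)) \<phi>)"
| "sat e E (ExS X \<phi>) \<longleftrightarrow> (\<exists>A\<in>SS. sat e (E(X := A)) \<phi>)"


section \<open>The axiom systems\<close>

definition robinson :: bool where
  "robinson \<longleftrightarrow>
     (\<forall>m. m \<oplus> \<one> \<noteq> \<zero>) \<and>
     (\<forall>m n. m \<oplus> \<one> = n \<oplus> \<one> \<longrightarrow> m = n) \<and>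
     (\<forall>m. m \<noteq> \<zero> \<longrightarrow> (\<exists>n. m = n \<oplus> \<one>)) \<and>
     (\<forall>m. m \<oplus> \<zero> = m) \<and>
     (\<forall>m n. m \<oplus> (n \<oplus> \<one>) = (m \<oplus> n) \<oplus> \<one>) \<and>
     (\<forall>m. m \<otimes> \<zero> = \<zero>) \<and>
     (\<forall>m n. m \<otimes> (n \<oplus> \<one>) = m \<otimes> n \<oplus> m) \<and>
     (\<forall>m. \<not> m \<lhd> \<zero>) \<and>
     (\<forall>m n. m \<lhd> n \<oplus> \<one> \<longleftrightarrow> m \<lhd> n \<or> m = n)"

text \<open>In the schemata, the assignments \<open>e\<close> and \<open>E\<close> supply arbitrary number and set parameters.\<close>

definition sigma01_induction :: bool where
  "sigma01_induction \<longleftrightarrow>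
     (\<forall>\<phi> x e E. sigma01 \<phi> \<and> range E \<subseteq> SS \<longrightarrow>
        sat (e(x := \<zero>)) E \<phi> \<and>
        (\<forall>n. sat (e(x := n)) E \<phi> \<longrightarrow> sat (e(x := n \<oplus> \<one>)) E \<phi>) \<longrightarrow>
        (\<forall>n. sat (e(x := n)) E \<phi>))"

definition delta01_comprehension :: bool where
  "delta01_comprehension \<longleftrightarrow>
     (\<forall>\<phi> \<psi> x e E. sigma01 \<phi> \<and> pi01 \<psi> \<and> range E \<subseteq> SS \<longrightarrow>
        (\<forall>n. sat (e(x := n)) E \<phi> \<longleftrightarrow> sat (e(x := n)) E \<psi>) \<longrightarrow>
        (\<exists>X\<in>SS. \<forall>n. n \<in> X \<longleftrightarrow> sat (e(x := n)) E \<phi>))"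

definition arithmetical_comprehension :: bool where
  "arithmetical_comprehension \<longleftrightarrow>
     (\<forall>\<phi> x e E. arithmetical \<phi> \<and> range E \<subseteq> SS \<longrightarrow>
        (\<exists>X\<in>SS. \<forall>n. n \<in> X \<longleftrightarrow> sat (e(x := n)) E \<phi>))"

text \<open>The conjunct \<open>SS \<noteq> {}\<close> is the usual requirement that the domain of each sort is non-empty; without
  it there would be no assignments \<open>E\<close> and the schemata would hold vacuously.\<close>

definition RCA0 :: bool where
  "RCA0 \<longleftrightarrow> SS \<noteq> {} \<and> robinson \<and> sigma01_induction \<and> delta01_comprehension"

definition ACA0 :: bool where
  "ACA0 \<longleftrightarrow> RCA0 \<and> arithmetical_comprehension"


section \<open>Coding of pairs, functions and finite sets\<close>

text \<open>Everything from here on is the interpretation in \<open>M\<close> of a definition made in the language of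
  second-order arithmetic: number quantifiers range over \<open>'a\<close> and set quantifiers over \<open>SS\<close>.
  Definite descriptions are only used where existence and uniqueness are provable in RCA0.\<close>

text \<open>Cantor pairing \<open>(x + y)(x + y + 1)/2 + x\<close>, a bijection from pairs of numbers onto numbers.\<close>

definition pair :: "'a \<Rightarrow> 'a \<Rightarrow> 'a" where
  "pair x y = (THE z. z \<oplus> z = (x \<oplus> y) \<otimes> (x \<oplus> y \<oplus> \<one>) \<oplus> (x \<oplus> x))"

definition cprod :: "'a set \<Rightarrow> 'a set \<Rightarrow> 'a set" where
  "cprod X Y = {pair x y | x y. x \<in> X \<and> y \<in> Y}"

text \<open>Truncated subtraction.\<close>

definition monus :: "'a \<Rightarrow> 'a \<Rightarrow> 'a" (infixl "\<ominus>" 65) where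
  "x \<ominus> y = (THE z. z \<oplus> y = x \<or> x \<lhd> y \<and> z = \<zero>)"

text \<open>Functions are sets, namely their graphs.\<close>

definition is_function :: "'a set \<Rightarrow> 'a set \<Rightarrow> 'a set \<Rightarrow> bool" where
  "is_function F X Y \<longleftrightarrow> F \<in> SS \<and> F \<subseteq> cprod X Y \<and> (\<forall>x\<in>X. \<exists>!y. pair x y \<in> F)"

definition app :: "'a set \<Rightarrow> 'a \<Rightarrow> 'a" where
  "app F x = (THE y. pair x y \<in> F)"

definition bounded_by :: "'a set \<Rightarrow> 'a \<Rightarrow> bool" where
  "bounded_by X k \<longleftrightarrow> (\<forall>x\<in>X. x \<lhd> k)"

definition finite_set :: "'a set \<Rightarrow> bool" where
  "finite_set X \<longleftrightarrow> X \<in> SS \<and> (\<exists>k. bounded_by X k)"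


section \<open>Modal formulas\<close>

text \<open>Modal formulas are coded by
    \<open>falsum = 0\<close>, \<open>p\<^sub>i = 3 i + 1\<close>, \<open>box a = 3 a + 2\<close>, \<open>a \<rightarrow> b = 3 \<langle>a, b\<rangle> + 3\<close>.
  As the pairing is bijective, every number has exactly one of these forms, and the codes of
  immediate subformulas are smaller than the code of the formula. Hence every number is the code of
  exactly one formula: \<open>Fml\<close> is the set of all numbers, and a set of formulas is just a set.\<close>

definition thrice :: "'a \<Rightarrow> 'a" where
  "thrice n = n \<oplus> n \<oplus> n"

definition Fml :: "'a set" where
  "Fml = UNIV"

definition falsum :: 'a where
  "falsum = \<zero>"

definition pvar :: "'a \<Rightarrow> 'a" where
  "pvar i = thrice i \<oplus> \<one>"

definition box :: "'a \<Rightarrow> 'a" where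
  "box a = thrice a \<oplus> \<one> \<oplus> \<one>"

definition imp :: "'a \<Rightarrow> 'a \<Rightarrow> 'a" where
  "imp a b = thrice (pair a b) \<oplus> \<one> \<oplus> \<one> \<oplus> \<one>"

definition Prop :: "'a set" where
  "Prop = range pvar"

definition neg :: "'a \<Rightarrow> 'a" where
  "neg a = imp a falsum"

definition verum :: 'a where
  "verum = neg falsum"

definition conj :: "'a \<Rightarrow> 'a \<Rightarrow> 'a" where
  "conj a b = neg (imp a (neg b))"

definition dia :: "'a \<Rightarrow> 'a" where
  "dia a = neg (box (neg a))"

text \<open>The conjunction of a finite set \<open>X\<close> of formulas takes its elements in increasing order,
  starting from \<open>verum\<close>: \<open>F n\<close> is the conjunction of the elements of \<open>X\<close> below \<open>n\<close>.\<close>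

definition conj_seq :: "'a set \<Rightarrow> 'a set \<Rightarrow> bool" where
  "conj_seq X F \<longleftrightarrow> is_function F UNIV Fml \<and> app F \<zero> = verum \<and>
     (\<forall>n. app F (n \<oplus> \<one>) = (if n \<in> X then conj (app F n) n else app F n))"

definition big_conj :: "'a set \<Rightarrow> 'a" where
  "big_conj X = (THE c. \<exists>F\<in>SS. \<exists>k. conj_seq X F \<and> bounded_by X k \<and> c = app F k)"


section \<open>Kripke models\<close>

definition rel :: "'a set \<Rightarrow> 'a \<Rightarrow> 'a \<Rightarrow> bool" where
  "rel R x y \<longleftrightarrow> pair x y \<in> R"

definition val :: "'a kripke \<Rightarrow> 'a \<Rightarrow> 'a \<Rightarrow> 'a" where
  "val K w a = app (Val K) (pair w a)"

definition kripke_model :: "'a kripke \<Rightarrow> bool" where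
  "kripke_model K \<longleftrightarrow>
     Wld K \<in> SS \<and> Wld K \<noteq> {} \<and>
     Acc K \<in> SS \<and> Acc K \<subseteq> cprod (Wld K) (Wld K) \<and>
     is_function (Val K) (cprod (Wld K) Fml) {\<zero>, \<one>} \<and>
     (\<forall>w\<in>Wld K. \<forall>a\<in>Fml. \<forall>b\<in>Fml.
        val K w falsum = \<zero> \<and>
        val K w (imp a b) = \<one> \<ominus> val K w a \<otimes> (\<one> \<ominus> val K w b) \<and>
        (val K w (box a) = \<one> \<longleftrightarrow> (\<forall>v\<in>Wld K. rel (Acc K) w v \<longrightarrow> val K v a = \<one>)))"

definition pointed_model :: "'a kripke \<Rightarrow> 'a \<Rightarrow> bool" where
  "pointed_model K w \<longleftrightarrow> kripke_model K \<and> w \<in> Wld K"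

definition forces :: "'a kripke \<Rightarrow> 'a \<Rightarrow> 'a \<Rightarrow> bool" where
  "forces K w a \<longleftrightarrow> val K w a = \<one>"

definition forces_all :: "'a kripke \<Rightarrow> 'a \<Rightarrow> 'a set \<Rightarrow> bool" where
  "forces_all K w \<Gamma> \<longleftrightarrow> (\<forall>a\<in>\<Gamma>. forces K w a)"

definition successors :: "'a kripke \<Rightarrow> 'a \<Rightarrow> 'a set" where
  "successors K w = {v \<in> Wld K. rel (Acc K) w v}"

definition image_finite :: "'a kripke \<Rightarrow> bool" where
  "image_finite K \<longleftrightarrow> (\<forall>w\<in>Wld K. finite_set (successors K w))"

definition modally_saturated :: "'a kripke \<Rightarrow> bool" where
  "modally_saturated K \<longleftrightarrow>
     (\<forall>w\<in>Wld K. \<forall>\<Gamma>\<in>SS. \<Gamma> \<subseteq> Fml \<longrightarrow>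
        (\<forall>\<Gamma>\<^sub>0. finite_set \<Gamma>\<^sub>0 \<and> \<Gamma>\<^sub>0 \<subseteq> \<Gamma> \<longrightarrow> forces K w (dia (big_conj \<Gamma>\<^sub>0))) \<longrightarrow>
        (\<exists>u\<in>successors K w. forces_all K u \<Gamma>))"

definition modally_equivalent :: "'a kripke \<Rightarrow> 'a \<Rightarrow> 'a kripke \<Rightarrow> 'a \<Rightarrow> bool" where
  "modally_equivalent K w K' w' \<longleftrightarrow> (\<forall>a\<in>Fml. val K w a = \<one> \<longleftrightarrow> val K' w' a = \<one>)"

definition bisimulation :: "'a set \<Rightarrow> 'a kripke \<Rightarrow> 'a kripke \<Rightarrow> bool" where
  "bisimulation Z K K' \<longleftrightarrow>
     Z \<in> SS \<and> Z \<noteq> {} \<and> Z \<subseteq> cprod (Wld K) (Wld K') \<and>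
     (\<forall>v v'. rel Z v v' \<longrightarrow> (\<forall>p\<in>Prop. val K v p = \<one> \<longleftrightarrow> val K' v' p = \<one>)) \<and>
     (\<forall>v v' u. rel Z v v' \<and> rel (Acc K) v u \<longrightarrow> (\<exists>u'. rel Z u u' \<and> rel (Acc K') v' u')) \<and>
     (\<forall>v v' u'. rel Z v v' \<and> rel (Acc K') v' u' \<longrightarrow> (\<exists>u. rel Z u u' \<and> rel (Acc K) v u))"

definition bisimilar :: "'a kripke \<Rightarrow> 'a \<Rightarrow> 'a kripke \<Rightarrow> 'a \<Rightarrow> bool" where
  "bisimilar K w K' w' \<longleftrightarrow> (\<exists>Z\<in>SS. bisimulation Z K K' \<and> rel Z w w')"

definition hennessy_milner_saturated :: bool where
  "hennessy_milner_saturated \<longleftrightarrow>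
     (\<forall>K w K' w'.
        pointed_model K w \<and> modally_saturated K \<and> pointed_model K' w' \<and> modally_saturated K' \<longrightarrow>
        (modally_equivalent K w K' w' \<longleftrightarrow> bisimilar K w K' w'))"

definition hennessy_milner_image_finite :: bool where
  "hennessy_milner_image_finite \<longleftrightarrow>
     (\<forall>K w K' w'.
        pointed_model K w \<and> image_finite K \<and> pointed_model K' w' \<and> image_finite K' \<longrightarrow>
        (modally_equivalent K w K' w' \<longleftrightarrow> bisimilar K w K' w'))"

end

end

theory Submission
  imports Defs
begin

text \<open>The implications proved are (1) to (2) to (3) to (1), inside an arbitrary, possibly nonstandard, structure
that satisfies \<open>RCA0\<close>.

\<^item> \<^bold>\<open>(1) to (2).\<close> Arithmetical comprehension makes modal equivalence of worlds into a set. If \<open>v\<close> and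
  \<open>v'\<close> are equivalent and \<open>u\<close> is a successor of \<open>v\<close>, then every finite part of the theory of \<open>u\<close> holds at
  some successor of \<open>v'\<close>, so by saturation the whole theory does (\<open>saturated_match\<close>): the set is a
  bisimulation. Conversely, bisimilar worlds agree on all formulas by \<open>\<Pi>\<^sub>1\<close> induction on formulas
  (\<open>bisimilar_equivalent\<close>).

\<^item> \<^bold>\<open>(2) to (3).\<close> An image-finite model is saturated (\<open>image_finite_saturated\<close>). If no successor satisfies
  all of \<open>\<Gamma>\<close>, each of the boundedly many successors refutes a member of \<open>\<Gamma>\<close>, and \<open>\<Sigma>\<^sub>1\<close> induction
  bounds these members at once; the members of \<open>\<Gamma>\<close> below that bound form a finite set that no
  successor satisfies.

\<^item> \<^bold>\<open>(3) to (1).\<close> Let \<open>A\<close> be the projection of a set of pairs. One image-finite model is built with two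
  roots that are modally equivalent but such that every bisimulation that relates the roots has to
  answer, for each \<open>n\<close>, whether \<open>n \<in> A\<close> (\<open>hm_model_bisimulation\<close>). An infinite spine leads from
  the left root through worlds \<open>left n\<close>, another one from the right root through worlds \<open>right n\<close>. A world
  \<open>probe n\<close> sees a reflexive world, and, if \<open>n \<in> A\<close> with least witness \<open>a\<close>, also the top of a
  chain of length \<open>a\<close>. Both \<open>left n\<close> and \<open>right n\<close> see \<open>probe n\<close>; \<open>left n\<close> always sees a reflexive
  world, \<open>right n\<close> sees one only if \<open>n \<in> A\<close>. If \<open>n \<notin> A\<close>, the reflexive world has no partner but
  \<open>probe n\<close>; if \<open>n \<in> A\<close>, the two are not bisimilar. The valuation is computable although \<open>A\<close> is
  not, because a formula with code at most \<open>a\<close> cannot tell a chain of length \<open>a\<close> from the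
  reflexive world (\<open>holds_chain\<close>): searching for witnesses below the code of the formula suffices.
  Once all projections of sets are sets, quantifiers can be eliminated from arithmetical
  formulas one by one in favour of set parameters (\<open>delta0_sat\<close>).

Two tools make this possible in \<open>RCA0\<close>. The first is a semantic form of definability by bounded
formulas (\<open>delta0\<close>) that allows the axiom schemata to be applied to predicates rather than to formulas.
The second is course-of-values recursion (\<open>set_recursion\<close>), which yields both the codes of finite
conjunctions and the valuation of the model. Finite approximations are coded by divisibility:
\<open>u\<close> belongs to the set coded by \<open>(a, b)\<close> iff \<open>(u + 1) b + 1\<close> divides \<open>a\<close>.\<close>

section \<open>Predicates definable by bounded formulas\<close>

definition finite_support :: "((nat \<Rightarrow> 'a) \<Rightarrow> 'b) \<Rightarrow> bool" where
  "finite_support f \<longleftrightarrow> (\<exists>N. \<forall>e e'. (\<forall>i<N. e i = e' i) \<longrightarrow> f e = f e')"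

lemma finite_support_var: "finite_support (\<lambda>e. e i)"
  unfolding finite_support_def by blast

lemma finite_support_const: "finite_support (\<lambda>e. c)"
  unfolding finite_support_def by blast

lemma finite_support_comp:
  assumes "finite_support f" "finite_support g"
  shows "finite_support (\<lambda>e. h (f e) (g e))"
proof -
  obtain m n where "\<forall>e e'. (\<forall>i<m. e i = e' i) \<longrightarrow> f e = f e'"
    "\<forall>e e'. (\<forall>i<n. e i = e' i) \<longrightarrow> g e = g e'"
    using assms unfolding finite_support_def by blast
  then have "(\<forall>i<max m n. e i = e' i) \<longrightarrow> h (f e) (g e) = h (f e') (g e')" for e e'
    by (metis less_max_iff_disj)
  then show ?thesis unfolding finite_support_def by blast
qed

context l2 begin

text \<open>The functions and predicates of an environment that are given by terms and by bounded formulas, with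
arbitrary number and set parameters. Variables are handled in the style of de Bruijn: under a
quantifier the bound variable is entry \<open>0\<close> and the surrounding environment is shifted. Thus goals
of the form \<open>delta0 (\<lambda>e. ...)\<close> can be decomposed by plain introduction rules, and no
formula has to be written down.\<close>

inductive poly_fun :: "((nat \<Rightarrow> 'a) \<Rightarrow> 'a) \<Rightarrow> bool" where
  poly_var: "poly_fun (\<lambda>e. e i)"
| poly_const: "poly_fun (\<lambda>e. c)"
| poly_add: "poly_fun f \<Longrightarrow> poly_fun g \<Longrightarrow> poly_fun (\<lambda>e. f e \<oplus> g e)"
| poly_mul: "poly_fun f \<Longrightarrow> poly_fun g \<Longrightarrow> poly_fun (\<lambda>e. f e \<otimes> g e)"

inductive delta0 :: "((nat \<Rightarrow> 'a) \<Rightarrow> bool) \<Rightarrow> bool" where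
  delta0_poly_eq: "poly_fun f \<Longrightarrow> poly_fun g \<Longrightarrow> delta0 (\<lambda>e. f e = g e)"
| delta0_poly_less: "poly_fun f \<Longrightarrow> poly_fun g \<Longrightarrow> delta0 (\<lambda>e. f e \<lhd> g e)"
| delta0_poly_mem: "poly_fun f \<Longrightarrow> X \<in> SS \<Longrightarrow> delta0 (\<lambda>e. f e \<in> X)"
| delta0_not: "delta0 P \<Longrightarrow> delta0 (\<lambda>e. \<not> P e)"
| delta0_and: "delta0 P \<Longrightarrow> delta0 Q \<Longrightarrow> delta0 (\<lambda>e. P e \<and> Q e)"
| delta0_poly_all: "poly_fun f \<Longrightarrow> delta0 (\<lambda>e. Q (e 0) (\<lambda>i. e (Suc i))) \<Longrightarrow>
    delta0 (\<lambda>e. \<forall>x. x \<lhd> f e \<longrightarrow> Q x e)"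

lemma poly_subst:
  assumes "poly_fun f" and "\<And>i. poly_fun (\<sigma> i)"
  shows "poly_fun (\<lambda>e. f (\<lambda>i. \<sigma> i e))"
  using assms by induction (auto intro: poly_fun.intros)

text \<open>Substitution of terms for the free variables. Renaming is the special case used most: it moves a
predicate below quantifiers.\<close>

lemma delta0_subst_poly:
  assumes "delta0 P" and "\<And>i. poly_fun (\<sigma> i)"
  shows "delta0 (\<lambda>e. P (\<lambda>i. \<sigma> i e))"
  using assms
proof (induction arbitrary: \<sigma>)
  case (delta0_poly_all f Q)
  let ?s = "\<lambda>i. case i of 0 \<Rightarrow> \<lambda>e. e 0 | Suc j \<Rightarrow> \<lambda>e. \<sigma> j (\<lambda>i. e (Suc i))"
  have "poly_fun (?s i)" for i
    using poly_subst[OF delta0_poly_all.prems, of "\<lambda>i e. e (Suc i)"] by (cases i) (auto intro: poly_var)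
  from delta0_poly_all.IH[of ?s, OF this] have "delta0 (\<lambda>e. Q (e 0) (\<lambda>i. \<sigma> i (\<lambda>i. e (Suc i))))"
    by simp
  from delta0.delta0_poly_all[OF poly_subst[OF delta0_poly_all.hyps(1) delta0_poly_all.prems] this] show ?case .
next
  case (delta0_poly_eq f g)
  show ?case by (rule delta0.delta0_poly_eq[OF poly_subst[OF delta0_poly_eq.hyps(1) delta0_poly_eq.prems]
          poly_subst[OF delta0_poly_eq.hyps(2) delta0_poly_eq.prems]])
next
  case (delta0_poly_less f g)
  show ?case by (rule delta0.delta0_poly_less[OF poly_subst[OF delta0_poly_less.hyps(1) delta0_poly_less.prems]
          poly_subst[OF delta0_poly_less.hyps(2) delta0_poly_less.prems]])
next
  case (delta0_poly_mem f X)
  show ?case by (rule delta0.delta0_poly_mem[OF poly_subst[OF delta0_poly_mem.hyps(1) delta0_poly_mem.prems] delta0_poly_mem.hyps(2)])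
next
  case (delta0_not P)
  show ?case by (rule delta0.delta0_not[OF delta0_not.IH[OF delta0_not.prems]])
next
  case (delta0_and P Q)
  show ?case by (rule delta0.delta0_and[OF delta0_and.IH(1)[OF delta0_and.prems] delta0_and.IH(2)[OF delta0_and.prems]])
qed

lemma delta0_rename: "delta0 P \<Longrightarrow> delta0 (\<lambda>e. P (\<lambda>i. e (r i)))"
  by (rule delta0_subst_poly[where \<sigma> = "\<lambda>i e. e (r i)"]) (auto intro: poly_var)

lemma poly_finite_support: "poly_fun f \<Longrightarrow> finite_support f"
  by (induction rule: poly_fun.induct) (auto intro: finite_support_var finite_support_const finite_support_comp)

text \<open>Only finitely many entries of the environment matter; this makes it possible later to fold all of
them into one number.\<close>

lemma delta0_finite_support: "delta0 P \<Longrightarrow> finite_support P"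
proof (induction rule: delta0.induct)
  case (delta0_poly_all f Q)
  obtain m where m: "\<And>e e'. (\<forall>i<m. e i = e' i) \<Longrightarrow> f e = f e'"
    using poly_finite_support[OF delta0_poly_all.hyps(1)] unfolding finite_support_def by blast
  obtain n where n: "\<And>e e'. (\<forall>i<n. e i = e' i) \<Longrightarrow>
      Q (e 0) (\<lambda>i. e (Suc i)) = Q (e' 0) (\<lambda>i. e' (Suc i))"
    using delta0_poly_all.IH unfolding finite_support_def by blast
  have Q: "Q x e = Q x e'" if "\<forall>i<n. e i = e' i" for x e e'
    using n[of "case_nat x e" "case_nat x e'"] that by (auto split: nat.splits)
  show ?case unfolding finite_support_def
  proof (intro exI[of _ "max m n"] allI impI)
    fix e e' :: "nat \<Rightarrow> 'a"
    assume "\<forall>i<max m n. e i = e' i"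
    then have "f e = f e'" "\<And>x. Q x e = Q x e'" using m Q by auto
    then show "(\<forall>x. x \<lhd> f e \<longrightarrow> Q x e) = (\<forall>x. x \<lhd> f e' \<longrightarrow> Q x e')" by simp
  qed
qed (auto intro: poly_finite_support finite_support_comp
    finite_support_comp[where h = "\<lambda>x _. x \<in> X" for X] finite_support_comp[where h = "\<lambda>x _. \<not> x"])

lemma fresh_name:
  assumes "infinite (- range r)" "finite F"
  shows "\<exists>z. z \<notin> F \<and> z \<notin> range r"
  using assms by (metis Compl_iff finite_subset subsetI)

text \<open>From semantic functions back to terms. Entry \<open>i\<close> of the environment becomes the variable named
\<open>r i\<close>, and each parameter receives a name of its own, outside \<open>range r\<close> and outside the set \<open>F\<close> of
names that are already in use. With an arbitrary \<open>r\<close> in the statement no variable ever has to be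
renamed: for a quantifier one passes from \<open>r\<close> to \<open>case_nat z r\<close> with \<open>z\<close> fresh. Fresh names exist
because \<open>r\<close> leaves out infinitely many.\<close>

lemma poly_term:
  assumes "poly_fun f" "infinite (- range r)" "finite F"
  shows "\<exists>t D c. finite D \<and> D \<inter> (F \<union> range r) = {} \<and> term_vars t \<subseteq> D \<union> range r \<and>
    (\<forall>e. (\<forall>x\<in>D. e x = c x) \<longrightarrow> eval_term e t = f (\<lambda>i. e (r i)))"
  using assms
proof (induction arbitrary: F)
  case (poly_var i)
  show ?case by (rule exI[of _ "Var (r i)"], rule exI[of _ "{}"]) auto
next
  case (poly_const c)
  obtain z where "z \<notin> F" "z \<notin> range r" using fresh_name[OF poly_const] by blast
  then show ?case by (intro exI[of _ "Var z"] exI[of _ "{z}"] exI[of _ "\<lambda>_. c"]) auto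
next
  case (poly_add f g)
  obtain t D c where 1: "finite D" "D \<inter> (F \<union> range r) = {}" "term_vars t \<subseteq> D \<union> range r"
    "\<And>e. (\<forall>x\<in>D. e x = c x) \<Longrightarrow> eval_term e t = f (\<lambda>i. e (r i))"
    using poly_add.IH(1)[OF poly_add.prems] by blast
  obtain t' D' c' where 2: "finite D'" "D' \<inter> (F \<union> D \<union> range r) = {}" "term_vars t' \<subseteq> D' \<union> range r"
    "\<And>e. (\<forall>x\<in>D'. e x = c' x) \<Longrightarrow> eval_term e t' = g (\<lambda>i. e (r i))"
    using poly_add.IH(2)[OF poly_add.prems(1), of "F \<union> D"] poly_add.prems(2) 1(1) by blast
  show ?case
    using 1 2 by (intro exI[of _ "Add t t'"] exI[of _ "D \<union> D'"] exI[of _ "\<lambda>x. if x \<in> D then c x else c' x"])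
      (auto simp: disjoint_iff)
next
  case (poly_mul f g)
  obtain t D c where 1: "finite D" "D \<inter> (F \<union> range r) = {}" "term_vars t \<subseteq> D \<union> range r"
    "\<And>e. (\<forall>x\<in>D. e x = c x) \<Longrightarrow> eval_term e t = f (\<lambda>i. e (r i))"
    using poly_mul.IH(1)[OF poly_mul.prems] by blast
  obtain t' D' c' where 2: "finite D'" "D' \<inter> (F \<union> D \<union> range r) = {}" "term_vars t' \<subseteq> D' \<union> range r"
    "\<And>e. (\<forall>x\<in>D'. e x = c' x) \<Longrightarrow> eval_term e t' = g (\<lambda>i. e (r i))"
    using poly_mul.IH(2)[OF poly_mul.prems(1), of "F \<union> D"] poly_mul.prems(2) 1(1) by blast
  show ?case
    using 1 2 by (intro exI[of _ "Mul t t'"] exI[of _ "D \<union> D'"] exI[of _ "\<lambda>x. if x \<in> D then c x else c' x"])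
      (auto simp: disjoint_iff)
qed

text \<open>\<open>\<phi>\<close> defines \<open>P\<close> when variable \<open>r i\<close> carries entry \<open>i\<close> of the environment, the number variables in
\<open>D\<close> carry the parameters \<open>c\<close>, and the set variables in \<open>G\<close> carry the parameters \<open>C\<close>.\<close>

definition defines_at ::
  "(nat \<Rightarrow> nat) \<Rightarrow> nat set \<Rightarrow> (nat \<Rightarrow> 'a) \<Rightarrow> nat set \<Rightarrow> (nat \<Rightarrow> 'a set) \<Rightarrow> l2_formula \<Rightarrow>
    ((nat \<Rightarrow> 'a) \<Rightarrow> bool) \<Rightarrow> bool" where
  "defines_at r D c G C \<phi> P \<longleftrightarrow> bounded_fm \<phi> \<and> finite D \<and> D \<inter> range r = {} \<and> finite G \<and> C ` G \<subseteq> SS \<and>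
    (\<forall>e E. (\<forall>x\<in>D. e x = c x) \<longrightarrow> (\<forall>X\<in>G. E X = C X) \<longrightarrow> sat e E \<phi> = P (\<lambda>i. e (r i)))"

lemma delta0_formula:
  assumes "delta0 P" "infinite (- range r)" "finite F" "finite H"
  shows "\<exists>D c G C \<phi>. defines_at r D c G C \<phi> P \<and> D \<inter> F = {} \<and> G \<inter> H = {}"
  using assms
proof (induction arbitrary: r F H)
  case (delta0_poly_eq f g)
  obtain t D c where 1: "finite D" "D \<inter> (F \<union> range r) = {}" "term_vars t \<subseteq> D \<union> range r"
    "\<And>e. (\<forall>x\<in>D. e x = c x) \<Longrightarrow> eval_term e t = f (\<lambda>i. e (r i))"
    using poly_term[OF delta0_poly_eq.hyps(1) delta0_poly_eq.prems(1,2)] by blast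
  obtain t' D' c' where 2: "finite D'" "D' \<inter> (F \<union> D \<union> range r) = {}" "term_vars t' \<subseteq> D' \<union> range r"
    "\<And>e. (\<forall>x\<in>D'. e x = c' x) \<Longrightarrow> eval_term e t' = g (\<lambda>i. e (r i))"
    using poly_term[OF delta0_poly_eq.hyps(2) delta0_poly_eq.prems(1), of "F \<union> D"] delta0_poly_eq.prems(2) 1(1) by blast
  have "defines_at r (D \<union> D') (\<lambda>x. if x \<in> D then c x else c' x) {} C (Eq t t') (\<lambda>e. f e = g e)" for C
    unfolding defines_at_def
  proof (intro conjI allI impI)
    fix e E
    assume "\<forall>x\<in>D \<union> D'. e x = (if x \<in> D then c x else c' x)"
    then have "\<forall>x\<in>D. e x = c x" "\<forall>x\<in>D'. e x = c' x" using 2(2) by auto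
    then show "sat e E (Eq t t') = (f (\<lambda>i. e (r i)) = g (\<lambda>i. e (r i)))" using 1(4) 2(4) by simp
  qed (use 1 2 in \<open>auto intro: bounded_fm.intros\<close>)
  moreover have "(D \<union> D') \<inter> F = {}" using 1(2) 2(2) by blast
  ultimately show ?case by blast
next
  case (delta0_poly_less f g)
  obtain t D c where 1: "finite D" "D \<inter> (F \<union> range r) = {}" "term_vars t \<subseteq> D \<union> range r"
    "\<And>e. (\<forall>x\<in>D. e x = c x) \<Longrightarrow> eval_term e t = f (\<lambda>i. e (r i))"
    using poly_term[OF delta0_poly_less.hyps(1) delta0_poly_less.prems(1,2)] by blast
  obtain t' D' c' where 2: "finite D'" "D' \<inter> (F \<union> D \<union> range r) = {}" "term_vars t' \<subseteq> D' \<union> range r"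
    "\<And>e. (\<forall>x\<in>D'. e x = c' x) \<Longrightarrow> eval_term e t' = g (\<lambda>i. e (r i))"
    using poly_term[OF delta0_poly_less.hyps(2) delta0_poly_less.prems(1), of "F \<union> D"] delta0_poly_less.prems(2) 1(1) by blast
  have "defines_at r (D \<union> D') (\<lambda>x. if x \<in> D then c x else c' x) {} C (Less t t') (\<lambda>e. f e \<lhd> g e)" for C
    unfolding defines_at_def
  proof (intro conjI allI impI)
    fix e E
    assume "\<forall>x\<in>D \<union> D'. e x = (if x \<in> D then c x else c' x)"
    then have "\<forall>x\<in>D. e x = c x" "\<forall>x\<in>D'. e x = c' x" using 2(2) by auto
    then show "sat e E (Less t t') = (f (\<lambda>i. e (r i)) \<lhd> g (\<lambda>i. e (r i)))" using 1(4) 2(4) by simp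
  qed (use 1 2 in \<open>auto intro: bounded_fm.intros\<close>)
  moreover have "(D \<union> D') \<inter> F = {}" using 1(2) 2(2) by blast
  ultimately show ?case by blast
next
  case (delta0_poly_mem f X)
  obtain t D c where 1: "finite D" "D \<inter> (F \<union> range r) = {}" "term_vars t \<subseteq> D \<union> range r"
    "\<And>e. (\<forall>x\<in>D. e x = c x) \<Longrightarrow> eval_term e t = f (\<lambda>i. e (r i))"
    using poly_term[OF delta0_poly_mem.hyps(1) delta0_poly_mem.prems(1,2)] by blast
  obtain Y where "Y \<notin> H" using delta0_poly_mem.prems(3) ex_new_if_finite infinite_UNIV_nat by blast
  then show ?case
    using 1 delta0_poly_mem.hyps(2) by (intro exI[of _ D] exI[of _ c] exI[of _ "{Y}"] exI[of _ "\<lambda>_. X"]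
        exI[of _ "Mem t Y"]) (auto simp: disjoint_iff defines_at_def intro: bounded_fm.intros)
next
  case (delta0_not P)
  obtain D c G C \<phi> where 1: "defines_at r D c G C \<phi> P" "D \<inter> F = {}" "G \<inter> H = {}"
    using delta0_not.IH[OF delta0_not.prems] by blast
  then have "defines_at r D c G C (Neg \<phi>) (\<lambda>e. \<not> P e)"
    by (simp add: defines_at_def bounded_fm.intros)
  with 1 show ?case by blast
next
  case (delta0_and P Q)
  obtain D c G C \<phi> where 1: "defines_at r D c G C \<phi> P" "D \<inter> F = {}" "G \<inter> H = {}"
    using delta0_and.IH(1)[OF delta0_and.prems] by blast
  then have fin: "finite (F \<union> D)" "finite (H \<union> G)" using delta0_and.prems by (auto simp: defines_at_def)
  obtain D' c' G' C' \<psi> where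
    2: "defines_at r D' c' G' C' \<psi> Q" "D' \<inter> (F \<union> D) = {}" "G' \<inter> (H \<union> G) = {}"
    using delta0_and.IH(2)[OF delta0_and.prems(1) fin] by blast
  have "defines_at r (D \<union> D') (\<lambda>x. if x \<in> D then c x else c' x)
      (G \<union> G') (\<lambda>X. if X \<in> G then C X else C' X) (Conj \<phi> \<psi>) (\<lambda>e. P e \<and> Q e)"
    unfolding defines_at_def
  proof (intro conjI allI impI)
    fix e E
    assume "\<forall>x\<in>D \<union> D'. e x = (if x \<in> D then c x else c' x)"
      and "\<forall>X\<in>G \<union> G'. E X = (if X \<in> G then C X else C' X)"
    then have "\<forall>x\<in>D. e x = c x" "\<forall>x\<in>D'. e x = c' x" "\<forall>X\<in>G. E X = C X" "\<forall>X\<in>G'. E X = C' X"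
      using 2(2,3) by auto
    then show "sat e E (Conj \<phi> \<psi>) = (P (\<lambda>i. e (r i)) \<and> Q (\<lambda>i. e (r i)))"
      using 1(1) 2(1) by (simp add: defines_at_def)
  qed (use 1(1) 2(1) in \<open>auto simp: defines_at_def intro: bounded_fm.intros\<close>)
  moreover have "(D \<union> D') \<inter> F = {}" "(G \<union> G') \<inter> H = {}" using 1 2 by blast+
  ultimately show ?case by blast
next
  case (delta0_poly_all f Q)
  obtain t D c where 1: "finite D" "D \<inter> (F \<union> range r) = {}" "term_vars t \<subseteq> D \<union> range r"
    "\<And>e. (\<forall>x\<in>D. e x = c x) \<Longrightarrow> eval_term e t = f (\<lambda>i. e (r i))"
    using poly_term[OF delta0_poly_all.hyps(1) delta0_poly_all.prems(1,2)] by blast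
  have fin: "finite (F \<union> D)" using 1 delta0_poly_all.prems by simp
  obtain z where z: "z \<notin> F \<union> D" "z \<notin> range r"
    using fresh_name[OF delta0_poly_all.prems(1) fin] by blast
  have ran: "range (case_nat z r) = insert z (range r)"
    by (auto simp: image_iff split: nat.splits)
  have "- range (case_nat z r) = - range r - {z}" unfolding ran by auto
  then have "infinite (- range (case_nat z r))" using delta0_poly_all.prems(1) by simp
  from delta0_poly_all.IH[OF this fin delta0_poly_all.prems(3)] obtain D' c' G C \<phi> where
    2: "defines_at (case_nat z r) D' c' G C \<phi> (\<lambda>e. Q (e 0) (\<lambda>i. e (Suc i)))"
    "D' \<inter> (F \<union> D) = {}" "G \<inter> H = {}" by blast
  have D'z: "D' \<inter> range (case_nat z r) = {}" using 2(1) by (simp only: defines_at_def)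
  then have D': "D' \<inter> insert z (range r) = {}" by (simp only: ran)
  have \<phi>: "sat e E \<phi> = Q (e z) (\<lambda>i. e (r i))"
    if "\<forall>x\<in>D'. e x = c' x" "\<forall>X\<in>G. E X = C X" for e E
    using 2(1) that by (simp add: defines_at_def)
  have zt: "z \<notin> term_vars t" using 1(3) z by auto
  have rz: "(\<lambda>i. (e(z := a)) (r i)) = (\<lambda>i. e (r i))" for e :: "nat \<Rightarrow> 'a" and a
    using z(2) by (metis fun_upd_apply rangeI)
  have "defines_at r (D \<union> D') (\<lambda>x. if x \<in> D then c x else c' x) G C
      (AllN z (Imp (Less (Var z) t) \<phi>)) (\<lambda>e. \<forall>x. x \<lhd> f e \<longrightarrow> Q x e)"
    unfolding defines_at_def
  proof (intro conjI allI impI)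
    show "bounded_fm (AllN z (Imp (Less (Var z) t) \<phi>))"
      using 2(1) zt bounded_fm.intros(8)[of \<phi> z t] by (simp add: defines_at_def)
    fix e E
    assume e: "\<forall>x\<in>D \<union> D'. e x = (if x \<in> D then c x else c' x)" and E: "\<forall>X\<in>G. E X = C X"
    have "eval_term (e(z := a)) t = f (\<lambda>i. e (r i))" for a
      using 1(4)[of "e(z := a)"] e z(1) rz by simp
    moreover have "sat (e(z := a)) E \<phi> = Q a (\<lambda>i. e (r i))" for a
    proof -
      have "\<forall>x\<in>D'. (e(z := a)) x = c' x" using e D' 2(2) by auto
      then have "sat (e(z := a)) E \<phi> = Q ((e(z := a)) z) (\<lambda>i. (e(z := a)) (r i))"
        using \<phi> E by blast
      then show ?thesis unfolding rz by simp
    qed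
    ultimately show "sat e E (AllN z (Imp (Less (Var z) t) \<phi>)) =
        (\<forall>x. x \<lhd> f (\<lambda>i. e (r i)) \<longrightarrow> Q x (\<lambda>i. e (r i)))" by simp
  next
    show "(D \<union> D') \<inter> range r = {}" using 1(2) D' by blast
  qed (use 1 2 in \<open>auto simp: defines_at_def\<close>)
  then show ?case using 1(2) 2(2,3) by blast
qed

text \<open>Two predicates of two numbers are defined over a common assignment, as needed for the two
formulas in \<open>\<Delta>\<^sub>1\<close> comprehension. Variable \<open>0\<close> is the one to be quantified, variable \<open>1\<close> the one on which
induction or comprehension acts.\<close>

lemma delta0_formula_pair:
  assumes P: "delta0 (\<lambda>e. P (e 0) (e (Suc 0)))" and Q: "delta0 (\<lambda>e. Q (e 0) (e (Suc 0)))" and "SS \<noteq> {}"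
  obtains e E \<phi> \<psi> where "range E \<subseteq> SS" "bounded_fm \<phi>" "bounded_fm \<psi>"
    "\<And>a n. sat (e(Suc 0 := n, 0 := a)) E \<phi> = P a n" "\<And>a n. sat (e(Suc 0 := n, 0 := a)) E \<psi> = Q a n"
proof -
  let ?r = "\<lambda>i. if i = 0 then 0 else Suc 0"
  have "range ?r \<subseteq> {0, Suc 0}" by auto
  then have inf: "infinite (- range ?r)" 
    by (metis finite.emptyI finite.insertI finite_subset infinite_UNIV_nat finite_compl)
  obtain D c G C \<phi> where 1: "defines_at ?r D c G C \<phi> (\<lambda>e. P (e 0) (e (Suc 0)))"
    using delta0_formula[OF P inf, of "{}" "{}"] by auto
  have fin: "finite D" "finite G" using 1 by (auto simp: defines_at_def)
  obtain D' c' G' C' \<psi> where 2: "defines_at ?r D' c' G' C' \<psi> (\<lambda>e. Q (e 0) (e (Suc 0)))"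
    "D' \<inter> D = {}" "G' \<inter> G = {}"
    using delta0_formula[OF Q inf fin] by blast
  obtain S where "S \<in> SS" using assms(3) by blast
  let ?e = "\<lambda>x. if x \<in> D then c x else c' x"
  let ?E = "\<lambda>X. if X \<in> G then C X else if X \<in> G' then C' X else S"
  have D: "0 \<notin> D \<union> D'" "Suc 0 \<notin> D \<union> D'" using 1 2 unfolding defines_at_def by auto
  show thesis
  proof (rule that[of ?E \<phi> \<psi> ?e])
    show "range ?E \<subseteq> SS" using 1 2 \<open>S \<in> SS\<close> by (auto simp: defines_at_def)
    have 3: "sat e E \<phi> = P (e 0) (e (Suc 0))"
      if "\<forall>x\<in>D. e x = c x" "\<forall>X\<in>G. E X = C X" for e E
      using 1 that by (simp add: defines_at_def)
    have 4: "sat e E \<psi> = Q (e 0) (e (Suc 0))"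
      if "\<forall>x\<in>D'. e x = c' x" "\<forall>X\<in>G'. E X = C' X" for e E
      using 2(1) that by (simp add: defines_at_def)
    fix a n
    show "sat (?e(Suc 0 := n, 0 := a)) ?E \<phi> = P a n"
      by (subst 3) (use D in auto)
    show "sat (?e(Suc 0 := n, 0 := a)) ?E \<psi> = Q a n"
      by (subst 4) (use D 2 in auto)
  qed (use 1 2 in \<open>auto simp: defines_at_def\<close>)
qed

end

section \<open>The axioms as rules for predicates\<close>

locale rca0 = l2 M for M :: "'a l2_structure" +
  assumes RCA0: "RCA0"
begin

lemma sets_nonempty: "SS \<noteq> {}" and robinson: robinson
  using RCA0 by (auto simp: RCA0_def)

lemma sigma01_induct:
  assumes "delta0 (\<lambda>e. P (e 0) (e (Suc 0)))" and "\<exists>a. P a \<zero>" and "\<And>n a. P a n \<Longrightarrow> \<exists>b. P b (n \<oplus> \<one>)"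
  shows "\<exists>a. P a n"
proof -
  obtain e E \<phi> where E: "range E \<subseteq> SS" and \<phi>: "bounded_fm \<phi>"
    and sat: "\<And>a n. sat (e(Suc 0 := n, 0 := a)) E \<phi> = P a n"
    by (rule delta0_formula_pair[OF assms(1,1) sets_nonempty]) blast
  have eq: "sat (e(Suc 0 := n)) E (ExN 0 \<phi>) = (\<exists>a. P a n)" for n
    using sat by simp
  have "sigma01 (ExN 0 \<phi>)" using \<phi> by (auto simp: sigma01_def)
  then have "(\<exists>a. P a \<zero>) \<and> (\<forall>n. (\<exists>a. P a n) \<longrightarrow> (\<exists>a. P a (n \<oplus> \<one>))) \<longrightarrow> (\<forall>n. \<exists>a. P a n)"
    using RCA0 E unfolding RCA0_def sigma01_induction_def eq[symmetric] by blast
  then show ?thesis using assms(2,3) by blast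
qed

lemma delta01_set:
  assumes "delta0 (\<lambda>e. P (e 0) (e (Suc 0)))" "delta0 (\<lambda>e. Q (e 0) (e (Suc 0)))"
    and PQ: "\<And>n. (\<exists>a. P a n) \<longleftrightarrow> (\<forall>a. Q a n)"
  shows "{n. \<exists>a. P a n} \<in> SS"
proof -
  obtain e E \<phi> \<psi> where E: "range E \<subseteq> SS" and \<phi>: "bounded_fm \<phi>" "bounded_fm \<psi>"
    and sat: "\<And>a n. sat (e(Suc 0 := n, 0 := a)) E \<phi> = P a n"
      "\<And>a n. sat (e(Suc 0 := n, 0 := a)) E \<psi> = Q a n"
    by (rule delta0_formula_pair[OF assms(1,2) sets_nonempty]) blast
  have eq: "sat (e(Suc 0 := n)) E (ExN 0 \<phi>) = (\<exists>a. P a n)"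
    "sat (e(Suc 0 := n)) E (AllN 0 \<psi>) = (\<forall>a. Q a n)" for n
    using sat by simp_all
  have "sigma01 (ExN 0 \<phi>)" "pi01 (AllN 0 \<psi>)" using \<phi> by (auto simp: sigma01_def pi01_def)
  then obtain X where "X \<in> SS" "\<forall>n. n \<in> X \<longleftrightarrow> sat (e(Suc 0 := n)) E (ExN 0 \<phi>)"
    using RCA0 E PQ unfolding RCA0_def delta01_comprehension_def eq[symmetric] by blast
  moreover from this(2) have "X = {n. \<exists>a. P a n}" unfolding eq by blast
  ultimately show ?thesis by simp
qed

lemma delta0_comprehension:
  assumes "delta0 (\<lambda>e. P (e 0))"
  shows "{n. P n} \<in> SS"
  using delta01_set[of "\<lambda>_. P" "\<lambda>_. P"] delta0_rename[OF assms, of Suc] by simp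

lemma delta0_induct:
  assumes "delta0 (\<lambda>e. P (e 0))" "P \<zero>" "\<And>n. P n \<Longrightarrow> P (n \<oplus> \<one>)"
  shows "P n"
  using sigma01_induct[of "\<lambda>_. P" n] delta0_rename[OF assms(1), of Suc] assms(2,3) by simp

definition nle :: "'a \<Rightarrow> 'a \<Rightarrow> bool" (infix "\<unlhd>" 50) where
  "x \<unlhd> y \<longleftrightarrow> x \<lhd> y \<or> x = y"

section \<open>Arithmetic\<close>

lemma delta0_or:
  assumes "delta0 P" "delta0 Q"
  shows "delta0 (\<lambda>e. P e \<or> Q e)"
  using delta0_not[OF delta0_and[OF delta0_not[OF assms(1)] delta0_not[OF assms(2)]]] by simp

lemma delta0_imp:
  assumes "delta0 P" "delta0 Q"
  shows "delta0 (\<lambda>e. P e \<longrightarrow> Q e)"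
  using delta0_not[OF delta0_and[OF assms(1) delta0_not[OF assms(2)]]] by simp

lemma delta0_iff:
  assumes "delta0 P" "delta0 Q"
  shows "delta0 (\<lambda>e. P e \<longleftrightarrow> Q e)"
  using delta0_and[OF delta0_imp[OF assms] delta0_imp[OF assms(2,1)]] by (simp add: iff_conv_conj_imp)

lemmas delta0_poly_intros = delta0_poly_eq delta0_poly_less delta0_poly_mem
  delta0_not delta0_and delta0_or delta0_imp delta0_iff poly_fun.intros

lemma succ_neq_zero: "m \<oplus> \<one> \<noteq> \<zero>"
  and succ_inject: "m \<oplus> \<one> = n \<oplus> \<one> \<Longrightarrow> m = n"
  and nonzero_succ: "m \<noteq> \<zero> \<Longrightarrow> \<exists>n. m = n \<oplus> \<one>"
  and plus_zero: "m \<oplus> \<zero> = m"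
  and plus_succ: "m \<oplus> (n \<oplus> \<one>) = (m \<oplus> n) \<oplus> \<one>"
  and times_zero: "m \<otimes> \<zero> = \<zero>"
  and times_succ: "m \<otimes> (n \<oplus> \<one>) = m \<otimes> n \<oplus> m"
  and not_less_zero: "\<not> m \<lhd> \<zero>"
  and less_succ: "m \<lhd> n \<oplus> \<one> \<longleftrightarrow> m \<unlhd> n"
  using robinson unfolding robinson_def nle_def by blast+

lemma plus_assoc: "(x \<oplus> y) \<oplus> z = x \<oplus> (y \<oplus> z)"
  by (rule delta0_induct[where P = "\<lambda>z. (x \<oplus> y) \<oplus> z = x \<oplus> (y \<oplus> z)"])
    (auto intro!: delta0_poly_intros simp: plus_zero plus_succ)

lemma zero_plus: "\<zero> \<oplus> x = x"
  by (rule delta0_induct[where P = "\<lambda>x. \<zero> \<oplus> x = x"])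
    (auto intro!: delta0_poly_intros simp: plus_zero plus_succ)

lemma succ_plus: "(x \<oplus> \<one>) \<oplus> y = (x \<oplus> y) \<oplus> \<one>"
  by (rule delta0_induct[where P = "\<lambda>y. (x \<oplus> \<one>) \<oplus> y = (x \<oplus> y) \<oplus> \<one>"])
    (auto intro!: delta0_poly_intros simp: plus_zero plus_succ)

lemma plus_commute: "x \<oplus> y = y \<oplus> x"
  by (rule delta0_induct[where P = "\<lambda>y. x \<oplus> y = y \<oplus> x"])
    (auto intro!: delta0_poly_intros simp: plus_zero zero_plus plus_succ succ_plus)

lemma plus_cancel: "x \<oplus> z = y \<oplus> z \<Longrightarrow> x = y"
proof -
  have "\<not> (x \<oplus> z = y \<oplus> z \<and> x \<noteq> y)"
    by (rule delta0_induct[where P = "\<lambda>z. \<not> (x \<oplus> z = y \<oplus> z \<and> x \<noteq> y)"])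
      (auto intro!: delta0_poly_intros simp: plus_zero plus_succ dest: succ_inject)
  then show "x \<oplus> z = y \<oplus> z \<Longrightarrow> x = y" by blast
qed

lemma times_plus: "x \<otimes> (y \<oplus> z) = x \<otimes> y \<oplus> x \<otimes> z"
  by (rule delta0_induct[where P = "\<lambda>z. x \<otimes> (y \<oplus> z) = x \<otimes> y \<oplus> x \<otimes> z"])
    (auto intro!: delta0_poly_intros simp: plus_zero times_zero times_succ plus_assoc[symmetric])

lemma zero_times: "\<zero> \<otimes> x = \<zero>"
  by (rule delta0_induct[where P = "\<lambda>x. \<zero> \<otimes> x = \<zero>"])
    (auto intro!: delta0_poly_intros simp: plus_zero times_zero times_succ)

lemma plus_left_commute: "x \<oplus> (y \<oplus> z) = y \<oplus> (x \<oplus> z)"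
  by (metis plus_assoc plus_commute)

lemma succ_times: "(x \<oplus> \<one>) \<otimes> y = x \<otimes> y \<oplus> y"
  by (rule delta0_induct[where P = "\<lambda>y. (x \<oplus> \<one>) \<otimes> y = x \<otimes> y \<oplus> y"])
    (auto intro!: delta0_poly_intros simp: plus_zero times_zero times_succ plus_assoc plus_commute plus_left_commute)

lemma times_commute: "x \<otimes> y = y \<otimes> x"
  by (rule delta0_induct[where P = "\<lambda>y. x \<otimes> y = y \<otimes> x"])
    (auto intro!: delta0_poly_intros simp: times_zero zero_times times_succ succ_times)

lemma one_times: "\<one> \<otimes> x = x"
  using times_succ[of x \<zero>] by (simp add: times_zero zero_plus times_commute[of \<one>])

lemma times_one: "x \<otimes> \<one> = x"
  using one_times times_commute by metis

lemma times_assoc: "(x \<otimes> y) \<otimes> z = x \<otimes> (y \<otimes> z)"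
  by (rule delta0_induct[where P = "\<lambda>z. (x \<otimes> y) \<otimes> z = x \<otimes> (y \<otimes> z)"])
    (auto intro!: delta0_poly_intros simp: times_zero times_plus times_succ times_one)

text \<open>The order axioms only give a recursion for \<open>\<lhd>\<close>. Its description by addition is obtained from \<open>\<Sigma>\<^sub>1\<close>
induction, the difference being the witness.\<close>

lemma less_iff_plus: "x \<lhd> y \<longleftrightarrow> (\<exists>z. y = x \<oplus> (z \<oplus> \<one>))"
proof
  have "\<exists>z. \<not> (x \<lhd> y \<and> y \<noteq> x \<oplus> (z \<oplus> \<one>))"
  proof (rule sigma01_induct[where P = "\<lambda>z y. \<not> (x \<lhd> y \<and> y \<noteq> x \<oplus> (z \<oplus> \<one>))"])
    fix n a
    assume "\<not> (x \<lhd> n \<and> n \<noteq> x \<oplus> (a \<oplus> \<one>))"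
    then show "\<exists>b. \<not> (x \<lhd> n \<oplus> \<one> \<and> n \<oplus> \<one> \<noteq> x \<oplus> (b \<oplus> \<one>))"
      by (metis less_succ nle_def plus_assoc plus_commute plus_zero)
  qed (auto intro!: delta0_poly_intros simp: not_less_zero)
  then show "x \<lhd> y \<Longrightarrow> \<exists>z. y = x \<oplus> (z \<oplus> \<one>)" by blast
next
  have "x \<lhd> x \<oplus> (z \<oplus> \<one>)" for z
    by (rule delta0_induct[where P = "\<lambda>z. x \<lhd> x \<oplus> (z \<oplus> \<one>)"])
      (auto intro!: delta0_poly_intros simp: zero_plus less_succ plus_succ nle_def)
  then show "\<exists>z. y = x \<oplus> (z \<oplus> \<one>) \<Longrightarrow> x \<lhd> y" by blast
qed

lemma le_iff_plus: "x \<unlhd> y \<longleftrightarrow> (\<exists>z. y = x \<oplus> z)"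
  unfolding nle_def by (metis less_iff_plus plus_zero nonzero_succ)

lemma le_total: "x \<unlhd> y \<or> y \<unlhd> x"
proof -
  have "\<not> (\<not> x \<lhd> y \<and> x \<noteq> y \<and> \<not> y \<lhd> x)"
  proof (rule delta0_induct[where P = "\<lambda>x. \<not> (\<not> x \<lhd> y \<and> x \<noteq> y \<and> \<not> y \<lhd> x)"])
    show "\<not> (\<not> \<zero> \<lhd> y \<and> \<zero> \<noteq> y \<and> \<not> y \<lhd> \<zero>)" using le_iff_plus zero_plus nle_def by metis
    fix n assume "\<not> (\<not> n \<lhd> y \<and> n \<noteq> y \<and> \<not> y \<lhd> n)"
    moreover have "n \<oplus> \<one> \<unlhd> y" if "n \<lhd> y"
      using that unfolding less_iff_plus[of n] le_iff_plus by (metis plus_assoc plus_commute)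
    ultimately show "\<not> (\<not> n \<oplus> \<one> \<lhd> y \<and> n \<oplus> \<one> \<noteq> y \<and> \<not> y \<lhd> n \<oplus> \<one>)" using less_succ nle_def by blast
  qed (auto intro!: delta0_poly_intros)
  then show ?thesis unfolding nle_def by blast
qed

lemma less_irrefl: "\<not> x \<lhd> x"
  by (metis less_iff_plus plus_cancel plus_commute succ_neq_zero zero_plus)

lemma nless_trans: "x \<lhd> y \<Longrightarrow> y \<lhd> z \<Longrightarrow> x \<lhd> z"
  unfolding less_iff_plus by (metis plus_assoc)

lemma monus_plus: "(z \<oplus> y) \<ominus> y = z"
  unfolding monus_def
proof (rule the_equality)
  fix u assume "u \<oplus> y = z \<oplus> y \<or> z \<oplus> y \<lhd> y \<and> u = \<zero>"
  then show "u = z"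
    using plus_cancel le_iff_plus[of y "z \<oplus> y"] less_irrefl nless_trans plus_commute nle_def by metis
qed simp

lemma monus_less: "x \<lhd> y \<Longrightarrow> x \<ominus> y = \<zero>"
  unfolding monus_def
proof (rule the_equality)
  fix u assume "x \<lhd> y" "u \<oplus> y = x \<or> x \<lhd> y \<and> u = \<zero>"
  then show "u = \<zero>" using le_iff_plus[of y x] less_irrefl nless_trans plus_commute nle_def by metis
qed simp

lemma monus_cases:
  obtains "x \<lhd> y" "x \<ominus> y = \<zero>" | z where "x = z \<oplus> y" "x \<ominus> y = z"
  using le_total[of x y] monus_less monus_plus le_iff_plus plus_commute nle_def by metis

lemma monus_monus: "x \<ominus> y \<ominus> z = x \<ominus> (y \<oplus> z)"
proof (cases x y rule: monus_cases)
  case 1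
  then have "x \<lhd> y \<oplus> z" using le_iff_plus[of y "y \<oplus> z"] nless_trans nle_def by metis
  moreover have "\<zero> \<ominus> z = \<zero>"
    by (cases \<zero> z rule: monus_cases) (metis, metis le_iff_plus nle_def not_less_zero)
  ultimately show ?thesis using 1 by (simp add: monus_less)
next
  case (2 u)
  show ?thesis
  proof (cases u z rule: monus_cases)
    case 1
    then have "x \<lhd> y \<oplus> z" unfolding 2 less_iff_plus by (metis plus_assoc plus_commute)
    with 1 2 show ?thesis by (simp add: monus_less monus_plus)
  next
    case (2 v)
    then have "x = v \<oplus> (y \<oplus> z)" using \<open>x = u \<oplus> y\<close> plus_assoc plus_commute by metis
    then show ?thesis using \<open>x \<ominus> y = u\<close> 2 by (simp add: monus_plus)
  qed
qed

lemma times_less: "a \<lhd> b \<Longrightarrow> \<zero> \<lhd> c \<Longrightarrow> c \<otimes> a \<lhd> c \<otimes> b"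
  unfolding less_iff_plus zero_plus by (metis times_plus times_succ plus_assoc)

lemma times_monus: "x \<otimes> (y \<ominus> z) = x \<otimes> y \<ominus> x \<otimes> z"
proof (cases y z rule: monus_cases)
  case 1
  have "x \<otimes> y \<ominus> x \<otimes> z = \<zero>"
  proof (cases "x = \<zero>")
    case True
    then show ?thesis using monus_plus[of \<zero> \<zero>] by (simp add: zero_times plus_zero)
  next
    case False
    then have "\<zero> \<lhd> x" using le_iff_plus[of \<zero> x] zero_plus nle_def by metis
    then show ?thesis using 1 times_less monus_less by blast
  qed
  with 1 show ?thesis by (simp add: times_zero)
next
  case (2 u)
  then show ?thesis by (simp add: times_plus monus_plus)
qed

text \<open>The numbers form the nonnegative part of a discretely ordered ring, so that the general theory of
ordered semirings applies to them.\<close>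

sublocale ar: linordered_semidom where one = "\<one>" and times = "mul_of M" and plus = "add_of M"
  and zero = "\<zero>" and less_eq = nle and less = "less_of M" and minus = "(\<ominus>)"
proof
  fix a b c
  have zl: "a \<noteq> \<zero> \<Longrightarrow> \<zero> \<lhd> a" for a using le_iff_plus[of \<zero> a] zero_plus nle_def by metis
  show "a \<oplus> b \<ominus> a = b" by (metis monus_plus plus_commute)
  show "a \<lhd> b \<longleftrightarrow> a \<unlhd> b \<and> \<not> b \<unlhd> a" unfolding nle_def by (metis less_irrefl nless_trans)
  show "a \<unlhd> b \<Longrightarrow> b \<unlhd> c \<Longrightarrow> a \<unlhd> c" unfolding nle_def by (metis nless_trans)
  show "a \<unlhd> b \<Longrightarrow> b \<unlhd> a \<Longrightarrow> a = b" unfolding nle_def by (metis less_irrefl nless_trans)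
  show "a \<unlhd> b \<Longrightarrow> c \<oplus> a \<unlhd> c \<oplus> b" unfolding le_iff_plus by (metis plus_assoc)
  show "\<zero> \<noteq> \<one>" using succ_neq_zero[of \<zero>] zero_plus by metis
  then show "\<zero> \<lhd> \<one>" using zl by metis
  show "a \<noteq> \<zero> \<Longrightarrow> b \<noteq> \<zero> \<Longrightarrow> a \<otimes> b \<noteq> \<zero>" using times_less[of \<zero> b a] zl times_zero less_irrefl by metis
  show "(a \<oplus> b) \<otimes> c = a \<otimes> c \<oplus> b \<otimes> c" by (metis times_plus times_commute)
  show "b \<unlhd> a \<Longrightarrow> a \<ominus> b \<oplus> b = a" unfolding le_iff_plus by (metis monus_plus plus_commute)
  show "a \<unlhd> b \<or> b \<unlhd> a" by (rule le_total)
  show "a \<otimes> b \<otimes> c = a \<otimes> (b \<otimes> c)" by (rule times_assoc)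
  show "a \<otimes> b = b \<otimes> a" by (rule times_commute)
  show "\<one> \<otimes> a = a" by (rule one_times)
  show "a \<oplus> b \<oplus> c = a \<oplus> (b \<oplus> c)" by (rule plus_assoc)
  show "a \<oplus> b = b \<oplus> a" by (rule plus_commute)
  show "a \<lhd> b \<Longrightarrow> \<zero> \<lhd> c \<Longrightarrow> c \<otimes> a \<lhd> c \<otimes> b" by (rule times_less)
qed (simp_all add: zero_plus zero_times times_zero times_plus monus_monus times_monus nle_def)

text \<open>Sums of ones are to stay in the form in which the codes of formulas use them.\<close>

declare ar.one_add_one [simp del]

lemmas arith_ac = ar.add.assoc ar.add.commute ar.add.left_commute
  ar.mult.assoc ar.mult.commute ar.mult.left_commute
lemmas ring_simps = arith_ac ar.distrib_left ar.distrib_right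

lemma zero_le [simp]: "\<zero> \<unlhd> x"
  using le_iff_plus[of \<zero> x] by simp

lemma le_plus [simp]: "x \<unlhd> x \<oplus> y" "x \<unlhd> y \<oplus> x"
  by (simp_all add: ar.add_increasing ar.add_increasing2)

lemma less_plus_one [simp]: "x \<lhd> x \<oplus> \<one>"
  by (simp add: less_succ)

lemma less_iff_succ_le: "x \<lhd> y \<longleftrightarrow> x \<oplus> \<one> \<unlhd> y"
  unfolding less_iff_plus[of x] le_iff_plus by (simp add: ar.add.assoc ar.add.commute[of \<one>])

section \<open>Bounded definability with defined functions\<close>

lemma delta0_const: "delta0 (\<lambda>e. b)"
proof (cases b)
  case True
  have "delta0 (\<lambda>e. \<zero> = \<zero>)" by (intro delta0_poly_eq poly_const)
  with True show ?thesis by simp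
next
  case False
  have "delta0 (\<lambda>e. \<zero> = \<one>)" by (intro delta0_poly_eq poly_const)
  with False show ?thesis by simp
qed

lemma delta0_poly_ex:
  assumes "poly_fun f" "delta0 (\<lambda>e. Q (e 0) (\<lambda>i. e (Suc i)))"
  shows "delta0 (\<lambda>e. \<exists>x. x \<lhd> f e \<and> Q x e)"
proof -
  have "delta0 (\<lambda>e. \<not> (\<forall>x. x \<lhd> f e \<longrightarrow> \<not> Q x e))"
    by (intro delta0_not delta0_poly_all assms)
  then show ?thesis by simp
qed

text \<open>A function with a bounded graph and a polynomial bound can be substituted into bounded predicates:
\<open>Q (f e) e\<close> is equivalent to \<open>\<exists>x < t e. x = f e \<and> Q x e\<close>. The pairing function and the constructors of
formulas are of this kind, although they are not terms.\<close>

definition delta0_fun :: "((nat \<Rightarrow> 'a) \<Rightarrow> 'a) \<Rightarrow> bool" where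
  "delta0_fun f \<longleftrightarrow> (\<exists>t. poly_fun t \<and> (\<forall>e. f e \<lhd> t e)) \<and> delta0 (\<lambda>e. e 0 = f (\<lambda>i. e (Suc i)))"

lemma delta0_fun_poly:
  assumes "poly_fun f"
  shows "delta0_fun f"
  unfolding delta0_fun_def
proof
  show "\<exists>t. poly_fun t \<and> (\<forall>e. f e \<lhd> t e)"
    by (rule exI[of _ "\<lambda>e. f e \<oplus> \<one>"]) (simp add: assms poly_add poly_const)
  show "delta0 (\<lambda>e. e 0 = f (\<lambda>i. e (Suc i)))"
    by (intro delta0_poly_eq poly_var poly_subst[where \<sigma> = "\<lambda>i e. e (Suc i)"] assms)
qed

lemma delta0_fn_subst:
  assumes "delta0_fun f" "delta0 (\<lambda>e. Q (e 0) (\<lambda>i. e (Suc i)))"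
  shows "delta0 (\<lambda>e. Q (f e) e)"
proof -
  obtain t where t: "poly_fun t" "\<And>e. f e \<lhd> t e" using assms(1) unfolding delta0_fun_def by blast
  have "delta0 (\<lambda>e. e 0 = f (\<lambda>i. e (Suc i)))" using assms(1) unfolding delta0_fun_def by blast
  then have "delta0 (\<lambda>e. \<exists>x. x \<lhd> t e \<and> (x = f e \<and> Q x e))"
    by (intro delta0_poly_ex[where Q = "\<lambda>x e. x = f e \<and> Q x e"] delta0_and t assms(2))
  moreover have "(\<lambda>e. \<exists>x. x \<lhd> t e \<and> (x = f e \<and> Q x e)) = (\<lambda>e. Q (f e) e)"
    using t(2) by auto
  ultimately show ?thesis by simp
qed

lemma delta0_fun_rename:
  assumes "delta0_fun f"
  shows "delta0_fun (\<lambda>e. f (\<lambda>i. e (r i)))"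
proof -
  obtain t where t: "poly_fun t" "\<And>e. f e \<lhd> t e" and g: "delta0 (\<lambda>e. e 0 = f (\<lambda>i. e (Suc i)))"
    using assms(1) unfolding delta0_fun_def by blast
  have "poly_fun (\<lambda>e. t (\<lambda>i. e (r i)))"
    by (rule poly_subst[where \<sigma> = "\<lambda>i e. e (r i)"]) (use t poly_var in auto)
  moreover have "delta0 (\<lambda>e. e 0 = f (\<lambda>i. e (Suc (r i))))"
    using delta0_rename[OF g, of "case_nat 0 (\<lambda>i. Suc (r i))"] by simp
  ultimately show ?thesis using t(2) unfolding delta0_fun_def by blast
qed

lemma delta0_fn_subst2:
  assumes "delta0_fun f" "delta0_fun g" "delta0 (\<lambda>e. Q (e 0) (e (Suc 0)) (\<lambda>i. e (Suc (Suc i))))"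
  shows "delta0 (\<lambda>e. Q (f e) (g e) e)"
proof -
  have "delta0 (\<lambda>e. Q (f (\<lambda>i. e (Suc i))) (e 0) (\<lambda>i. e (Suc i)))"
  proof (rule delta0_fn_subst[OF delta0_fun_rename[OF assms(1)], where Q = "\<lambda>x e. Q x (e 0) (\<lambda>i. e (Suc i))"])
    show "delta0 (\<lambda>e. Q (e 0) (e (Suc 0)) (\<lambda>i. e (Suc (Suc i))))" by (rule assms(3))
  qed
  from delta0_fn_subst[OF assms(2), where Q = "\<lambda>y e. Q (f e) y e", OF this] show ?thesis .
qed

lemma delta0_fun_comp:
  assumes "delta0_fun f" "delta0_fun g" and h: "delta0 (\<lambda>e. e 0 = h (e (Suc 0)) (e (Suc (Suc 0))))"
    and b: "poly_fun (\<lambda>e. b (e 0) (e (Suc 0)))" "\<And>x y x' y'. x \<unlhd> x' \<Longrightarrow> y \<unlhd> y' \<Longrightarrow> h x y \<lhd> b x' y'"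
  shows "delta0_fun (\<lambda>e. h (f e) (g e))"
proof -
  obtain t where t: "poly_fun t" "\<And>e. f e \<lhd> t e" using assms(1) unfolding delta0_fun_def by blast
  obtain u where u: "poly_fun u" "\<And>e. g e \<lhd> u e" using assms(2) unfolding delta0_fun_def by blast
  have "poly_fun (\<lambda>e. b (t e) (u e))"
    using poly_subst[OF b(1), of "case_nat t (\<lambda>_. u)"] t u by (simp split: nat.splits)
  moreover have "h (f e) (g e) \<lhd> b (t e) (u e)" for e
    using b(2) t(2) u(2) by (simp add: ar.less_imp_le)
  moreover have "delta0 (\<lambda>e. e 0 = h (f (\<lambda>i. e (Suc i))) (g (\<lambda>i. e (Suc i))))"
    by (rule delta0_fn_subst2[where Q = "\<lambda>x y e. e 0 = h x y", OF delta0_fun_rename[OF assms(1)] delta0_fun_rename[OF assms(2)]])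
      (use delta0_rename[OF h, of "\<lambda>i. if i = 0 then Suc (Suc 0) else if i = Suc 0 then 0 else Suc 0"] in simp)
  ultimately show ?thesis unfolding delta0_fun_def by blast
qed

lemma delta0_fun_var: "delta0_fun (\<lambda>e. e i)" and delta0_fun_const: "delta0_fun (\<lambda>e. c)"
  by (intro delta0_fun_poly poly_fun.intros)+

lemma delta0_fun_add: "delta0_fun f \<Longrightarrow> delta0_fun g \<Longrightarrow> delta0_fun (\<lambda>e. f e \<oplus> g e)"
  by (rule delta0_fun_comp[where h = "add_of M" and b = "\<lambda>x y. x \<oplus> y \<oplus> \<one>"])
    (assumption | intro delta0_poly_eq poly_fun.intros | simp add: less_succ ar.add_mono)+

lemma delta0_fun_mul: "delta0_fun f \<Longrightarrow> delta0_fun g \<Longrightarrow> delta0_fun (\<lambda>e. f e \<otimes> g e)"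
  by (rule delta0_fun_comp[where h = "mul_of M" and b = "\<lambda>x y. x \<otimes> y \<oplus> \<one>"])
    (assumption | intro delta0_poly_eq poly_fun.intros | simp add: less_succ ar.mult_mono)+

lemma delta0_eq: "delta0_fun f \<Longrightarrow> delta0_fun g \<Longrightarrow> delta0 (\<lambda>e. f e = g e)"
  by (rule delta0_fn_subst2[where Q = "\<lambda>x y e. x = y"]) (auto intro: delta0_poly_eq poly_var)

lemma delta0_less: "delta0_fun f \<Longrightarrow> delta0_fun g \<Longrightarrow> delta0 (\<lambda>e. f e \<lhd> g e)"
  by (rule delta0_fn_subst2[where Q = "\<lambda>x y e. x \<lhd> y"]) (auto intro: delta0_poly_less poly_var)

lemma delta0_le: "delta0_fun f \<Longrightarrow> delta0_fun g \<Longrightarrow> delta0 (\<lambda>e. f e \<unlhd> g e)"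
  unfolding nle_def by (intro delta0_or delta0_less delta0_eq)

lemma delta0_mem: "delta0_fun f \<Longrightarrow> X \<in> SS \<Longrightarrow> delta0 (\<lambda>e. f e \<in> X)"
  by (rule delta0_fn_subst[where Q = "\<lambda>x e. x \<in> X"]) (auto intro: delta0_poly_mem poly_var)

lemma delta0_all:
  assumes "delta0_fun f" "delta0 (\<lambda>e. Q (e 0) (\<lambda>i. e (Suc i)))"
  shows "delta0 (\<lambda>e. \<forall>x. x \<lhd> f e \<longrightarrow> Q x e)"
proof (rule delta0_fn_subst[OF assms(1), where Q = "\<lambda>y e. \<forall>x. x \<lhd> y \<longrightarrow> Q x e"])
  have "delta0 (\<lambda>e. Q (e 0) (\<lambda>i. e (Suc (Suc i))))"
    using delta0_rename[OF assms(2), of "case_nat 0 (\<lambda>i. Suc (Suc i))"] by simp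
  then show "delta0 (\<lambda>e. \<forall>x. x \<lhd> e 0 \<longrightarrow> Q x (\<lambda>i. e (Suc i)))"
    by (intro delta0_poly_all[where Q = "\<lambda>x e. Q x (\<lambda>i. e (Suc i))"] poly_var)
qed

lemma delta0_ex:
  assumes "delta0_fun f" "delta0 (\<lambda>e. Q (e 0) (\<lambda>i. e (Suc i)))"
  shows "delta0 (\<lambda>e. \<exists>x. x \<lhd> f e \<and> Q x e)"
  using delta0_not[OF delta0_all[where Q = "\<lambda>x e. \<not> Q x e", OF assms(1) delta0_not[OF assms(2)]]] by simp

lemma delta0_all_le:
  assumes "delta0_fun f" "delta0 (\<lambda>e. Q (e 0) (\<lambda>i. e (Suc i)))"
  shows "delta0 (\<lambda>e. \<forall>x. x \<unlhd> f e \<longrightarrow> Q x e)"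
  using delta0_all[where Q = Q, OF delta0_fun_add[OF assms(1) delta0_fun_const] assms(2), of \<one>] by (simp add: less_succ)

lemma delta0_ex_le:
  assumes "delta0_fun f" "delta0 (\<lambda>e. Q (e 0) (\<lambda>i. e (Suc i)))"
  shows "delta0 (\<lambda>e. \<exists>x. x \<unlhd> f e \<and> Q x e)"
  using delta0_ex[where Q = Q, OF delta0_fun_add[OF assms(1) delta0_fun_const] assms(2), of \<one>] by (simp add: less_succ)

lemmas delta0_basic_intros = delta0_const delta0_eq delta0_less delta0_le delta0_mem
  delta0_not delta0_and delta0_or delta0_imp delta0_iff
  delta0_all delta0_ex delta0_all_le delta0_ex_le delta0_fun_var delta0_fun_const delta0_fun_add delta0_fun_mul

section \<open>Further forms of induction\<close>

lemma delta0_less_induct: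
  assumes "delta0 (\<lambda>e. P (e 0))" and step: "\<And>n. (\<And>m. m \<lhd> n \<Longrightarrow> P m) \<Longrightarrow> P n"
  shows "P n"
proof -
  have "\<forall>m. m \<lhd> n \<longrightarrow> P m" for n
  proof (rule delta0_induct[where P = "\<lambda>n. \<forall>m. m \<lhd> n \<longrightarrow> P m"])
    show "delta0 (\<lambda>e. \<forall>m. m \<lhd> e 0 \<longrightarrow> P m)"
      by (intro delta0_basic_intros assms(1))
  qed (use step less_succ nle_def not_less_zero in blast)+
  then show ?thesis using less_plus_one by blast
qed

lemma delta0_least:
  assumes "delta0 (\<lambda>e. P (e 0))" and "P n"
  obtains m where "P m" "\<And>k. k \<lhd> m \<Longrightarrow> \<not> P k"
  using delta0_less_induct[where P = "\<lambda>n. \<not> P n", OF delta0_not[OF assms(1)]] assms(2) by blast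

text \<open>\<open>\<Pi>\<^sub>1\<close> induction reduces to \<open>\<Sigma>\<^sub>1\<close> induction by running backwards from a counterexample at \<open>n\<close>:
if the claim fails at \<open>m\<close> with \<open>m + k = n\<close>, it also fails at the predecessor of \<open>m\<close>, hence for every \<open>k\<close>
up to \<open>n\<close>, hence at \<open>0\<close>.\<close>

lemma pi01_induct:
  assumes "delta0 (\<lambda>e. P (e 0) (e (Suc 0)))" and base: "\<And>a. P a \<zero>"
    and step: "\<And>n a. (\<And>a. P a n) \<Longrightarrow> P a (n \<oplus> \<one>)"
  shows "P a n"
proof (rule ccontr)
  assume neg: "\<not> P a n"
  let ?Q = "\<lambda>a k. \<exists>m. m \<unlhd> n \<and> (n \<unlhd> m \<oplus> k \<and> m \<oplus> k \<unlhd> n \<and> \<not> P a m \<or> n \<lhd> k)"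
  have "\<exists>a. ?Q a n"
  proof (rule sigma01_induct[where P = ?Q])
    show "delta0 (\<lambda>e. ?Q (e 0) (e (Suc 0)))"
      using delta0_rename[OF assms(1), of "\<lambda>i. if i = 0 then Suc 0 else 0"]
      by (intro delta0_basic_intros) simp
    show "\<exists>a. ?Q a \<zero>" using neg by (intro exI[of _ a] exI[of _ n]) simp
    fix k a
    assume "?Q a k"
    then show "\<exists>b. ?Q b (k \<oplus> \<one>)"
    proof (elim exE conjE disjE)
      fix m assume m: "m \<unlhd> n" "n \<unlhd> m \<oplus> k" "m \<oplus> k \<unlhd> n" "\<not> P a m"
      then obtain l where l: "m = l \<oplus> \<one>" using base nonzero_succ by metis
      then obtain b where "\<not> P b l" using step m(4) by blast
      moreover have "l \<unlhd> n" using m(1) l le_plus(1) ar.order_trans by blast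
      ultimately show ?thesis using m l by (metis ar.add.assoc ar.add.commute)
    next
      fix m assume "n \<lhd> k"
      then have "n \<lhd> k \<oplus> \<one>" by (simp add: less_succ ar.less_imp_le)
      then show ?thesis by auto
    qed
  qed
  then obtain b m where m: "n \<unlhd> m \<oplus> n" "m \<oplus> n \<unlhd> n" "\<not> P b m" by (auto simp: ar.less_irrefl)
  then have "m \<oplus> n = \<zero> \<oplus> n" by (simp add: ar.order_antisym)
  then have "m = \<zero>" using plus_cancel by blast
  with m base show False by blast
qed

lemma pi01_less_induct:
  assumes P: "delta0 (\<lambda>e. P (e 0) (e (Suc 0)))"
    and step: "\<And>n a. (\<And>m a. m \<lhd> n \<Longrightarrow> P a m) \<Longrightarrow> P a n"
  shows "P a n"
proof -
  have "\<forall>m. m \<lhd> n \<longrightarrow> P a m" for a n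
  proof (rule pi01_induct[where P = "\<lambda>a n. \<forall>m. m \<lhd> n \<longrightarrow> P a m"])
    show "delta0 (\<lambda>e. \<forall>m. m \<lhd> e (Suc 0) \<longrightarrow> P (e 0) m)"
      using delta0_rename[OF P, of "\<lambda>i. if i = 0 then Suc 0 else 0"] by (intro delta0_basic_intros) simp
  qed (use step less_succ nle_def not_less_zero in blast)+
  from this[of "n \<oplus> \<one>" a] show ?thesis using less_plus_one by blast
qed

section \<open>Pairing\<close>

lemma double_inject: "x \<oplus> x = y \<oplus> y \<Longrightarrow> x = y"
  using ar.add_strict_mono[of x y x y] ar.add_strict_mono[of y x y x] by (metis ar.less_irrefl ar.neqE)

lemma double_less: "x \<oplus> x \<lhd> y \<oplus> y \<Longrightarrow> x \<lhd> y"
  using ar.add_mono[of y x y x] by (metis ar.not_le)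

lemma double_le: "x \<oplus> x \<unlhd> y \<oplus> y \<Longrightarrow> x \<unlhd> y"
  using ar.add_strict_mono[of y x y x] by (metis ar.not_le)

lemma double_pair: "pair x y \<oplus> pair x y = (x \<oplus> y) \<otimes> (x \<oplus> y \<oplus> \<one>) \<oplus> (x \<oplus> x)"
proof -
  have "\<exists>t. t \<oplus> t = s \<otimes> (s \<oplus> \<one>)" for s
  proof (rule sigma01_induct[where P = "\<lambda>t s. t \<oplus> t = s \<otimes> (s \<oplus> \<one>)"])
    fix n t assume "t \<oplus> t = n \<otimes> (n \<oplus> \<one>)"
    moreover have "(t \<oplus> n \<oplus> \<one>) \<oplus> (t \<oplus> n \<oplus> \<one>) = (t \<oplus> t) \<oplus> (n \<oplus> n) \<oplus> (\<one> \<oplus> \<one>)"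
      by (simp add: arith_ac)
    ultimately have "(t \<oplus> n \<oplus> \<one>) \<oplus> (t \<oplus> n \<oplus> \<one>) = (n \<oplus> \<one>) \<otimes> (n \<oplus> \<one> \<oplus> \<one>)"
      by (simp add: ring_simps)
    then show "\<exists>t. t \<oplus> t = (n \<oplus> \<one>) \<otimes> (n \<oplus> \<one> \<oplus> \<one>)" ..
  next
    show "delta0 (\<lambda>e. e 0 \<oplus> e 0 = e (Suc 0) \<otimes> (e (Suc 0) \<oplus> \<one>))" by (intro delta0_basic_intros)
  qed (metis ar.add_0_left times_zero zero_times)
  then obtain t where "t \<oplus> t = (x \<oplus> y) \<otimes> (x \<oplus> y \<oplus> \<one>)" by metis
  then have *: "(t \<oplus> x) \<oplus> (t \<oplus> x) = (x \<oplus> y) \<otimes> (x \<oplus> y \<oplus> \<one>) \<oplus> (x \<oplus> x)"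
    by (metis ar.add.assoc ar.add.left_commute)
  show ?thesis unfolding pair_def by (rule theI, rule *) (rule double_inject, simp add: *)
qed

lemma pair_eq_iff: "z = pair x y \<longleftrightarrow> z \<oplus> z = (x \<oplus> y) \<otimes> (x \<oplus> y \<oplus> \<one>) \<oplus> (x \<oplus> x)"
  using double_pair double_inject by metis

lemma le_square: "x \<unlhd> x \<otimes> x"
  using ar.mult_left_mono[of \<one> x x] less_iff_succ_le[of \<zero> x] by (cases "x = \<zero>") (auto simp: ar.less_le)

lemma le_pair [simp]: "x \<unlhd> pair x y" "y \<unlhd> pair x y"
proof -
  have "x \<oplus> x \<unlhd> pair x y \<oplus> pair x y" unfolding double_pair by simp
  then show "x \<unlhd> pair x y" by (rule double_le)
  have "y \<oplus> y \<unlhd> (x \<oplus> y) \<oplus> (x \<oplus> y) \<otimes> (x \<oplus> y)"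
    by (intro ar.add_mono ar.order_trans[OF _ le_square]) simp_all
  also have "\<dots> \<unlhd> pair x y \<oplus> pair x y"
    unfolding double_pair ar.distrib_left[of "x \<oplus> y" "x \<oplus> y"] ar.mult_1_right
    by (simp add: ar.add.commute[of "x \<oplus> y"])
  finally show "y \<unlhd> pair x y" by (rule double_le)
qed

lemma pair_mono: "x \<unlhd> x' \<Longrightarrow> y \<unlhd> y' \<Longrightarrow> pair x y \<unlhd> pair x' y'"
proof -
  assume "x \<unlhd> x'" "y \<unlhd> y'"
  then have "pair x y \<oplus> pair x y \<unlhd> pair x' y' \<oplus> pair x' y'"
    unfolding double_pair by (intro ar.add_mono ar.mult_mono) simp_all
  then show ?thesis by (rule double_le)
qed

text \<open>With \<open>s = x + y\<close>, twice the code lies between \<open>s (s + 1)\<close> and \<open>s (s + 1) + 2 s\<close>, which is below \<open>(s + 1) (s + 2)\<close>.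
So the code determines \<open>s\<close>, and then \<open>x\<close>.\<close>

lemma pair_inject [simp]: "pair x y = pair x' y' \<longleftrightarrow> x = x' \<and> y = y'"
proof
  have *: "pair x y \<lhd> pair x' y'" if "x \<oplus> y \<lhd> x' \<oplus> y'" for x y x' y'
  proof (rule double_less)
    let ?s = "x \<oplus> y"
    have "?s \<otimes> (?s \<oplus> \<one>) \<oplus> (x \<oplus> x) \<unlhd> ?s \<otimes> (?s \<oplus> \<one>) \<oplus> (?s \<oplus> ?s)" by (intro ar.add_mono) simp_all
    also have "\<dots> \<lhd> (?s \<oplus> \<one>) \<otimes> (?s \<oplus> \<one> \<oplus> \<one>)"
    proof -
      have "(?s \<oplus> \<one>) \<otimes> (?s \<oplus> \<one> \<oplus> \<one>) = ?s \<otimes> (?s \<oplus> \<one>) \<oplus> (?s \<oplus> ?s) \<oplus> \<one> \<oplus> \<one>"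
        by (simp add: ar.distrib_left ar.distrib_right ar.add.assoc ar.add.commute ar.add.left_commute)
      then show ?thesis using less_plus_one ar.less_trans by metis
    qed
    also have "\<dots> \<unlhd> (x' \<oplus> y') \<otimes> (x' \<oplus> y' \<oplus> \<one>)"
      using that unfolding less_iff_succ_le by (intro ar.mult_mono ar.add_right_mono) simp_all
    also have "\<dots> \<unlhd> pair x' y' \<oplus> pair x' y'" unfolding double_pair by simp
    finally show "pair x y \<oplus> pair x y \<lhd> pair x' y' \<oplus> pair x' y'" unfolding double_pair[of x y] .
  qed
  assume eq: "pair x y = pair x' y'"
  then have s: "x \<oplus> y = x' \<oplus> y'" using *[of x y x' y'] *[of x' y' x y] by (metis ar.less_irrefl ar.neqE)
  then have "x \<oplus> x = x' \<oplus> x'" using double_pair[of x y] double_pair[of x' y'] eq by simp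
  then have "x = x'" by (rule double_inject)
  then show "x = x' \<and> y = y'" using s by simp
qed simp

lemma pair_less: "x \<unlhd> x' \<Longrightarrow> y \<lhd> y' \<Longrightarrow> pair x y \<lhd> pair x' y'"
  and pair_less': "x \<lhd> x' \<Longrightarrow> y \<unlhd> y' \<Longrightarrow> pair x y \<lhd> pair x' y'"
  using pair_mono[of x x' y y'] pair_inject[of x y x' y'] unfolding nle_def by (metis ar.less_irrefl)+

lemma delta0_fun_pair: "delta0_fun f \<Longrightarrow> delta0_fun g \<Longrightarrow> delta0_fun (\<lambda>e. pair (f e) (g e))"
proof (rule delta0_fun_comp[where h = pair and b = "\<lambda>x y. (x \<oplus> y) \<otimes> (x \<oplus> y \<oplus> \<one>) \<oplus> (x \<oplus> x) \<oplus> \<one>"])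
  show "delta0 (\<lambda>e. e 0 = pair (e (Suc 0)) (e (Suc (Suc 0))))"
    unfolding pair_eq_iff by (intro delta0_basic_intros)
  show "pair x y \<lhd> (x' \<oplus> y') \<otimes> (x' \<oplus> y' \<oplus> \<one>) \<oplus> (x' \<oplus> x') \<oplus> \<one>" if "x \<unlhd> x'" "y \<unlhd> y'" for x y x' y'
    unfolding double_pair[symmetric] less_succ using pair_mono[OF that] le_plus(1) ar.order_trans by blast
qed (assumption | intro poly_fun.intros)+

text \<open>The successor of a code moves one step along a diagonal, or to the start of the next diagonal.\<close>

lemma pair_surj: "\<exists>x y. z = pair x y"
proof -
  have "\<exists>x. x \<unlhd> z \<and> (\<exists>y. y \<unlhd> z \<and> z = pair x y)" for z
  proof (rule delta0_induct[where P = "\<lambda>z. \<exists>x. x \<unlhd> z \<and> (\<exists>y. y \<unlhd> z \<and> z = pair x y)"])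
    show "delta0 (\<lambda>e. \<exists>x. x \<unlhd> e 0 \<and> (\<exists>y. y \<unlhd> e 0 \<and> e 0 = pair x y))"
      by (intro delta0_basic_intros delta0_fun_pair)
    have "\<zero> = pair \<zero> \<zero>" by (simp add: pair_eq_iff)
    then show "\<exists>x. x \<unlhd> \<zero> \<and> (\<exists>y. y \<unlhd> \<zero> \<and> \<zero> = pair x y)" by (meson ar.order_refl)
    fix n assume "\<exists>x. x \<unlhd> n \<and> (\<exists>y. y \<unlhd> n \<and> n = pair x y)"
    then obtain x y where n: "n = pair x y" by blast
    have "\<exists>x y. n \<oplus> \<one> = pair x y"
    proof (cases "y = \<zero>")
      case True
      have "(n \<oplus> \<one>) \<oplus> (n \<oplus> \<one>) = (n \<oplus> n) \<oplus> (\<one> \<oplus> \<one>)" by (simp add: arith_ac)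
      also have "\<dots> = (x \<oplus> \<one>) \<otimes> (x \<oplus> \<one> \<oplus> \<one>)" unfolding n double_pair by (simp add: True ring_simps)
      finally have "n \<oplus> \<one> = pair \<zero> (x \<oplus> \<one>)" unfolding pair_eq_iff by simp
      then show ?thesis by blast
    next
      case False
      then obtain y' where y: "y = y' \<oplus> \<one>" using nonzero_succ by blast
      have "(n \<oplus> \<one>) \<oplus> (n \<oplus> \<one>) = (n \<oplus> n) \<oplus> (\<one> \<oplus> \<one>)" by (simp add: arith_ac)
      also have "\<dots> = ((x \<oplus> \<one>) \<oplus> y') \<otimes> ((x \<oplus> \<one>) \<oplus> y' \<oplus> \<one>) \<oplus> ((x \<oplus> \<one>) \<oplus> (x \<oplus> \<one>))"
        unfolding n double_pair y by (simp add: arith_ac)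
      finally have "n \<oplus> \<one> = pair (x \<oplus> \<one>) y'" unfolding pair_eq_iff .
      then show ?thesis by blast
    qed
    then show "\<exists>x. x \<unlhd> n \<oplus> \<one> \<and> (\<exists>y. y \<unlhd> n \<oplus> \<one> \<and> n \<oplus> \<one> = pair x y)" by (metis le_pair)
  qed
  then show ?thesis by blast
qed

section \<open>Codes of modal formulas\<close>

abbreviation "three \<equiv> \<one> \<oplus> \<one> \<oplus> \<one>"

lemma thrice_inject: "thrice a \<oplus> r = thrice b \<oplus> s \<Longrightarrow> r \<lhd> three \<Longrightarrow> s \<lhd> three \<Longrightarrow> a = b"
proof -
  have *: "thrice a \<oplus> r \<lhd> thrice b \<oplus> s" if "r \<lhd> three" "a \<lhd> b" for a b r s
  proof -
    have "thrice a \<oplus> r \<lhd> thrice a \<oplus> three" using that by (simp add: ar.add_strict_left_mono)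
    also have "\<dots> = thrice (a \<oplus> \<one>)" by (simp add: thrice_def arith_ac)
    also have "\<dots> \<unlhd> thrice b"
      using that unfolding thrice_def less_iff_succ_le by (intro ar.add_mono) 
    also have "\<dots> \<unlhd> thrice b \<oplus> s" by simp
    finally show ?thesis .
  qed
  assume "thrice a \<oplus> r = thrice b \<oplus> s" "r \<lhd> three" "s \<lhd> three"
  then show "a = b" using *[of r a b s] *[of s b a r] by (metis ar.less_irrefl ar.neqE)
qed

lemma residue_less_three: "\<zero> \<lhd> three" "\<one> \<lhd> three" "\<one> \<oplus> \<one> \<lhd> three"
  by (simp_all add: less_succ ar.less_imp_le)

lemma imp_succ: "imp a b = thrice (pair a b \<oplus> \<one>)"
  by (simp add: imp_def thrice_def arith_ac)

lemma thrice_cases: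
  obtains q where "n = thrice q" | q where "n = thrice q \<oplus> \<one>" | q where "n = thrice q \<oplus> \<one> \<oplus> \<one>"
proof -
  have "\<exists>q. n = thrice q \<or> n = thrice q \<oplus> \<one> \<or> n = thrice q \<oplus> \<one> \<oplus> \<one>"
  proof (rule sigma01_induct[where P = "\<lambda>q n. n = thrice q \<or> n = thrice q \<oplus> \<one> \<or> n = thrice q \<oplus> \<one> \<oplus> \<one>"])
    show "delta0 (\<lambda>e. e (Suc 0) = thrice (e 0) \<or> e (Suc 0) = thrice (e 0) \<oplus> \<one> \<or>
        e (Suc 0) = thrice (e 0) \<oplus> \<one> \<oplus> \<one>)" unfolding thrice_def by (intro delta0_basic_intros)
    have "\<zero> = thrice \<zero>" by (simp add: thrice_def)
    then show "\<exists>q. \<zero> = thrice q \<or> \<zero> = thrice q \<oplus> \<one> \<or> \<zero> = thrice q \<oplus> \<one> \<oplus> \<one>" by blast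
    fix n q assume "n = thrice q \<or> n = thrice q \<oplus> \<one> \<or> n = thrice q \<oplus> \<one> \<oplus> \<one>"
    moreover have "thrice q \<oplus> \<one> \<oplus> \<one> \<oplus> \<one> = thrice (q \<oplus> \<one>)" by (simp add: thrice_def arith_ac)
    ultimately show "\<exists>q. n \<oplus> \<one> = thrice q \<or> n \<oplus> \<one> = thrice q \<oplus> \<one> \<or> n \<oplus> \<one> = thrice q \<oplus> \<one> \<oplus> \<one>" by metis
  qed
  then show thesis using that by blast
qed

lemma formula_cases:
  obtains "n = falsum" | i where "n = pvar i" | a where "n = box a" | a b where "n = imp a b"
proof (cases n rule: thrice_cases)
  case (1 q)
  then show ?thesis
  proof (cases "q = \<zero>")
    case True
    then show ?thesis using that(1) 1 by (simp add: falsum_def thrice_def)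
  next
    case False
    then obtain r where "q = r \<oplus> \<one>" using nonzero_succ by blast
    then show ?thesis using pair_surj[of r] 1 that(4) imp_succ by metis
  qed
qed (use that in \<open>simp_all add: pvar_def box_def\<close>)

lemma thrice_eq: "falsum = thrice \<zero> \<oplus> \<zero>" "pvar i = thrice i \<oplus> \<one>" "box a = thrice a \<oplus> (\<one> \<oplus> \<one>)"
    "imp a b = thrice (pair a b \<oplus> \<one>) \<oplus> \<zero>"
  by (simp_all add: falsum_def pvar_def box_def imp_succ arith_ac) (simp add: thrice_def)

lemma formula_inject [simp]:
  "pvar i = pvar j \<longleftrightarrow> i = j" "box a = box b \<longleftrightarrow> a = b" "imp a b = imp c d \<longleftrightarrow> a = c \<and> b = d"
  unfolding thrice_eq using thrice_inject residue_less_three pair_inject ar.add_right_cancel by metis+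

lemma formula_distinct [simp]:
  "falsum \<noteq> pvar i" "falsum \<noteq> box a" "falsum \<noteq> imp a b" "pvar i \<noteq> box a" "pvar i \<noteq> imp a b" "box c \<noteq> imp a b"
  "pvar i \<noteq> falsum" "box a \<noteq> falsum" "imp a b \<noteq> falsum" "box a \<noteq> pvar i" "imp a b \<noteq> pvar i" "imp a b \<noteq> box c"
proof -
  have *: "r = s" if "thrice a \<oplus> r = thrice b \<oplus> s" "r \<lhd> three" "s \<lhd> three" for a b r s
    using thrice_inject[OF that] that by simp
  have "\<one> \<noteq> \<one> \<oplus> \<one>" "\<zero> \<noteq> \<one> \<oplus> \<one>" "\<zero> \<noteq> \<one>"
    using less_plus_one[of \<one>] succ_neq_zero[of \<one>] by (auto simp: ar.less_irrefl)
  then show "falsum \<noteq> pvar i" "falsum \<noteq> box a" "pvar i \<noteq> box a" "pvar i \<noteq> imp a b" "box c \<noteq> imp a b"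
      "pvar i \<noteq> falsum" "box a \<noteq> falsum" "box a \<noteq> pvar i" "imp a b \<noteq> pvar i" "imp a b \<noteq> box c"
    unfolding thrice_eq using * residue_less_three by metis+
  show "falsum \<noteq> imp a b" "imp a b \<noteq> falsum"
    unfolding thrice_eq using thrice_inject residue_less_three(1) succ_neq_zero by metis+
qed

lemma le_thrice: "a \<unlhd> thrice a"
  by (simp add: thrice_def ar.add.assoc)

lemma subformula_less [simp]: "i \<lhd> pvar i" "a \<lhd> box a" "a \<lhd> imp a b" "b \<lhd> imp a b"
proof -
  have *: "a \<lhd> thrice c \<oplus> (d \<oplus> \<one>)" if "a \<unlhd> c" for a c d
    using that le_thrice[of c] ar.order_trans unfolding less_iff_succ_le[of a]
    by (metis ar.add.assoc ar.add_mono ar.add_right_mono le_plus(1))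
  show "i \<lhd> pvar i" "a \<lhd> box a" using *[of i i \<zero>] *[of a a \<one>] by (simp_all add: pvar_def box_def ar.add.assoc)
  show "a \<lhd> imp a b" "b \<lhd> imp a b" using *[of a "pair a b" "\<one> \<oplus> \<one>"] *[of b "pair a b" "\<one> \<oplus> \<one>"]
    by (simp_all add: imp_def ar.add.assoc)
qed

lemma delta0_fun_thrice: "delta0_fun f \<Longrightarrow> delta0_fun (\<lambda>e. thrice (f e))"
  unfolding thrice_def by (intro delta0_basic_intros)

lemma delta0_fun_pvar: "delta0_fun f \<Longrightarrow> delta0_fun (\<lambda>e. pvar (f e))"
  unfolding pvar_def by (intro delta0_basic_intros delta0_fun_thrice)

lemma delta0_fun_box: "delta0_fun f \<Longrightarrow> delta0_fun (\<lambda>e. box (f e))"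
  unfolding box_def by (intro delta0_basic_intros delta0_fun_thrice)

lemma delta0_fun_imp: "delta0_fun f \<Longrightarrow> delta0_fun g \<Longrightarrow> delta0_fun (\<lambda>e. imp (f e) (g e))"
  unfolding imp_def by (intro delta0_basic_intros delta0_fun_thrice delta0_fun_pair)

lemma delta0_fun_neg: "delta0_fun f \<Longrightarrow> delta0_fun (\<lambda>e. neg (f e))"
  unfolding neg_def by (intro delta0_basic_intros delta0_fun_imp)

lemma delta0_fun_conj: "delta0_fun f \<Longrightarrow> delta0_fun g \<Longrightarrow> delta0_fun (\<lambda>e. conj (f e) (g e))"
  unfolding conj_def by (intro delta0_fun_neg delta0_fun_imp)

lemmas delta0_intros = delta0_basic_intros delta0_fun_pair delta0_fun_thrice
  delta0_fun_pvar delta0_fun_box delta0_fun_imp delta0_fun_neg delta0_fun_conj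

text \<open>Structural induction is induction on codes, because immediate subformulas have smaller codes. The
variable \<open>x\<close> is universally quantified in the induction hypotheses: for a box the
claim is needed at other worlds.\<close>

lemma pi01_formula_induct:
  assumes "delta0 (\<lambda>e. P (e 0) (e (Suc 0)))"
    and "\<And>x. P x falsum" "\<And>x i. P x (pvar i)"
    and "\<And>x a. (\<And>x. P x a) \<Longrightarrow> P x (box a)"
    and "\<And>x a b. (\<And>x. P x a) \<Longrightarrow> (\<And>x. P x b) \<Longrightarrow> P x (imp a b)"
  shows "P x a"
proof (rule pi01_less_induct[where P = P, OF assms(1)])
  fix n x assume "\<And>m a. m \<lhd> n \<Longrightarrow> P a m"
  then show "P x n" using assms(2-) by (cases n rule: formula_cases) simp_all
qed

section \<open>Finite sets as numbers, and recursion\<close>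

abbreviation divides :: "'a \<Rightarrow> 'a \<Rightarrow> bool" (infix "divides" 50) where
  "x divides y \<equiv> ar.dvd x y"

lemma factor_le: "y = x \<otimes> q \<Longrightarrow> \<zero> \<lhd> x \<Longrightarrow> q \<unlhd> y"
  using ar.mult_right_mono[of \<one> x q] by (simp add: less_iff_succ_le)

lemma divides_bounded: "x divides y \<longleftrightarrow> (\<exists>q. q \<unlhd> y \<and> y = x \<otimes> q)"
proof
  assume "x divides y"
  then obtain q where q: "y = x \<otimes> q" unfolding ar.dvd_def by blast
  show "\<exists>q. q \<unlhd> y \<and> y = x \<otimes> q"
  proof (cases "x = \<zero>")
    case True
    then show ?thesis using q by (intro exI[of _ \<zero>]) simp
  next
    case False
    then have "\<zero> \<lhd> x" using zero_le nle_def by metis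
    then show ?thesis using factor_le q by blast
  qed
qed (auto simp: ar.dvd_def)

lemma delta0_divides: "delta0_fun f \<Longrightarrow> delta0_fun g \<Longrightarrow> delta0 (\<lambda>e. f e divides g e)"
  by (rule delta0_fn_subst2[where Q = "\<lambda>x y e. x divides y"], assumption+) (unfold divides_bounded, intro delta0_intros)

text \<open>The numbers coded by \<open>pair a b\<close> are those \<open>u\<close> whose modulus divides \<open>a\<close>. If \<open>b\<close> is divisible by
all positive numbers up to \<open>n\<close>, then the moduli of the numbers up to \<open>n\<close> are pairwise coprime, so multiplying \<open>a\<close>
by the modulus of \<open>v\<close> inserts \<open>v\<close> and nothing else up to \<open>n\<close>.\<close>

definition modulus :: "'a \<Rightarrow> 'a \<Rightarrow> 'a" where
  "modulus b u = (u \<oplus> \<one>) \<otimes> b \<oplus> \<one>"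

definition coded_mem :: "'a \<Rightarrow> 'a \<Rightarrow> bool" where
  "coded_mem u s \<longleftrightarrow> (\<exists>a. a \<unlhd> s \<and> (\<exists>b. b \<unlhd> s \<and> s = pair a b \<and> modulus b u divides a))"

lemma coded_mem_pair [simp]: "coded_mem u (pair a b) \<longleftrightarrow> modulus b u divides a"
  by (auto simp: coded_mem_def)

lemma delta0_coded_mem: "delta0_fun f \<Longrightarrow> delta0_fun g \<Longrightarrow> delta0 (\<lambda>e. coded_mem (f e) (g e))"
  by (rule delta0_fn_subst2[where Q = "\<lambda>x y e. coded_mem x y"], assumption+)
    (unfold coded_mem_def modulus_def, intro delta0_intros delta0_divides)

text \<open>The modulus and \<open>b\<close> are coprime, as the modulus is \<open>1\<close> modulo \<open>b\<close>.\<close>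

lemma modulus_cancel_base: "modulus b u divides x \<otimes> b \<Longrightarrow> modulus b u divides x"
proof -
  assume "modulus b u divides x \<otimes> b"
  then have "modulus b u divides x \<otimes> b \<otimes> (u \<oplus> \<one>)" by (rule ar.dvd_mult2)
  moreover have "modulus b u divides x \<otimes> b \<otimes> (u \<oplus> \<one>) \<oplus> x"
    using ar.dvd_triv_right[of "modulus b u" x] by (simp add: modulus_def ring_simps)
  ultimately show ?thesis using ar.dvd_add_right_iff by blast
qed

text \<open>Euclid's lemma for two distinct moduli. Their difference is \<open>d b\<close> with \<open>d\<close> the difference of \<open>u\<close> and \<open>v\<close>, so the
modulus of \<open>u\<close> divides \<open>a d b\<close>. Here \<open>b\<close> can be cancelled, then \<open>d\<close> as well since \<open>d\<close> divides \<open>b\<close>.\<close>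

lemma modulus_cancel:
  assumes b: "\<And>d. d \<unlhd> n \<Longrightarrow> \<zero> \<lhd> d \<Longrightarrow> d divides b" and "u \<unlhd> n" "v \<unlhd> n" "u \<noteq> v"
    and div: "modulus b u divides a \<otimes> modulus b v"
  shows "modulus b u divides a"
proof -
  have fin: "modulus b u divides a" if "modulus b u divides a \<otimes> d \<otimes> b" "d \<unlhd> n" "\<zero> \<lhd> d" for d
  proof -
    obtain k where k: "b = d \<otimes> k" using b \<open>d \<unlhd> n\<close> \<open>\<zero> \<lhd> d\<close> ar.dvd_def by blast
    have "modulus b u divides a \<otimes> d \<otimes> k" using that modulus_cancel_base ar.dvd_mult2 by blast
    then have "modulus b u divides a \<otimes> b" unfolding k by (simp add: ar.mult.assoc)
    then show ?thesis by (rule modulus_cancel_base)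
  qed
  consider "u \<lhd> v" | "v \<lhd> u" using \<open>u \<noteq> v\<close> ar.neqE by blast
  then show ?thesis
  proof cases
    case 1
    then obtain d where d: "v = u \<oplus> (d \<oplus> \<one>)" using less_iff_plus by blast
    have "modulus b u divides a \<otimes> modulus b u \<oplus> a \<otimes> (d \<oplus> \<one>) \<otimes> b"
      using div unfolding d by (simp add: modulus_def ring_simps)
    then have "modulus b u divides a \<otimes> (d \<oplus> \<one>) \<otimes> b"
      using ar.dvd_add_right_iff ar.dvd_triv_right by blast
    moreover have "d \<oplus> \<one> \<unlhd> n" using \<open>v \<unlhd> n\<close> d le_plus(2) ar.order_trans by blast
    moreover have "\<zero> \<lhd> d \<oplus> \<one>" by (simp add: less_succ)
    ultimately show ?thesis by (rule fin)
  next
    case 2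
    then obtain d where d: "u = v \<oplus> (d \<oplus> \<one>)" using less_iff_plus by blast
    have "a \<otimes> modulus b u = a \<otimes> modulus b v \<oplus> a \<otimes> (d \<oplus> \<one>) \<otimes> b"
      unfolding d by (simp add: modulus_def ring_simps)
    then have "modulus b u divides a \<otimes> (d \<oplus> \<one>) \<otimes> b"
      using ar.dvd_add_right_iff ar.dvd_triv_right div by metis
    moreover have "d \<oplus> \<one> \<unlhd> n" using \<open>u \<unlhd> n\<close> d le_plus(2) ar.order_trans by blast
    moreover have "\<zero> \<lhd> d \<oplus> \<one>" by (simp add: less_succ)
    ultimately show ?thesis by (rule fin)
  qed
qed

lemma common_multiple:
  obtains b where "\<zero> \<lhd> b" "\<And>d. d \<unlhd> n \<Longrightarrow> \<zero> \<lhd> d \<Longrightarrow> d divides b"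
proof -
  have "\<exists>b. \<zero> \<lhd> b \<and> (\<forall>d. d \<unlhd> n \<longrightarrow> \<zero> \<lhd> d \<longrightarrow> d divides b)" for n
  proof (rule sigma01_induct[where P = "\<lambda>b n. \<zero> \<lhd> b \<and> (\<forall>d. d \<unlhd> n \<longrightarrow> \<zero> \<lhd> d \<longrightarrow> d divides b)"])
    show "delta0 (\<lambda>e. \<zero> \<lhd> e 0 \<and> (\<forall>d. d \<unlhd> e (Suc 0) \<longrightarrow> \<zero> \<lhd> d \<longrightarrow> d divides e 0))"
      by (intro delta0_intros delta0_divides)
    show "\<exists>b. \<zero> \<lhd> b \<and> (\<forall>d. d \<unlhd> \<zero> \<longrightarrow> \<zero> \<lhd> d \<longrightarrow> d divides b)"
      by (intro exI[of _ \<one>]) (auto simp: ar.not_less)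
    fix n b assume b: "\<zero> \<lhd> b \<and> (\<forall>d. d \<unlhd> n \<longrightarrow> \<zero> \<lhd> d \<longrightarrow> d divides b)"
    show "\<exists>b. \<zero> \<lhd> b \<and> (\<forall>d. d \<unlhd> n \<oplus> \<one> \<longrightarrow> \<zero> \<lhd> d \<longrightarrow> d divides b)"
    proof (intro exI[of _ "b \<otimes> (n \<oplus> \<one>)"] conjI allI impI)
      show "\<zero> \<lhd> b \<otimes> (n \<oplus> \<one>)" using b by (simp add: less_succ)
      fix d assume "d \<unlhd> n \<oplus> \<one>" "\<zero> \<lhd> d"
      then have "d \<unlhd> n \<or> d = n \<oplus> \<one>" using less_succ nle_def by blast
      then show "d divides b \<otimes> (n \<oplus> \<one>)" using b \<open>\<zero> \<lhd> d\<close> by auto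
    qed
  qed
  from this[of n] show thesis using that by blast
qed

text \<open>Course-of-values recursion for a set, where membership of \<open>u\<close> may depend on which smaller
numbers are members. A coded set is a history up to \<open>n\<close> if it obeys the recursion below \<open>n\<close>. Histories agree
as far as they go, and they exist by \<open>\<Sigma>\<^sub>1\<close> induction, one factor of \<open>a\<close> at a time for a fixed \<open>b\<close> that
serves all numbers up to \<open>n\<close>. So the recursively defined set is \<open>\<Delta>\<^sub>1\<close>: some history contains \<open>u\<close> iff
every sufficiently long history does.\<close>

lemma set_recursion:
  assumes \<Phi>: "delta0 (\<lambda>e. \<Phi> (e 0) (\<lambda>v. coded_mem v (e (Suc 0))))"
    and local: "\<And>u A B. (\<And>v. v \<lhd> u \<Longrightarrow> A v = B v) \<Longrightarrow> \<Phi> u A = \<Phi> u B"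
  obtains X where "X \<in> SS" "\<And>u. u \<in> X \<longleftrightarrow> \<Phi> u (\<lambda>v. v \<in> X)"
proof -
  have delta0_\<Phi>: "delta0 (\<lambda>e. \<Phi> (f e) (\<lambda>v. coded_mem v (g e)))" if "delta0_fun f" "delta0_fun g" for f g
    by (rule delta0_fn_subst2[OF that, where Q = "\<lambda>x y e. \<Phi> x (\<lambda>v. coded_mem v y)"]) (rule \<Phi>)
  let ?hist = "\<lambda>s n. \<forall>v. v \<lhd> n \<longrightarrow> coded_mem v s = \<Phi> v (\<lambda>v. coded_mem v s)"
  have agree: "coded_mem v s = coded_mem v t" if "?hist s n" "?hist t n" "v \<lhd> n" for s t n v
  proof -
    have "v \<lhd> n \<longrightarrow> coded_mem v s = coded_mem v t"
    proof (rule delta0_less_induct[where P = "\<lambda>v. v \<lhd> n \<longrightarrow> coded_mem v s = coded_mem v t"])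
      show "delta0 (\<lambda>e. e 0 \<lhd> n \<longrightarrow> coded_mem (e 0) s = coded_mem (e 0) t)" by (intro delta0_intros delta0_coded_mem)
      fix k assume "\<And>m. m \<lhd> k \<Longrightarrow> m \<lhd> n \<longrightarrow> coded_mem m s = coded_mem m t"
      then have "\<Phi> k (\<lambda>v. coded_mem v s) = \<Phi> k (\<lambda>v. coded_mem v t)" if "k \<lhd> n"
        using that by (intro local) (blast intro: ar.less_trans)
      then show "k \<lhd> n \<longrightarrow> coded_mem k s = coded_mem k t" using \<open>?hist s n\<close> \<open>?hist t n\<close> by blast
    qed
    then show ?thesis using that by blast
  qed
  have ex: "\<exists>s. ?hist s n" for n
  proof -
    obtain b where b: "\<zero> \<lhd> b" "\<And>d. d \<unlhd> n \<Longrightarrow> \<zero> \<lhd> d \<Longrightarrow> d divides b"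
      using common_multiple[of n] by blast
    let ?P = "\<lambda>a m. m \<unlhd> n \<longrightarrow> (\<forall>u. u \<unlhd> n \<longrightarrow>
      coded_mem u (pair a b) = (u \<lhd> m \<and> \<Phi> u (\<lambda>v. coded_mem v (pair a b))))"
    have "\<exists>a. ?P a n"
    proof (rule sigma01_induct[where P = ?P])
      show "delta0 (\<lambda>e. ?P (e 0) (e (Suc 0)))"
        by (intro delta0_basic_intros delta0_\<Phi> delta0_coded_mem delta0_fun_pair)
      have "\<not> modulus b u divides \<one>" for u
      proof
        assume "modulus b u divides \<one>"
        then obtain q where "\<one> = q \<otimes> modulus b u" by (metis ar.dvdE ar.mult.commute)
        moreover from this have "\<zero> \<lhd> q" using ar.zero_neq_one zero_le nle_def ar.mult_zero_left by metis
        ultimately have "modulus b u \<unlhd> \<one>" by (rule factor_le)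
        then have "(u \<oplus> \<one>) \<otimes> b \<unlhd> \<zero>" using ar.add_le_cancel_right[of _ \<one> \<zero>] by (simp add: modulus_def)
        moreover have "\<zero> \<lhd> (u \<oplus> \<one>) \<otimes> b" using b(1) by (simp add: less_succ)
        ultimately show False by simp
      qed
      then show "\<exists>a. ?P a \<zero>" by (intro exI[of _ \<one>]) (simp add: not_less_zero)
      fix m a assume a: "?P a m"
      show "\<exists>a. ?P a (m \<oplus> \<one>)"
      proof (cases "m \<oplus> \<one> \<unlhd> n \<and> \<Phi> m (\<lambda>v. coded_mem v (pair a b))")
        case False
        have "m \<unlhd> n" if "m \<oplus> \<one> \<unlhd> n" using that le_plus(1) ar.order_trans by blast
        then have "?P a (m \<oplus> \<one>)" using False a unfolding less_succ nle_def by blast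
        then show ?thesis ..
      next
        case True
        then have "m \<unlhd> n" using le_plus(1) ar.order_trans by blast
        have ins: "coded_mem u (pair (a \<otimes> modulus b m) b) \<longleftrightarrow> coded_mem u (pair a b) \<or> u = m" if "u \<unlhd> n" for u
          using modulus_cancel[of n b u m, OF b(2) that \<open>m \<unlhd> n\<close>] by auto
        have "\<Phi> u (\<lambda>v. coded_mem v (pair (a \<otimes> modulus b m) b)) = \<Phi> u (\<lambda>v. coded_mem v (pair a b))"
          if "u \<unlhd> m" for u
        proof (rule local)
          fix v assume "v \<lhd> u"
          then have "v \<noteq> m" "v \<unlhd> n" using that \<open>m \<unlhd> n\<close> by order+
          then show "coded_mem v (pair (a \<otimes> modulus b m) b) = coded_mem v (pair a b)" using ins by blast
        qed
        then have "?P (a \<otimes> modulus b m) (m \<oplus> \<one>)"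
          using a True ins \<open>m \<unlhd> n\<close> unfolding less_succ by (metis nle_def ar.less_irrefl)
        then show ?thesis ..
      qed
    qed
    then obtain a where "\<forall>u. u \<unlhd> n \<longrightarrow>
      coded_mem u (pair a b) = (u \<lhd> n \<and> \<Phi> u (\<lambda>v. coded_mem v (pair a b)))" by auto
    then have "?hist (pair a b) n" using nle_def by blast
    then show ?thesis ..
  qed
  let ?X = "{u. \<exists>s. ?hist s (u \<oplus> \<one>) \<and> coded_mem u s}"
  have X_iff: "u \<in> ?X \<longleftrightarrow> coded_mem u s" if "?hist s (u \<oplus> \<one>)" for u s
    using agree[OF that _ less_plus_one] that by blast
  have "?X \<in> SS"
  proof (rule delta01_set)
    show "delta0 (\<lambda>e. ?hist (e 0) (e (Suc 0) \<oplus> \<one>) \<and> coded_mem (e (Suc 0)) (e 0))"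
      by (intro delta0_basic_intros delta0_\<Phi> delta0_coded_mem)
    show "delta0 (\<lambda>e. ?hist (e 0) (e (Suc 0) \<oplus> \<one>) \<longrightarrow> coded_mem (e (Suc 0)) (e 0))"
      by (intro delta0_basic_intros delta0_\<Phi> delta0_coded_mem)
    show "(\<exists>s. ?hist s (u \<oplus> \<one>) \<and> coded_mem u s) = (\<forall>s. ?hist s (u \<oplus> \<one>) \<longrightarrow> coded_mem u s)" for u
      using X_iff[of u] ex[of "u \<oplus> \<one>"] by blast
  qed
  moreover have "u \<in> ?X \<longleftrightarrow> \<Phi> u (\<lambda>v. v \<in> ?X)" for u
  proof -
    obtain s where s: "?hist s (u \<oplus> \<one>)" using ex by blast
    have "\<Phi> u (\<lambda>v. v \<in> ?X) = \<Phi> u (\<lambda>v. coded_mem v s)"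
    proof (rule local, rule X_iff)
      fix v assume "v \<lhd> u"
      then have "w \<lhd> u \<oplus> \<one>" if "w \<lhd> v \<oplus> \<one>" for w
        using that unfolding less_succ by order
      then show "?hist s (v \<oplus> \<one>)" using s by blast
    qed
    then show ?thesis using X_iff[OF s] s by (simp add: less_succ)
  qed
  ultimately show thesis by (rule that)
qed

section \<open>Finite conjunctions\<close>

lemma app_eq_iff: "is_function F X Y \<Longrightarrow> x \<in> X \<Longrightarrow> app F x = y \<longleftrightarrow> pair x y \<in> F"
  unfolding is_function_def app_def by (metis (mono_tags, lifting) theI')

lemma is_functionI:
  assumes "F \<in> SS" "\<And>x y. pair x y \<in> F \<Longrightarrow> x \<in> X \<and> y \<in> Y"
    and "\<And>x. x \<in> X \<Longrightarrow> \<exists>y. pair x y \<in> F"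
    and "\<And>x y y'. x \<in> X \<Longrightarrow> pair x y \<in> F \<Longrightarrow> pair x y' \<in> F \<Longrightarrow> y = y'"
  shows "is_function F X Y"
  unfolding is_function_def
proof (intro conjI ballI subsetI)
  fix z assume "z \<in> F"
  then show "z \<in> cprod X Y" using pair_surj[of z] assms(2) unfolding cprod_def by blast
qed (use assms in blast)+

text \<open>The graph of the sequence of partial conjunctions is obtained by \<open>set_recursion\<close>: whether
\<open>n + 1\<close> has the value \<open>y\<close> depends on which value at \<open>n\<close> it arises from, and that value is at most \<open>y\<close>, so
that the pair to be consulted has a smaller code.\<close>

lemma conj_seq_exists:
  assumes "X \<in> SS"
  obtains F where "F \<in> SS" "conj_seq X F"
proof -
  let ?\<Phi> = "\<lambda>u A. \<exists>n. n \<unlhd> u \<and> (\<exists>y. y \<unlhd> u \<and> u = pair n y \<and>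
    (n = \<zero> \<and> y = verum \<or> (\<exists>m. m \<lhd> n \<and> (\<exists>z. z \<unlhd> y \<and> n = m \<oplus> \<one> \<and> A (pair m z) \<and>
      (m \<in> X \<and> y = conj z m \<or> m \<notin> X \<and> y = z)))))"
  obtain F where F: "F \<in> SS" "\<And>u. u \<in> F \<longleftrightarrow> ?\<Phi> u (\<lambda>v. v \<in> F)"
  proof (rule set_recursion[where \<Phi> = ?\<Phi>])
    show "delta0 (\<lambda>e. ?\<Phi> (e 0) (\<lambda>v. coded_mem v (e (Suc 0))))"
      by (intro delta0_intros delta0_coded_mem assms)
    fix u and A B :: "'a \<Rightarrow> bool" assume "\<And>v. v \<lhd> u \<Longrightarrow> A v = B v"
    then have "A (pair m z) = B (pair m z)" if "u = pair n y" "m \<lhd> n" "z \<unlhd> y" for n m y z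
      using that pair_less' by blast
    then show "?\<Phi> u A = ?\<Phi> u B" by blast
  qed blast
  have z_le: "z \<unlhd> conj z m" for z m
    unfolding conj_def neg_def by (intro ar.less_imp_le ar.less_trans[OF subformula_less(3) subformula_less(3)])
  have zero: "pair \<zero> y \<in> F \<longleftrightarrow> y = verum" for y
    unfolding F(2)[of "pair \<zero> y"] by (auto simp: not_less_zero)
  have succ: "pair (n \<oplus> \<one>) y \<in> F \<longleftrightarrow> (\<exists>z. z \<unlhd> y \<and> pair n z \<in> F \<and> y = (if n \<in> X then conj z n else z))"
    for n y
    unfolding F(2)[of "pair (n \<oplus> \<one>) y"] using succ_neq_zero[of n]
    by (auto dest!: succ_inject intro: le_pair less_plus_one)
  have total: "\<exists>y. pair n y \<in> F" for n
  proof (rule sigma01_induct[where P = "\<lambda>y n. pair n y \<in> F"])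
    show "delta0 (\<lambda>e. pair (e (Suc 0)) (e 0) \<in> F)" by (intro delta0_intros F(1))
    show "\<exists>y. pair \<zero> y \<in> F" using zero by blast
    show "\<exists>y. pair (n \<oplus> \<one>) y \<in> F" if "pair n z \<in> F" for n z
      unfolding succ using that z_le[of z n] by (cases "n \<in> X") auto
  qed
  \<comment> \<open>Partial conjunctions only grow, so both values at every earlier stage stay below a common bound \<open>b\<close>,
and a bounded induction suffices.\<close>
  have unique: "y = y'" if "pair n y \<in> F" "pair n y' \<in> F" for n y y'
  proof -
    have "\<forall>y'. y' \<unlhd> b \<longrightarrow> (\<forall>y. y \<unlhd> b \<longrightarrow> pair n y \<in> F \<and> pair n y' \<in> F \<longrightarrow> y = y')" for b
    proof (rule delta0_induct[where P = "\<lambda>n. \<forall>y'. y' \<unlhd> b \<longrightarrow> (\<forall>y. y \<unlhd> b \<longrightarrow> pair n y \<in> F \<and> pair n y' \<in> F \<longrightarrow> y = y')"])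
      show "delta0 (\<lambda>e. \<forall>y'. y' \<unlhd> b \<longrightarrow> (\<forall>y. y \<unlhd> b \<longrightarrow> pair (e 0) y \<in> F \<and> pair (e 0) y' \<in> F \<longrightarrow> y = y'))"
        by (intro delta0_intros F(1))
      fix n assume IH: "\<forall>y'. y' \<unlhd> b \<longrightarrow> (\<forall>y. y \<unlhd> b \<longrightarrow> pair n y \<in> F \<and> pair n y' \<in> F \<longrightarrow> y = y')"
      show "\<forall>y'. y' \<unlhd> b \<longrightarrow> (\<forall>y. y \<unlhd> b \<longrightarrow> pair (n \<oplus> \<one>) y \<in> F \<and> pair (n \<oplus> \<one>) y' \<in> F \<longrightarrow> y = y')"
        unfolding succ using IH ar.order_trans by (metis (no_types, lifting))
    qed (simp add: zero)
    from this[of "y \<oplus> y'"] that show ?thesis by simp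
  qed
  have F_fun: "is_function F UNIV Fml"
    by (rule is_functionI) (auto simp: Fml_def F(1) total intro: unique)
  then have app: "app F n = y \<longleftrightarrow> pair n y \<in> F" for n y
    using app_eq_iff by blast
  have "conj_seq X F" unfolding conj_seq_def
  proof (intro conjI allI)
    show "app F \<zero> = verum" unfolding app zero ..
    fix n
    have "pair n (app F n) \<in> F" using app by blast
    then show "app F (n \<oplus> \<one>) = (if n \<in> X then conj (app F n) n else app F n)"
      unfolding app succ using z_le by (intro exI[of _ "app F n"]) simp
  qed fact
  with F(1) show thesis by (rule that)
qed

lemma conj_seq_simps:
  assumes "conj_seq X F"
  shows "F \<in> SS" "app F n = y \<longleftrightarrow> pair n y \<in> F" "app F \<zero> = verum"
    "app F (n \<oplus> \<one>) = (if n \<in> X then conj (app F n) n else app F n)"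
  using assms app_eq_iff[of F UNIV Fml n y] unfolding conj_seq_def is_function_def by auto

lemma conj_seq_unique:
  assumes F: "conj_seq X F" and G: "conj_seq X G"
  shows "app F n = app G n"
proof -
  note F' = conj_seq_simps[OF F] and G' = conj_seq_simps[OF G]
  have "\<exists>y. pair n y \<in> F \<and> pair n y \<in> G"
  proof (rule sigma01_induct[where P = "\<lambda>y n. pair n y \<in> F \<and> pair n y \<in> G"])
    show "delta0 (\<lambda>e. pair (e (Suc 0)) (e 0) \<in> F \<and> pair (e (Suc 0)) (e 0) \<in> G)"
      by (intro delta0_intros F' G')
  qed (use F'(3,4) G'(3,4) in \<open>simp_all add: F'(2)[symmetric] G'(2)[symmetric]\<close>)
  then show ?thesis using F'(2) G'(2) by metis
qed

lemma conj_seq_stable: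
  assumes F: "conj_seq X F" and "bounded_by X k"
  shows "app F (k \<oplus> n) = app F k"
proof -
  note F' = conj_seq_simps[OF F]
  have "pair (k \<oplus> n) (app F k) \<in> F"
  proof (rule delta0_induct[where P = "\<lambda>n. pair (k \<oplus> n) (app F k) \<in> F"])
    show "delta0 (\<lambda>e. pair (k \<oplus> e 0) (app F k) \<in> F)" by (intro delta0_intros F')
    fix n assume "pair (k \<oplus> n) (app F k) \<in> F"
    moreover have "k \<oplus> n \<notin> X" using assms(2) le_plus(1)[of k n] unfolding bounded_by_def by (metis ar.not_le)
    ultimately show "pair (k \<oplus> (n \<oplus> \<one>)) (app F k) \<in> F"
      using F'(4)[of "k \<oplus> n"] by (simp add: F'(2)[symmetric] ar.add.assoc)
  qed (simp add: F'(2)[symmetric])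
  then show ?thesis by (simp add: F'(2))
qed

text \<open>The conjunction depends neither on the sequence nor on the bound chosen, so the definite description is proper.\<close>

lemma big_conj_eq:
  assumes F: "conj_seq X F" and k: "bounded_by X k"
  shows "big_conj X = app F k"
  unfolding big_conj_def
proof (rule the_equality)
  show "\<exists>F'\<in>SS. \<exists>k'. conj_seq X F' \<and> bounded_by X k' \<and> app F k = app F' k'"
    using assms conj_seq_simps(1) by blast
  fix c assume "\<exists>F'\<in>SS. \<exists>k'. conj_seq X F' \<and> bounded_by X k' \<and> c = app F' k'"
  then obtain F' k' where F': "conj_seq X F'" and k': "bounded_by X k'" and c: "c = app F' k'" by blast
  have "app F k = app F (k \<oplus> k')" using conj_seq_stable[OF F k] by simp
  also have "\<dots> = app F k'" using conj_seq_stable[OF F k'] by (simp add: ar.add.commute)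
  finally show "c = app F k" using c conj_seq_unique[OF F F'] by simp
qed

section \<open>Truth in Kripke models\<close>

text \<open>Unlike \<open>forces\<close>, which goes through a definite description, this is visibly bounded with the valuation as a parameter.
The two agree at the worlds of a model.\<close>

definition true_at :: "'a kripke \<Rightarrow> 'a \<Rightarrow> 'a \<Rightarrow> bool" where
  "true_at K w a \<longleftrightarrow> pair (pair w a) \<one> \<in> Val K"

context
  fixes K :: "'a kripke"
  assumes K: "kripke_model K"
begin

lemma model_sets: "Wld K \<in> SS" "Acc K \<in> SS" "Val K \<in> SS"
  using K unfolding kripke_model_def is_function_def by blast+

lemma delta0_true_at: "delta0_fun f \<Longrightarrow> delta0_fun g \<Longrightarrow> delta0 (\<lambda>e. true_at K (f e) (g e))"
  unfolding true_at_def by (intro delta0_intros model_sets)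

lemma delta0_rel: "delta0_fun f \<Longrightarrow> delta0_fun g \<Longrightarrow> delta0 (\<lambda>e. rel (Acc K) (f e) (g e))"
  unfolding rel_def by (intro delta0_intros model_sets)

lemma rel_world: "rel (Acc K) u v \<Longrightarrow> u \<in> Wld K \<and> v \<in> Wld K"
  using K unfolding kripke_model_def rel_def cprod_def by auto

lemma val_iff:
  assumes w: "w \<in> Wld K"
  shows "val K w a = i \<longleftrightarrow> pair (pair w a) i \<in> Val K"
  unfolding val_def by (rule app_eq_iff[of _ "cprod (Wld K) Fml" "{\<zero>, \<one>}"])
    (use K w in \<open>auto simp: kripke_model_def cprod_def Fml_def\<close>)

lemma val_true_at:
  assumes w: "w \<in> Wld K"
  shows "val K w a = (if true_at K w a then \<one> else \<zero>)"
proof -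
  have "pair (pair w a) (val K w a) \<in> Val K" using val_iff[OF w] by blast
  then have "val K w a = \<zero> \<or> val K w a = \<one>"
    using K unfolding kripke_model_def is_function_def cprod_def by auto
  then show ?thesis using val_iff[OF w] true_at_def by auto
qed

lemma forces_true_at:
  assumes w: "w \<in> Wld K"
  shows "forces K w a \<longleftrightarrow> true_at K w a"
  by (simp add: forces_def val_true_at[OF w])

lemma true_at_falsum:
  assumes w: "w \<in> Wld K"
  shows "\<not> true_at K w falsum"
proof -
  have "val K w falsum = \<zero>" using K w unfolding kripke_model_def Fml_def by blast
  then show ?thesis by (simp add: val_true_at[OF w] split: if_splits)
qed

lemma true_at_imp:
  assumes w: "w \<in> Wld K"
  shows "true_at K w (imp a b) \<longleftrightarrow> (true_at K w a \<longrightarrow> true_at K w b)"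
proof -
  have "val K w (imp a b) = \<one> \<ominus> val K w a \<otimes> (\<one> \<ominus> val K w b)"
    using K w unfolding kripke_model_def Fml_def by blast
  moreover have "\<one> \<ominus> \<zero> = \<one>" "\<one> \<ominus> \<one> = \<zero>"
    using monus_plus[of \<one> \<zero>] monus_plus[of \<zero> \<one>] by simp_all
  ultimately show ?thesis
    by (cases "true_at K w a"; cases "true_at K w b"; cases "true_at K w (imp a b)") (simp_all add: val_true_at[OF w])
qed

lemma true_at_box:
  assumes w: "w \<in> Wld K"
  shows "true_at K w (box a) \<longleftrightarrow> (\<forall>v. rel (Acc K) w v \<longrightarrow> true_at K v a)"
proof -
  have "val K w (box a) = \<one> \<longleftrightarrow> (\<forall>v\<in>Wld K. rel (Acc K) w v \<longrightarrow> val K v a = \<one>)"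
    using K w unfolding kripke_model_def Fml_def by blast
  moreover have "val K v a = \<one> \<longleftrightarrow> true_at K v a" if "v \<in> Wld K" for v a
    using val_iff[OF that] by (simp add: true_at_def)
  ultimately show ?thesis using rel_world w by metis
qed

lemma true_at_neg:
  assumes w: "w \<in> Wld K"
  shows "true_at K w (neg a) \<longleftrightarrow> \<not> true_at K w a"
  by (simp add: neg_def true_at_imp[OF w] true_at_falsum[OF w])

lemma true_at_verum:
  assumes w: "w \<in> Wld K"
  shows "true_at K w verum"
  by (simp add: verum_def true_at_neg[OF w] true_at_falsum[OF w])

lemma true_at_conj:
  assumes w: "w \<in> Wld K"
  shows "true_at K w (conj a b) \<longleftrightarrow> true_at K w a \<and> true_at K w b"
  by (simp add: conj_def true_at_neg[OF w] true_at_imp[OF w])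

lemma true_at_dia: "w \<in> Wld K \<Longrightarrow> true_at K w (dia a) \<longleftrightarrow> (\<exists>v. rel (Acc K) w v \<and> true_at K v a)"
  using rel_world by (auto simp: dia_def true_at_neg true_at_box)

text \<open>Truth of the partial conjunctions is followed along the sequence; the induction is \<open>\<Sigma>\<^sub>1\<close>, the
witness being the value of the sequence.\<close>

lemma true_at_big_conj:
  assumes w: "w \<in> Wld K" and X: "finite_set X"
  shows "true_at K w (big_conj X) \<longleftrightarrow> (\<forall>a\<in>X. true_at K w a)"
proof -
  obtain k where k: "bounded_by X k" and "X \<in> SS" using X unfolding finite_set_def by blast
  obtain F where "F \<in> SS" and F: "conj_seq X F" using conj_seq_exists[OF \<open>X \<in> SS\<close>] .
  note F' = conj_seq_simps[OF F]
  let ?P = "\<lambda>n y. pair n y \<in> F \<and> (true_at K w y \<longleftrightarrow> (\<forall>a. a \<lhd> n \<longrightarrow> a \<in> X \<longrightarrow> true_at K w a))"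
  have "\<exists>y. ?P k y"
  proof (rule sigma01_induct[where P = "\<lambda>y n. ?P n y"])
    show "delta0 (\<lambda>e. ?P (e (Suc 0)) (e 0))" by (intro delta0_intros delta0_true_at \<open>F \<in> SS\<close> \<open>X \<in> SS\<close>)
    show "\<exists>y. ?P \<zero> y" using F'(3) by (simp add: F'(2) not_less_zero true_at_verum[OF w] exI[of _ verum])
    fix n y assume y: "?P n y"
    then have "app F n = y" using F'(2) by blast
    then have "app F (n \<oplus> \<one>) = (if n \<in> X then conj y n else y)" using F'(4)[of n] by simp
    then have "pair (n \<oplus> \<one>) (if n \<in> X then conj y n else y) \<in> F" unfolding F'(2) .
    then have "?P (n \<oplus> \<one>) (if n \<in> X then conj y n else y)"
    proof
      have "(\<forall>a. a \<lhd> n \<oplus> \<one> \<longrightarrow> a \<in> X \<longrightarrow> true_at K w a) \<longleftrightarrow>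
          (\<forall>a. a \<lhd> n \<longrightarrow> a \<in> X \<longrightarrow> true_at K w a) \<and> (n \<in> X \<longrightarrow> true_at K w n)"
        unfolding less_succ nle_def by blast
      then show "true_at K w (if n \<in> X then conj y n else y) \<longleftrightarrow>
          (\<forall>a. a \<lhd> n \<oplus> \<one> \<longrightarrow> a \<in> X \<longrightarrow> true_at K w a)"
        using y true_at_conj[OF w] by presburger
    qed
    then show "\<exists>y. ?P (n \<oplus> \<one>) y" ..
  qed
  then obtain y where "pair k y \<in> F" "true_at K w y \<longleftrightarrow> (\<forall>a. a \<lhd> k \<longrightarrow> a \<in> X \<longrightarrow> true_at K w a)" by blast
  then show ?thesis using k unfolding bounded_by_def big_conj_eq[OF F k] F'(2)[symmetric] by blast
qed

text \<open>Saturation with the coded conjunctions replaced by joint satisfaction of their conjuncts.\<close>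

lemma saturated_iff:
  "modally_saturated K \<longleftrightarrow> (\<forall>w\<in>Wld K. \<forall>\<Gamma>\<in>SS.
    (\<forall>\<Delta>. finite_set \<Delta> \<and> \<Delta> \<subseteq> \<Gamma> \<longrightarrow> (\<exists>v. rel (Acc K) w v \<and> (\<forall>a\<in>\<Delta>. true_at K v a))) \<longrightarrow>
    (\<exists>v. rel (Acc K) w v \<and> (\<forall>a\<in>\<Gamma>. true_at K v a)))"
proof -
  have 1: "forces K w (dia (big_conj \<Delta>)) \<longleftrightarrow> (\<exists>v. rel (Acc K) w v \<and> (\<forall>a\<in>\<Delta>. true_at K v a))"
    if "w \<in> Wld K" "finite_set \<Delta>" for w \<Delta>
    using that rel_world by (auto simp: forces_true_at true_at_dia true_at_big_conj)
  have 2: "(\<exists>u\<in>successors K w. forces_all K u \<Gamma>) \<longleftrightarrow> (\<exists>v. rel (Acc K) w v \<and> (\<forall>a\<in>\<Gamma>. true_at K v a))" for w \<Gamma>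
    using rel_world by (auto simp: successors_def forces_all_def forces_true_at)
  show ?thesis unfolding modally_saturated_def 2 Fml_def using 1 by (simp cong: ball_cong conj_cong) 
qed

text \<open>An instance of \<open>\<Sigma>\<^sub>1\<close> bounding: the induction on \<open>n\<close> finds a bound \<open>b\<close> such that each
successor below \<open>n\<close> refutes a member of \<open>\<Gamma>\<close> below \<open>b\<close>.\<close>

lemma image_finite_saturated:
  assumes "image_finite K"
  shows "modally_saturated K"
  unfolding saturated_iff
proof (intro ballI impI, rule ccontr)
  fix w \<Gamma> assume w: "w \<in> Wld K" and \<Gamma>: "\<Gamma> \<in> SS"
    and fin: "\<forall>\<Delta>. finite_set \<Delta> \<and> \<Delta> \<subseteq> \<Gamma> \<longrightarrow> (\<exists>v. rel (Acc K) w v \<and> (\<forall>a\<in>\<Delta>. true_at K v a))"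
    and none: "\<not> (\<exists>v. rel (Acc K) w v \<and> (\<forall>a\<in>\<Gamma>. true_at K v a))"
  obtain k where k: "bounded_by (successors K w) k"
    using assms w unfolding image_finite_def finite_set_def by blast
  let ?P = "\<lambda>b n. \<forall>v. v \<lhd> n \<longrightarrow> rel (Acc K) w v \<longrightarrow> (\<exists>a. a \<lhd> b \<and> a \<in> \<Gamma> \<and> \<not> true_at K v a)"
  have "\<exists>b. ?P b k"
  proof (rule sigma01_induct[where P = ?P])
    show "delta0 (\<lambda>e. ?P (e 0) (e (Suc 0)))" by (intro delta0_intros delta0_true_at delta0_rel \<Gamma>)
    show "\<exists>b. ?P b \<zero>" by (simp add: not_less_zero)
    fix n b assume b: "?P b n"
    obtain a where a: "rel (Acc K) w n \<longrightarrow> a \<in> \<Gamma> \<and> \<not> true_at K n a" using none by blast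
    have "?P (b \<oplus> (a \<oplus> \<one>)) (n \<oplus> \<one>)"
    proof (intro allI impI)
      fix v assume "v \<lhd> n \<oplus> \<one>" and rel: "rel (Acc K) w v"
      then consider "v = n" | "v \<lhd> n" using less_succ nle_def by blast
      then show "\<exists>a'. a' \<lhd> b \<oplus> (a \<oplus> \<one>) \<and> a' \<in> \<Gamma> \<and> \<not> true_at K v a'"
      proof cases
        case 1
        have "a \<lhd> b \<oplus> (a \<oplus> \<one>)" using le_plus(2)[of "a \<oplus> \<one>" b] less_plus_one[of a] by order
        with 1 a rel show ?thesis by blast
      next
        case 2
        then obtain a' where "a' \<lhd> b" "a' \<in> \<Gamma> \<and> \<not> true_at K v a'" using b rel by blast
        moreover from this(1) have "a' \<lhd> b \<oplus> (a \<oplus> \<one>)" using le_plus(1)[of b "a \<oplus> \<one>"] by order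
        ultimately show ?thesis by blast
      qed
    qed
    then show "\<exists>b. ?P b (n \<oplus> \<one>)" ..
  qed
  then obtain b where b: "?P b k" ..
  let ?D = "{a. a \<in> \<Gamma> \<and> a \<lhd> b}"
  have "?D \<in> SS" by (intro delta0_comprehension delta0_intros \<Gamma>)
  then have "finite_set ?D" unfolding finite_set_def bounded_by_def by blast
  then obtain v where v: "rel (Acc K) w v" "\<forall>a\<in>?D. true_at K v a" using fin by blast
  then have "v \<lhd> k" using k rel_world unfolding bounded_by_def successors_def by blast
  then show False using b v by blast
qed

end

section \<open>From arithmetical comprehension to the Hennessy--Milner theorem\<close>

lemma modally_equivalent_iff:
  assumes "kripke_model K" "w \<in> Wld K" "kripke_model K'" "w' \<in> Wld K'"
  shows "modally_equivalent K w K' w' \<longleftrightarrow> (\<forall>a. true_at K w a \<longleftrightarrow> true_at K' w' a)"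
  using assms by (simp add: modally_equivalent_def Fml_def val_iff true_at_def)

lemma bisimulation_world:
  "bisimulation Z K K' \<Longrightarrow> rel Z v v' \<Longrightarrow> v \<in> Wld K \<and> v' \<in> Wld K'"
  unfolding bisimulation_def cprod_def rel_def by auto

text \<open>The induction hypothesis must cover all related pairs. These are quantified as one number \<open>z\<close>, the code of the pair,
so that the claim is \<open>\<Pi>\<^sub>1\<close>.\<close>

lemma bisimilar_equivalent:
  assumes K: "kripke_model K" and K': "kripke_model K'" and Z: "bisimulation Z K K'" and "rel Z v v'"
  shows "true_at K v a \<longleftrightarrow> true_at K' v' a"
proof -
  have "Z \<in> SS" using Z unfolding bisimulation_def by blast
  let ?P = "\<lambda>z a. \<forall>v. v \<unlhd> z \<longrightarrow> (\<forall>v'. v' \<unlhd> z \<longrightarrow> z = pair v v' \<and> z \<in> Z \<longrightarrow> true_at K v a = true_at K' v' a)"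
  have P: "?P z a \<longleftrightarrow> (\<forall>v v'. z = pair v v' \<longrightarrow> rel Z v v' \<longrightarrow> true_at K v a = true_at K' v' a)" for z a
    by (auto simp: rel_def)
  note world = bisimulation_world[OF Z]
  have "?P z a" for z a
  proof (rule pi01_formula_induct[where P = ?P])
    show "delta0 (\<lambda>e. ?P (e 0) (e (Suc 0)))" by (intro delta0_intros delta0_true_at K K' \<open>Z \<in> SS\<close>)
    fix z
    show "?P z falsum" unfolding P using world true_at_falsum K K' by blast
    show "?P z (pvar i)" for i unfolding P
    proof (intro allI impI)
      fix v v' assume "rel Z v v'"
      then have "val K v (pvar i) = \<one> \<longleftrightarrow> val K' v' (pvar i) = \<one>"
        using Z unfolding bisimulation_def Prop_def by blast
      then show "true_at K v (pvar i) = true_at K' v' (pvar i)"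
        using world[OF \<open>rel Z v v'\<close>] by (simp add: val_iff[OF K] val_iff[OF K'] true_at_def)
    qed
    show "?P z (imp a b)" if "\<And>z. ?P z a" "\<And>z. ?P z b" for a b
      using that world true_at_imp K K' unfolding P by (metis (no_types, lifting))
    show "?P z (box a)" if IH: "\<And>z. ?P z a" for a unfolding P
    proof (intro allI impI)
      fix v v' assume vv': "rel Z v v'"
      have "(\<forall>u. rel (Acc K) v u \<longrightarrow> true_at K u a) = (\<forall>u'. rel (Acc K') v' u' \<longrightarrow> true_at K' u' a)"
        using Z vv' IH unfolding P bisimulation_def by (metis (no_types, lifting))
      then show "true_at K v (box a) = true_at K' v' (box a)"
        using world[OF vv'] by (simp add: true_at_box K K')
    qed
  qed
  then show ?thesis using \<open>rel Z v v'\<close> unfolding P by blast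
qed

text \<open>The theory of \<open>u\<close> is a set, and each of its finite subsets is realized at a successor of \<open>v'\<close>, since \<open>v\<close> satisfies the
possibility of its conjunction. A successor of \<open>v'\<close> that satisfies the theory of \<open>u\<close> is equivalent to
\<open>u\<close>, because the theory decides every formula.\<close>

lemma saturated_match:
  assumes K: "kripke_model K" and K': "kripke_model K'" and sat: "modally_saturated K'"
    and v: "v \<in> Wld K" "v' \<in> Wld K'" and eq: "\<And>a. true_at K v a \<longleftrightarrow> true_at K' v' a" and u: "rel (Acc K) v u"
  obtains u' where "rel (Acc K') v' u'" "\<And>a. true_at K u a \<longleftrightarrow> true_at K' u' a"
proof -
  have uw: "u \<in> Wld K" using rel_world[OF K u] by blast
  let ?G = "{a. true_at K u a}"
  have "?G \<in> SS" by (intro delta0_comprehension delta0_intros delta0_true_at K)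
  moreover have "\<exists>u'. rel (Acc K') v' u' \<and> (\<forall>a\<in>\<Delta>. true_at K' u' a)" if "finite_set \<Delta>" "\<Delta> \<subseteq> ?G" for \<Delta>
  proof -
    have "true_at K u (big_conj \<Delta>)" using that true_at_big_conj[OF K uw] by blast
    then have "true_at K v (dia (big_conj \<Delta>))" using true_at_dia[OF K v(1)] u by blast
    then obtain u' where u': "rel (Acc K') v' u'" "true_at K' u' (big_conj \<Delta>)"
      using eq true_at_dia[OF K' v(2)] by blast
    then show ?thesis using true_at_big_conj[OF K' _ that(1)] rel_world[OF K'] by blast
  qed
  ultimately obtain u' where u': "rel (Acc K') v' u'" "\<forall>a\<in>?G. true_at K' u' a"
    using sat v(2) unfolding saturated_iff[OF K'] by (metis (no_types, lifting))
  have "true_at K' u' a \<Longrightarrow> true_at K u a" for a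
    using u' true_at_neg[OF K uw] true_at_neg[OF K', of u'] rel_world[OF K' u'(1)] by blast
  with u' show thesis using that by blast
qed

lemma bounded_arithmetical: "bounded_fm \<phi> \<Longrightarrow> arithmetical \<phi>"
  by (induction rule: bounded_fm.induct) simp_all

lemma pi01_comprehension:
  assumes ACA: arithmetical_comprehension and "delta0 (\<lambda>e. P (e 0) (e (Suc 0)))"
  shows "{n. \<forall>a. P a n} \<in> SS"
proof -
  obtain e E \<phi> where E: "range E \<subseteq> SS" and \<phi>: "bounded_fm \<phi>"
    and sat: "\<And>a n. sat (e(Suc 0 := n, 0 := a)) E \<phi> = P a n"
    by (rule delta0_formula_pair[OF assms(2,2) sets_nonempty]) blast
  have "arithmetical (AllN 0 \<phi>)" using \<phi> bounded_arithmetical by simp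
  then obtain X where "X \<in> SS" "\<forall>n. n \<in> X \<longleftrightarrow> sat (e(Suc 0 := n)) E (AllN 0 \<phi>)"
    using ACA E unfolding arithmetical_comprehension_def by blast
  moreover from this(2) have "X = {n. \<forall>a. P a n}" using sat by auto
  ultimately show ?thesis by simp
qed

lemma ACA_hennessy_milner_saturated:
  assumes ACA: arithmetical_comprehension
  shows hennessy_milner_saturated
  unfolding hennessy_milner_saturated_def pointed_model_def
proof (intro allI impI iffI)
  fix K w K' w'
  assume "(kripke_model K \<and> w \<in> Wld K) \<and> modally_saturated K \<and>
    (kripke_model K' \<and> w' \<in> Wld K') \<and> modally_saturated K'"
  then have K: "kripke_model K" "w \<in> Wld K" "modally_saturated K"
    and K': "kripke_model K'" "w' \<in> Wld K'" "modally_saturated K'" by blast+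
  note equiv = modally_equivalent_iff[OF K(1,2) K'(1,2)]
  show "modally_equivalent K w K' w'" if "bisimilar K w K' w'"
    using that bisimilar_equivalent[OF K(1) K'(1)] unfolding equiv bisimilar_def by blast
  assume eq: "modally_equivalent K w K' w'"
  let ?E = "\<lambda>v v'. v \<in> Wld K \<and> v' \<in> Wld K' \<and> (\<forall>a. true_at K v a \<longleftrightarrow> true_at K' v' a)"
  let ?P = "\<lambda>a z. \<exists>v. v \<unlhd> z \<and> (\<exists>v'. v' \<unlhd> z \<and> z = pair v v' \<and> v \<in> Wld K \<and> v' \<in> Wld K' \<and>
    (true_at K v a \<longleftrightarrow> true_at K' v' a))"
  define Z where "Z = {z. \<forall>a. ?P a z}"
  have "Z \<in> SS" unfolding Z_def
    by (intro pi01_comprehension[OF ACA] delta0_intros delta0_true_at model_sets K K')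
  have Z: "rel Z v v' \<longleftrightarrow> ?E v v'" for v v'
    unfolding rel_def Z_def by auto
  have "Z \<subseteq> cprod (Wld K) (Wld K')" unfolding Z_def cprod_def by blast
  moreover have ww': "rel Z w w'" using eq K K' unfolding Z equiv by blast
  ultimately have "bisimulation Z K K'" unfolding bisimulation_def
  proof (intro conjI allI impI ballI)
    fix v v' assume "rel Z v v'"
    then show "val K v p = \<one> \<longleftrightarrow> val K' v' p = \<one>" for p
      unfolding Z by (simp add: val_iff[OF K(1)] val_iff[OF K'(1)] true_at_def)
  next
    fix v v' u assume "rel Z v v' \<and> rel (Acc K) v u"
    then show "\<exists>u'. rel Z u u' \<and> rel (Acc K') v' u'"
      unfolding Z using saturated_match[OF K(1) K'(1,3), of v v' u] rel_world[OF K(1)] rel_world[OF K'(1)] by metis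
  next
    fix v v' u' assume "rel Z v v' \<and> rel (Acc K') v' u'"
    then show "\<exists>u. rel Z u u' \<and> rel (Acc K) v u"
      unfolding Z using saturated_match[OF K'(1) K(1,3), of v' v u'] rel_world[OF K(1)] rel_world[OF K'(1)] by metis
  qed (use \<open>Z \<in> SS\<close> in \<open>auto simp: rel_def\<close>)
  with ww' \<open>Z \<in> SS\<close> show "bisimilar K w K' w'" unfolding bisimilar_def by blast
qed

lemma saturated_image_finite:
  "hennessy_milner_saturated \<Longrightarrow> hennessy_milner_image_finite"
  unfolding hennessy_milner_saturated_def hennessy_milner_image_finite_def pointed_model_def
  using image_finite_saturated by blast

section \<open>A model whose bisimulations compute projections\<close>

text \<open>The worlds are numbers, and the five kinds of worlds are told apart with two constructors of
formulas, whose ranges are disjoint. What matters is that they are linear: in contrast to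
codes by pairs, the edges that do not depend on a witness raise the code by at most a fixed amount.\<close>

abbreviation "loop a \<equiv> pvar (pvar a)"
abbreviation "chain a \<equiv> pvar (box a)"
abbreviation "probe n \<equiv> box (pvar n)"
abbreviation "left n \<equiv> box (box (pvar n))"
abbreviation "right n \<equiv> box (box (box n))"

text \<open>Multiplication by 27, the largest slope among the codes of worlds.\<close>

definition scale :: "'a \<Rightarrow> 'a" where
  "scale c = thrice (thrice (thrice c))"

lemma delta0_fun_scale: "delta0_fun f \<Longrightarrow> delta0_fun (\<lambda>e. scale (f e))"
  unfolding scale_def by (intro delta0_intros)

lemma thrice_plus: "thrice (a \<oplus> b) = thrice a \<oplus> thrice b"
  by (simp add: thrice_def arith_ac)

lemma scale_plus: "scale (a \<oplus> b) = scale a \<oplus> scale b"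
  by (simp add: scale_def thrice_plus)

lemma thrice_mono: "a \<unlhd> b \<Longrightarrow> thrice a \<unlhd> thrice b"
  unfolding thrice_def by (intro ar.add_mono)

lemma scale_mono: "a \<unlhd> b \<Longrightarrow> scale a \<unlhd> scale b"
  unfolding scale_def by (intro thrice_mono)

lemma thrice_one: "thrice \<one> = three" by (simp add: thrice_def)

lemma box_mono: "a \<unlhd> b \<Longrightarrow> box a \<unlhd> box b"
  unfolding box_def by (intro ar.add_mono thrice_mono) simp_all

lemma pvar_le_box: "a \<unlhd> b \<Longrightarrow> pvar a \<unlhd> box b"
  unfolding box_def pvar_def
  by (rule ar.order_trans[OF ar.add_right_mono[OF thrice_mono] le_plus(1)])

lemma box_le_thrice: "box a \<unlhd> thrice (a \<oplus> \<one>)"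
  unfolding thrice_plus thrice_one box_def by (simp add: ar.add.assoc[symmetric])

lemma pvar_le_thrice: "pvar a \<unlhd> thrice (a \<oplus> \<one>)"
  using pvar_le_box[of a a] box_le_thrice[of a] by (simp add: ar.order_trans)

lemma codes_le_scale: "loop a \<unlhd> scale (a \<oplus> \<one>)" "chain a \<unlhd> scale (a \<oplus> \<one>)"
proof -
  have *: "pvar x \<unlhd> scale (a \<oplus> \<one>)" if "x \<unlhd> thrice (a \<oplus> \<one>)" for x
  proof -
    have "pvar x \<unlhd> thrice (x \<oplus> \<one>)" by (rule pvar_le_thrice)
    also have "x \<oplus> \<one> \<unlhd> thrice (a \<oplus> \<one>) \<oplus> thrice (a \<oplus> \<one>)"
      using that ar.order_trans[OF le_plus(2) le_thrice, of \<one> a] by (intro ar.add_mono)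
    then have "thrice (x \<oplus> \<one>) \<unlhd> scale (a \<oplus> \<one>)"
      unfolding scale_def thrice_def[of "thrice (a \<oplus> \<one>)"]
      by (intro thrice_mono) (auto intro: ar.order_trans)
    finally show ?thesis .
  qed
  show "loop a \<unlhd> scale (a \<oplus> \<one>)" "chain a \<unlhd> scale (a \<oplus> \<one>)"
    by (rule *, rule pvar_le_thrice) (rule *, rule box_le_thrice)
qed

lemma box_plus: "box (a \<oplus> b) = box a \<oplus> thrice b"
  and pvar_plus: "pvar (a \<oplus> b) = pvar a \<oplus> thrice b"
  by (simp_all add: box_def pvar_def thrice_plus arith_ac)

context
  fixes \<Theta> :: "'a set"
  assumes \<Theta>: "\<Theta> \<in> SS"
begin

text \<open>The least witness instead of any witness keeps the model image-finite.\<close>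

definition least_wit :: "'a \<Rightarrow> 'a \<Rightarrow> bool" where
  "least_wit n a \<longleftrightarrow> pair n a \<in> \<Theta> \<and> (\<forall>b. b \<lhd> a \<longrightarrow> pair n b \<notin> \<Theta>)"

lemma least_wit_unique: "least_wit n a \<Longrightarrow> least_wit n b \<Longrightarrow> a = b"
  unfolding least_wit_def using ar.neqE by blast

lemma least_wit_exists: "pair n b \<in> \<Theta> \<Longrightarrow> \<exists>a. least_wit n a"
proof -
  assume "pair n b \<in> \<Theta>"
  moreover have "delta0 (\<lambda>e. pair n (e 0) \<in> \<Theta>)" by (intro delta0_intros \<Theta>)
  ultimately show ?thesis using delta0_least[where P = "\<lambda>b. pair n b \<in> \<Theta>"] unfolding least_wit_def by metis
qed

definition spine :: "'a \<Rightarrow> bool" where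
  "spine x \<longleftrightarrow> (\<exists>n. n \<unlhd> x \<and> (x = left n \<or> x = right n))"

text \<open>The top of a chain of length \<open>a\<close> is \<open>chain a\<close>, and \<open>chain \<zero>\<close> is a dead end; numbers that code no
world of the five kinds are isolated. All the worlds \<open>loop a\<close> are alike, but there has to be one for each \<open>a\<close>: the edge from
\<open>right n\<close> to \<open>loop a\<close> records the witness, so that the edges form a set.\<close>

definition edge :: "'a \<Rightarrow> 'a \<Rightarrow> bool" where
  "edge x y \<longleftrightarrow> (\<exists>n. n \<unlhd> x \<and>
     (x = loop n \<and> y = loop n \<or>
      x = chain (n \<oplus> \<one>) \<and> y = chain n \<or>
      x = probe n \<and> (y = loop \<zero> \<or> (\<exists>a. a \<unlhd> y \<and> y = chain a \<and> least_wit n a)) \<or>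
      x = left n \<and> (y = left (n \<oplus> \<one>) \<or> y = loop \<zero> \<or> y = probe n) \<or>
      x = right n \<and> (y = right (n \<oplus> \<one>) \<or> y = probe n \<or> (\<exists>a. a \<unlhd> y \<and> y = loop a \<and> least_wit n a))))"

lemma code_bounds: "a \<unlhd> loop a" "a \<unlhd> chain a" "a \<unlhd> chain (a \<oplus> \<one>)" "a \<unlhd> probe a" "a \<unlhd> left a" "a \<unlhd> right a"
proof -
  have p: "x \<unlhd> y \<Longrightarrow> x \<unlhd> pvar y" and b: "x \<unlhd> y \<Longrightarrow> x \<unlhd> box y" for x y
    using subformula_less(1)[of y] subformula_less(2)[of y] by order+
  show "a \<unlhd> loop a" "a \<unlhd> chain a" "a \<unlhd> chain (a \<oplus> \<one>)" "a \<unlhd> probe a" "a \<unlhd> left a" "a \<unlhd> right a"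
    by (intro p b; simp)+
qed

lemma spine_simps [simp]:
  "\<not> spine (loop a)" "\<not> spine (chain a)" "\<not> spine (probe a)" "spine (left a)" "spine (right a)"
  using code_bounds by (auto simp: spine_def)

lemma edge_simps [simp]:
  "edge (loop a) y \<longleftrightarrow> y = loop a"
  "edge (chain \<zero>) y \<longleftrightarrow> False"
  "edge (chain (a \<oplus> \<one>)) y \<longleftrightarrow> y = chain a"
  "edge (probe n) y \<longleftrightarrow> y = loop \<zero> \<or> (\<exists>a. y = chain a \<and> least_wit n a)"
  "edge (left n) y \<longleftrightarrow> y = left (n \<oplus> \<one>) \<or> y = loop \<zero> \<or> y = probe n"
  "edge (right n) y \<longleftrightarrow> y = right (n \<oplus> \<one>) \<or> y = probe n \<or> (\<exists>a. y = loop a \<and> least_wit n a)"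
  using succ_neq_zero[THEN not_sym] by (auto simp: edge_def code_bounds dest: succ_inject)

lemma edge_cases:
  assumes "edge x y"
  obtains a where "x = loop a" "y = loop a" | a where "x = chain (a \<oplus> \<one>)" "y = chain a"
  | n where "x = probe n" "y = loop \<zero>" | n a where "x = probe n" "y = chain a" "least_wit n a"
  | n where "x = left n" "y = left (n \<oplus> \<one>)" | n where "x = left n" "y = loop \<zero>"
  | n where "x = left n" "y = probe n" | n where "x = right n" "y = right (n \<oplus> \<one>)"
  | n where "x = right n" "y = probe n" | n a where "x = right n" "y = loop a" "least_wit n a"
  using assms unfolding edge_def by blast

text \<open>Only the edges that depend on a witness lead far away.\<close>

lemma edge_near:
  assumes "edge x y"
  shows "y \<unlhd> x \<oplus> scale \<one> \<or> (\<exists>n a. least_wit n a \<and> (x = probe n \<and> y = chain a \<or> x = right n \<and> y = loop a))"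
  using assms
proof (cases rule: edge_cases)
  case (2 a)
  have "chain a \<unlhd> chain (a \<oplus> \<one>)" by (simp add: box_plus pvar_plus)
  with 2 show ?thesis by (auto intro: ar.order_trans)
next
  case (3 n)
  then show ?thesis using codes_le_scale(1)[of \<zero>] by (auto intro: ar.order_trans)
next
  case (6 n)
  then show ?thesis using codes_le_scale(1)[of \<zero>] by (auto intro: ar.order_trans)
next
  case (7 n)
  have "probe n \<unlhd> left n" using subformula_less(2)[of "box (pvar n)"] nle_def by blast
  with 7 show ?thesis by (auto intro: ar.order_trans)
next
  case (9 n)
  have "probe n \<unlhd> box (box n)" by (intro box_mono pvar_le_box) simp
  also have "\<dots> \<unlhd> right n" using subformula_less(2)[of "box (box n)"] nle_def by blast
  finally show ?thesis using 9 by (auto intro: ar.order_trans)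
qed (auto simp: box_plus pvar_plus scale_def)

lemma delta0_least_wit: "delta0_fun f \<Longrightarrow> delta0_fun g \<Longrightarrow> delta0 (\<lambda>e. least_wit (f e) (g e))"
  by (rule delta0_fn_subst2[where Q = "\<lambda>x y e. least_wit x y"], assumption+)
    (unfold least_wit_def, intro delta0_intros \<Theta>)

lemma delta0_edge: "delta0_fun f \<Longrightarrow> delta0_fun g \<Longrightarrow> delta0 (\<lambda>e. edge (f e) (g e))"
  by (rule delta0_fn_subst2[where Q = "\<lambda>x y e. edge x y"], assumption+)
    (unfold edge_def, intro delta0_intros delta0_least_wit)

lemma delta0_spine: "delta0_fun f \<Longrightarrow> delta0 (\<lambda>e. spine (f e))"
  by (rule delta0_fn_subst[where Q = "\<lambda>x e. spine x"], assumption)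
    (unfold spine_def, intro delta0_intros)

text \<open>The key under which the truth value of formula \<open>c\<close> at world \<open>x\<close> is computed. Adding \<open>scale c\<close> lets the
world grow when the formula shrinks: passing from \<open>box b\<close> to \<open>b\<close> leaves room for a world up to
\<open>x + scale (b + 1)\<close>, which covers the edges that do not depend on a witness and all witnesses up to \<open>b\<close>.\<close>

definition item :: "'a \<Rightarrow> 'a \<Rightarrow> 'a" where
  "item x c = pair (x \<oplus> scale c) c"

lemma item_inject: "item x c = item y d \<longleftrightarrow> x = y \<and> c = d"
  by (auto simp: item_def)

lemma delta0_fun_item: "delta0_fun f \<Longrightarrow> delta0_fun g \<Longrightarrow> delta0_fun (\<lambda>e. item (f e) (g e))"
  unfolding item_def by (intro delta0_intros delta0_fun_scale)

lemma item_less: "a \<lhd> c \<Longrightarrow> item x a \<lhd> item x c"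
  unfolding item_def by (intro pair_less ar.add_mono scale_mono) (auto simp: nle_def)

lemma item_less_box:
  assumes "y \<unlhd> x \<oplus> scale (b \<oplus> \<one>)"
  shows "item y b \<lhd> item x (box b)"
  unfolding item_def
proof (intro pair_less)
  have "y \<oplus> scale b \<unlhd> x \<oplus> scale (b \<oplus> \<one>) \<oplus> scale b" using assms by (rule ar.add_right_mono)
  also have "\<dots> = x \<oplus> scale (b \<oplus> \<one> \<oplus> b)" by (simp add: scale_plus ar.add.assoc)
  also have "\<dots> \<unlhd> x \<oplus> scale (box b)"
  proof (intro ar.add_left_mono scale_mono)
    have "box b = (b \<oplus> \<one> \<oplus> b) \<oplus> (b \<oplus> \<one>)" by (simp add: box_def thrice_def arith_ac)
    then show "b \<oplus> \<one> \<oplus> b \<unlhd> box b" using le_plus(1) by metis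
  qed
  finally show "y \<oplus> scale b \<unlhd> x \<oplus> scale (box b)" .
qed simp

text \<open>Truth in which a box only looks at successors that are near relative to the formula. This is a course-of-values
recursion; that the far successors make no difference is shown in \<open>holds_box\<close>.\<close>

lemma truncated_truth:
  obtains X where "X \<in> SS" "\<And>x. item x falsum \<notin> X"
    "\<And>x i. item x (pvar i) \<in> X \<longleftrightarrow> spine x"
    "\<And>x a b. item x (imp a b) \<in> X \<longleftrightarrow> (item x a \<in> X \<longrightarrow> item x b \<in> X)"
    "\<And>x b. item x (box b) \<in> X \<longleftrightarrow> (\<forall>y. y \<unlhd> x \<oplus> scale (b \<oplus> \<one>) \<longrightarrow> edge x y \<longrightarrow> item y b \<in> X)"
proof -
  let ?\<psi> = "\<lambda>x c A. (\<exists>i. i \<unlhd> c \<and> c = pvar i \<and> spine x) \<or>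
     (\<exists>a. a \<unlhd> c \<and> (\<exists>b. b \<unlhd> c \<and> c = imp a b \<and> (A (item x a) \<longrightarrow> A (item x b)))) \<or>
     (\<exists>b. b \<unlhd> c \<and> c = box b \<and> (\<forall>y. y \<unlhd> x \<oplus> scale (b \<oplus> \<one>) \<longrightarrow> edge x y \<longrightarrow> A (item y b)))"
  let ?\<Phi> = "\<lambda>u A. \<exists>x. x \<unlhd> u \<and> (\<exists>c. c \<unlhd> u \<and> u = item x c \<and> ?\<psi> x c A)"
  obtain X where X: "X \<in> SS" "\<And>u. u \<in> X \<longleftrightarrow> ?\<Phi> u (\<lambda>v. v \<in> X)"
  proof (rule set_recursion[where \<Phi> = ?\<Phi>])
    show "delta0 (\<lambda>e. ?\<Phi> (e 0) (\<lambda>v. coded_mem v (e (Suc 0))))"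
      by (intro delta0_intros delta0_coded_mem delta0_spine delta0_edge delta0_fun_item delta0_fun_scale)
    fix u and A B :: "'a \<Rightarrow> bool" assume AB: "\<And>v. v \<lhd> u \<Longrightarrow> A v = B v"
    have imp: "A (item x a) = B (item x a)" "A (item x b) = B (item x b)" if "u = item x (imp a b)" for x a b
      using that AB item_less subformula_less by blast+
    have box: "A (item y b) = B (item y b)" if "u = item x (box b)" "y \<unlhd> x \<oplus> scale (b \<oplus> \<one>)" for x y b
      using that AB item_less_box by blast
    have "?\<psi> x c A = ?\<psi> x c B" if "u = item x c" for x c
    proof (cases c rule: formula_cases)
      case (3 b)
      then show ?thesis using box[of x b] that by auto
    next
      case (4 a b)
      then show ?thesis using imp[of x a b] that by simp
    qed simp_all
    then show "?\<Phi> u A = ?\<Phi> u B" by (intro ex_cong1 conj_cong refl)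
  qed blast
  have le: "x \<unlhd> item x c" "c \<unlhd> item x c" for x c
    unfolding item_def by (rule ar.order_trans[OF le_plus(1) le_pair(1)]) (rule le_pair(2))
  have sub: "i \<unlhd> pvar i" "a \<unlhd> box a" "a \<unlhd> imp a b" "b \<unlhd> imp a b" for i a b
    using subformula_less nle_def by blast+
  have X': "item x c \<in> X \<longleftrightarrow> ?\<psi> x c (\<lambda>v. v \<in> X)" for x c
    unfolding X(2)[of "item x c"] item_inject using le by blast
  show thesis
    by (rule that[OF X(1)]; subst X'; simp add: sub)
qed

text \<open>One such set is chosen so that the equations for truth become unconditional rewrite rules.\<close>

definition truth_set :: "'a set" where
  "truth_set = (SOME X. X \<in> SS \<and> (\<forall>x. item x falsum \<notin> X) \<and>
    (\<forall>x i. item x (pvar i) \<in> X \<longleftrightarrow> spine x) \<and>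
    (\<forall>x a b. item x (imp a b) \<in> X \<longleftrightarrow> (item x a \<in> X \<longrightarrow> item x b \<in> X)) \<and>
    (\<forall>x b. item x (box b) \<in> X \<longleftrightarrow> (\<forall>y. y \<unlhd> x \<oplus> scale (b \<oplus> \<one>) \<longrightarrow> edge x y \<longrightarrow> item y b \<in> X)))"

definition holds :: "'a \<Rightarrow> 'a \<Rightarrow> bool" where
  "holds x c \<longleftrightarrow> item x c \<in> truth_set"

lemma truth_set: "truth_set \<in> SS"
  and holds_falsum [simp]: "\<not> holds x falsum"
  and holds_pvar [simp]: "holds x (pvar i) \<longleftrightarrow> spine x"
  and holds_imp [simp]: "holds x (imp a b) \<longleftrightarrow> (holds x a \<longrightarrow> holds x b)"
  and holds_box_near: "holds x (box b) \<longleftrightarrow> (\<forall>y. y \<unlhd> x \<oplus> scale (b \<oplus> \<one>) \<longrightarrow> edge x y \<longrightarrow> holds y b)"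
proof -
  have "\<exists>X. X \<in> SS \<and> (\<forall>x. item x falsum \<notin> X) \<and>
    (\<forall>x i. item x (pvar i) \<in> X \<longleftrightarrow> spine x) \<and>
    (\<forall>x a b. item x (imp a b) \<in> X \<longleftrightarrow> (item x a \<in> X \<longrightarrow> item x b \<in> X)) \<and>
    (\<forall>x b. item x (box b) \<in> X \<longleftrightarrow> (\<forall>y. y \<unlhd> x \<oplus> scale (b \<oplus> \<one>) \<longrightarrow> edge x y \<longrightarrow> item y b \<in> X))"
    by (rule truncated_truth) blast
  from someI_ex[OF this] show "truth_set \<in> SS" "\<not> holds x falsum" "holds x (pvar i) \<longleftrightarrow> spine x"
    "holds x (imp a b) \<longleftrightarrow> (holds x a \<longrightarrow> holds x b)"
    "holds x (box b) \<longleftrightarrow> (\<forall>y. y \<unlhd> x \<oplus> scale (b \<oplus> \<one>) \<longrightarrow> edge x y \<longrightarrow> holds y b)"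
    unfolding truth_set_def[symmetric] holds_def by blast+
qed

lemma delta0_holds: "delta0_fun f \<Longrightarrow> delta0_fun g \<Longrightarrow> delta0 (\<lambda>e. holds (f e) (g e))"
  unfolding holds_def by (intro delta0_intros delta0_fun_item truth_set)

lemma near: "y \<unlhd> x \<oplus> scale \<one> \<Longrightarrow> y \<unlhd> x \<oplus> scale (b \<oplus> \<one>)"
  using ar.add_left_mono[OF scale_mono[OF le_plus(2)[of \<one> b]], of x] by order

lemma holds_loop_box [simp]: "holds (loop a) (box b) \<longleftrightarrow> holds (loop a) b"
  unfolding holds_box_near by auto

lemma holds_loop: "holds (loop a) b \<longleftrightarrow> holds (loop \<zero>) b"
  by (rule pi01_formula_induct[where P = "\<lambda>a b. holds (loop a) b \<longleftrightarrow> holds (loop \<zero>) b"])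
    (intro delta0_intros delta0_holds, simp, simp, simp, metis holds_imp)

text \<open>A formula sees no further than its code, so it does not notice the end of a chain that is at least as long.\<close>

lemma holds_chain: "b \<unlhd> a \<longrightarrow> (holds (chain a) b \<longleftrightarrow> holds (loop \<zero>) b)"
proof (rule pi01_formula_induct[where P = "\<lambda>a b. b \<unlhd> a \<longrightarrow> (holds (chain a) b \<longleftrightarrow> holds (loop \<zero>) b)"])
  show "delta0 (\<lambda>e. e (Suc 0) \<unlhd> e 0 \<longrightarrow> (holds (chain (e 0)) (e (Suc 0)) \<longleftrightarrow> holds (loop \<zero>) (e (Suc 0))))"
    by (intro delta0_intros delta0_holds)
  fix x b assume IH: "\<And>x. b \<unlhd> x \<longrightarrow> holds (chain x) b = holds (loop \<zero>) b"
  show "box b \<unlhd> x \<longrightarrow> holds (chain x) (box b) = holds (loop \<zero>) (box b)"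
  proof
    assume x: "box b \<unlhd> x"
    then have "b \<lhd> x" using subformula_less(2)[of b] by order
    then obtain y where y: "x = y \<oplus> \<one>" using nonzero_succ not_less_zero by metis
    then have "b \<unlhd> y" using \<open>b \<lhd> x\<close> less_succ by blast
    have "chain y \<unlhd> chain x \<oplus> scale \<one>" using edge_near[of "chain x" "chain y"] y by auto
    then show "holds (chain x) (box b) = holds (loop \<zero>) (box b)"
      using IH \<open>b \<unlhd> y\<close> near unfolding holds_box_near y by auto
  qed
next
  fix x a b
  assume "\<And>x. a \<unlhd> x \<longrightarrow> holds (chain x) a = holds (loop \<zero>) a" "\<And>x. b \<unlhd> x \<longrightarrow> holds (chain x) b = holds (loop \<zero>) b"
  moreover have "imp a b \<unlhd> x \<Longrightarrow> a \<unlhd> x \<and> b \<unlhd> x" using subformula_less(3)[of a b] subformula_less(4)[of b a] by (meson ar.order_trans ar.less_imp_le)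
  ultimately show "imp a b \<unlhd> x \<longrightarrow> holds (chain x) (imp a b) = holds (loop \<zero>) (imp a b)" by auto
qed simp_all

text \<open>Without a witness below \<open>b\<close>, the world \<open>probe n\<close> sees the reflexive world and possibly a chain that \<open>b\<close> cannot tell from it.\<close>

lemma holds_probe:
  "(\<forall>a. a \<lhd> b \<longrightarrow> \<not> least_wit n a) \<longrightarrow> (holds (probe n) b \<longleftrightarrow> holds (loop \<zero>) b)"
proof (rule pi01_formula_induct[where P = "\<lambda>n b. (\<forall>a. a \<lhd> b \<longrightarrow> \<not> least_wit n a) \<longrightarrow>
    (holds (probe n) b \<longleftrightarrow> holds (loop \<zero>) b)"])
  show "delta0 (\<lambda>e. (\<forall>a. a \<lhd> e (Suc 0) \<longrightarrow> \<not> least_wit (e 0) a) \<longrightarrow>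
      (holds (probe (e 0)) (e (Suc 0)) \<longleftrightarrow> holds (loop \<zero>) (e (Suc 0))))"
    by (intro delta0_intros delta0_holds delta0_least_wit)
  fix n b
  show "(\<forall>a. a \<lhd> box b \<longrightarrow> \<not> least_wit n a) \<longrightarrow> holds (probe n) (box b) = holds (loop \<zero>) (box b)"
  proof
    assume none: "\<forall>a. a \<lhd> box b \<longrightarrow> \<not> least_wit n a"
    have "holds y b \<longleftrightarrow> holds (loop \<zero>) b" if "edge (probe n) y" for y
    proof -
      have "b \<unlhd> a" if "least_wit n a" for a
        using none that subformula_less(2)[of b] by (meson ar.less_imp_le ar.not_less ar.order_trans)
      then show ?thesis using that holds_chain[of b] by auto
    qed
    moreover have "loop \<zero> \<unlhd> probe n \<oplus> scale (b \<oplus> \<one>)" 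
      using edge_near[of "probe n" "loop \<zero>"] by (intro near) auto
    ultimately show "holds (probe n) (box b) = holds (loop \<zero>) (box b)"
      unfolding holds_loop_box by (subst holds_box_near) (use edge_simps(4)[of n "loop \<zero>"] in blast)
  qed
next
  fix n a b
  assume "\<And>n. (\<forall>k. k \<lhd> a \<longrightarrow> \<not> least_wit n k) \<longrightarrow> holds (probe n) a = holds (loop \<zero>) a"
    "\<And>n. (\<forall>k. k \<lhd> b \<longrightarrow> \<not> least_wit n k) \<longrightarrow> holds (probe n) b = holds (loop \<zero>) b"
  then show "(\<forall>k. k \<lhd> imp a b \<longrightarrow> \<not> least_wit n k) \<longrightarrow> holds (probe n) (imp a b) = holds (loop \<zero>) (imp a b)"
    unfolding holds_imp using subformula_less(3)[of a b] subformula_less(4)[of b a] ar.less_trans by blast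
qed simp_all

text \<open>A far successor satisfies the same instance \<open>b\<close> as a near one: a far chain is as good as \<open>loop \<zero>\<close> for
\<open>probe n\<close>, and a far loop is as good as \<open>probe n\<close> itself for \<open>right n\<close>, because the only witness is large.\<close>

lemma holds_box [simp]: "holds x (box b) \<longleftrightarrow> (\<forall>y. edge x y \<longrightarrow> holds y b)"
proof
  assume hyp: "holds x (box b)"
  then have near': "holds y b" if "y \<unlhd> x \<oplus> scale \<one>" "edge x y" for y
    using that near unfolding holds_box_near by blast
  show "\<forall>y. edge x y \<longrightarrow> holds y b"
  proof (intro allI impI)
    fix y assume e: "edge x y"
    show "holds y b"
    proof (cases "y \<unlhd> x \<oplus> scale (b \<oplus> \<one>)")
      case True
      then show ?thesis using hyp e unfolding holds_box_near by blast
    next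
      case False
      then obtain n a where na: "least_wit n a" "x = probe n \<and> y = chain a \<or> x = right n \<and> y = loop a"
        using edge_near[OF e] near by blast
      have "b \<unlhd> a"
      proof (rule ccontr)
        assume "\<not> b \<unlhd> a"
        then have "scale (a \<oplus> \<one>) \<unlhd> x \<oplus> scale (b \<oplus> \<one>)"
          by (intro ar.order_trans[OF scale_mono le_plus(2)]) (simp add: ar.not_le ar.less_imp_le)
        then show False using False na(2) codes_le_scale[of a] by (auto intro: ar.order_trans)
      qed
      from na(2) show ?thesis
      proof
        assume x: "x = probe n \<and> y = chain a"
        have "holds (loop \<zero>) b"
          using near'[of "loop \<zero>"] x edge_near[of x "loop \<zero>"] by auto
        then show ?thesis using x holds_chain \<open>b \<unlhd> a\<close> by blast
      next
        assume x: "x = right n \<and> y = loop a"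
        have "holds (probe n) b"
          using near'[of "probe n"] x edge_near[of x "probe n"] by auto
        moreover have "\<not> least_wit n k" if "k \<lhd> b" for k
          using that \<open>b \<unlhd> a\<close> least_wit_unique[OF na(1), of k] by (metis ar.not_le)
        ultimately show ?thesis using x holds_probe[of b n] holds_loop by blast
      qed
    qed
  qed
qed (auto simp: holds_box_near)

text \<open>If \<open>n\<close> has a witness, the two worlds have the same kinds of successors off the spine; if not,
\<open>probe n\<close> satisfies the same formulas as \<open>loop \<zero>\<close>.\<close>

lemma holds_left_right: "holds (left n) c \<longleftrightarrow> holds (right n) c"
proof (rule pi01_formula_induct[where P = "\<lambda>n c. holds (left n) c \<longleftrightarrow> holds (right n) c"])
  show "delta0 (\<lambda>e. holds (left (e 0)) (e (Suc 0)) \<longleftrightarrow> holds (right (e 0)) (e (Suc 0)))"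
    by (intro delta0_intros delta0_holds)
  fix n b assume IH: "\<And>n. holds (left n) b = holds (right n) b"
  have "holds (loop a) b = holds (loop \<zero>) b" for a by (rule holds_loop)
  moreover have "holds (probe n) b = holds (loop \<zero>) b" if "\<nexists>a. least_wit n a"
    using that holds_probe by blast
  ultimately show "holds (left n) (box b) = holds (right n) (box b)"
    using IH by (auto; blast)
qed simp_all

definition hm_model :: "'a kripke" where
  "hm_model = \<lparr>Wld = UNIV,
     Acc = {z. \<exists>x. x \<unlhd> z \<and> (\<exists>y. y \<unlhd> z \<and> z = pair x y \<and> edge x y)},
     Val = {z. \<exists>u. u \<unlhd> z \<and> (\<exists>i. i \<unlhd> z \<and> z = pair u i \<and> (\<exists>x. x \<unlhd> u \<and> (\<exists>c. c \<unlhd> u \<and> u = pair x c \<and>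
       (holds x c \<and> i = \<one> \<or> \<not> holds x c \<and> i = \<zero>))))}\<rparr>"

lemma hm_model_rel [simp]: "rel (Acc hm_model) x y \<longleftrightarrow> edge x y"
  by (auto simp: hm_model_def rel_def)

lemma hm_model_Wld [simp]: "Wld hm_model = UNIV"
  by (simp add: hm_model_def)

lemma hm_model_Val: "pair (pair x c) i \<in> Val hm_model \<longleftrightarrow> i = (if holds x c then \<one> else \<zero>)"
  by (auto simp: hm_model_def)

lemma UNIV_in_sets: "UNIV \<in> SS"
  using delta0_comprehension[of "\<lambda>_. True"] delta0_const by simp

lemma hm_model_function: "is_function (Val hm_model) (cprod (Wld hm_model) Fml) {\<zero>, \<one>}"
proof (rule is_functionI)
  show "Val hm_model \<in> SS"
    unfolding hm_model_def kripke.simps by (intro delta0_comprehension delta0_intros delta0_holds)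
  have split: "\<exists>x c. u = pair x c" for u by (rule pair_surj)
  show "u \<in> cprod (Wld hm_model) Fml \<and> i \<in> {\<zero>, \<one>}" if "pair u i \<in> Val hm_model" for u i
    using that split[of u] by (auto simp: hm_model_Val cprod_def Fml_def)
  show "\<exists>i. pair u i \<in> Val hm_model" for u
    using split[of u] by (auto simp: hm_model_Val)
  show "i = j" if "pair u i \<in> Val hm_model" "pair u j \<in> Val hm_model" for u i j
    using that split[of u] by (auto simp: hm_model_Val)
qed

lemma hm_model_val: "val hm_model x c = (if holds x c then \<one> else \<zero>)"
  unfolding val_def app_eq_iff[OF hm_model_function, of "pair x c", simplified cprod_def Fml_def hm_model_Wld, simplified]
    hm_model_Val ..

lemma hm_model_kripke: "kripke_model hm_model"
  unfolding kripke_model_def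
proof (intro conjI ballI)
  show "Acc hm_model \<in> SS"
    unfolding hm_model_def kripke.simps by (intro delta0_comprehension delta0_intros delta0_edge)
  show "Acc hm_model \<subseteq> cprod (Wld hm_model) (Wld hm_model)"
    by (auto simp: hm_model_def cprod_def)
  fix x a b
  have "\<one> \<ominus> \<zero> = \<one>" "\<one> \<ominus> \<one> = \<zero>"
    using monus_plus[of \<one> \<zero>] monus_plus[of \<zero> \<one>] by simp_all
  then show "val hm_model x (imp a b) = \<one> \<ominus> val hm_model x a \<otimes> (\<one> \<ominus> val hm_model x b)"
    by (cases "holds x a"; cases "holds x b") (simp_all add: hm_model_val)
  show "val hm_model x (box a) = \<one> \<longleftrightarrow> (\<forall>v\<in>Wld hm_model. rel (Acc hm_model) x v \<longrightarrow> val hm_model v a = \<one>)"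
    by (simp add: hm_model_val) blast
qed (simp_all add: UNIV_in_sets hm_model_function[simplified] hm_model_val)

lemma hm_model_image_finite: "image_finite hm_model"
  unfolding image_finite_def finite_set_def bounded_by_def successors_def
proof (intro ballI conjI)
  fix x
  show "{v \<in> Wld hm_model. rel (Acc hm_model) x v} \<in> SS"
    by (simp, intro delta0_comprehension delta0_intros delta0_edge)
  obtain a where a: "\<And>y. edge x y \<Longrightarrow> y \<unlhd> x \<oplus> scale \<one> \<or> y = chain a \<or> y = loop a"
  proof (cases "\<exists>n a. least_wit n a \<and> (x = probe n \<or> x = right n)")
    case True
    then obtain n a where na: "least_wit n a" "x = probe n \<or> x = right n" by blast
    show thesis
    proof (rule that[of a])
      fix y assume "edge x y"
      from edge_near[OF this] show "y \<unlhd> x \<oplus> scale \<one> \<or> y = chain a \<or> y = loop a"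
        using na least_wit_unique by auto
    qed
  next
    case False
    then show thesis using that edge_near by blast
  qed
  have "y \<lhd> (x \<oplus> scale \<one>) \<oplus> (chain a \<oplus> loop a) \<oplus> \<one>" if "edge x y" for y
    unfolding less_succ using a[OF that] by (auto intro: ar.order_trans[OF _ le_plus(1)] ar.order_trans[OF _ le_plus(2)])
  then show "\<exists>k. \<forall>v\<in>{v \<in> Wld hm_model. rel (Acc hm_model) x v}. v \<lhd> k" by auto
qed

text \<open>Propositional variables hold exactly on the spines, so a bisimulation cannot leave them and relates \<open>left n\<close> to \<open>right n\<close>
for all \<open>n\<close>. The successor \<open>loop \<zero>\<close> of \<open>left n\<close> then needs a partner among the successors of \<open>right n\<close>;
without a witness only \<open>probe n\<close> is off the spine. With a witness, \<open>probe n\<close> reaches a chain, and no chain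
is bisimilar to a reflexive world, by induction on its length.\<close>

lemma hm_model_bisimulation:
  assumes Z: "bisimulation Z hm_model hm_model" and start: "rel Z (left \<zero>) (right \<zero>)"
  shows "rel Z (loop \<zero>) (probe n) \<longleftrightarrow> (\<nexists>a. least_wit n a)"
proof -
  have "Z \<in> SS" using Z unfolding bisimulation_def by blast
  have colour: "spine x \<longleftrightarrow> spine y" if "rel Z x y" for x y
    using Z that unfolding bisimulation_def Prop_def by (auto simp: hm_model_val split: if_splits)
  have zig: "\<exists>y'. rel Z x' y' \<and> edge y y'" if "rel Z x y" "edge x x'" for x y x'
    using Z that unfolding bisimulation_def hm_model_rel by blast
  have zag: "\<exists>x'. rel Z x' y' \<and> edge x x'" if "rel Z x y" "edge y y'" for x y y'
    using Z that unfolding bisimulation_def hm_model_rel by blast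
  have spine_rel: "rel Z (left n) (right n)" for n
  proof (rule delta0_induct[where P = "\<lambda>n. rel Z (left n) (right n)"])
    show "delta0 (\<lambda>e. rel Z (left (e 0)) (right (e 0)))" unfolding rel_def by (intro delta0_intros \<open>Z \<in> SS\<close>)
    fix n assume "rel Z (left n) (right n)"
    then obtain y where "rel Z (left (n \<oplus> \<one>)) y" "edge (right n) y" using zig by fastforce
    with colour show "rel Z (left (n \<oplus> \<one>)) (right (n \<oplus> \<one>))" by fastforce
  qed fact
  have no_chain: "\<not> rel Z (loop \<zero>) (chain j)" for j
  proof (rule delta0_induct[where P = "\<lambda>j. \<not> rel Z (loop \<zero>) (chain j)"])
    show "delta0 (\<lambda>e. \<not> rel Z (loop \<zero>) (chain (e 0)))" unfolding rel_def by (intro delta0_intros \<open>Z \<in> SS\<close>)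
  qed (use zig[of "loop \<zero>" _ "loop \<zero>"] in fastforce)+
  show ?thesis
  proof
    assume "rel Z (loop \<zero>) (probe n)"
    then have "\<not> edge (probe n) (chain a)" for a
      using zag[of "loop \<zero>" "probe n" "chain a"] no_chain by auto
    then show "\<nexists>a. least_wit n a" by simp
  next
    assume "\<nexists>a. least_wit n a"
    moreover obtain y where "rel Z (loop \<zero>) y" "edge (right n) y"
      using zig[OF spine_rel[of n], of "loop \<zero>"] by auto
    ultimately show "rel Z (loop \<zero>) (probe n)" using colour by fastforce
  qed
qed

lemma hennessy_milner_projection:
  assumes hennessy_milner_image_finite
  shows "{n. \<exists>a. pair n a \<in> \<Theta>} \<in> SS"
proof -
  have "modally_equivalent hm_model (left \<zero>) hm_model (right \<zero>)"
    by (simp add: modally_equivalent_def hm_model_val holds_left_right)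
  then have "bisimilar hm_model (left \<zero>) hm_model (right \<zero>)"
    using assms hm_model_kripke hm_model_image_finite
    unfolding hennessy_milner_image_finite_def pointed_model_def by simp
  then obtain Z where "Z \<in> SS" and Z: "bisimulation Z hm_model hm_model" "rel Z (left \<zero>) (right \<zero>)"
    unfolding bisimilar_def by blast
  have "(\<exists>a. pair n a \<in> \<Theta>) \<longleftrightarrow> pair (loop \<zero>) (probe n) \<notin> Z" for n
    using hm_model_bisimulation[OF Z, of n] least_wit_exists unfolding rel_def least_wit_def by blast
  moreover have "{n. pair (loop \<zero>) (probe n) \<notin> Z} \<in> SS" by (intro delta0_comprehension delta0_intros \<open>Z \<in> SS\<close>)
  ultimately show ?thesis by simp
qed

end

section \<open>From projections to arithmetical comprehension\<close>

lemma sigma01_comprehension: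
  assumes HM: hennessy_milner_image_finite and P: "delta0 (\<lambda>e. P (e 0) (e (Suc 0)))"
  shows "{n. \<exists>a. P a n} \<in> SS"
proof -
  let ?T = "{z. \<exists>n. n \<unlhd> z \<and> (\<exists>a. a \<unlhd> z \<and> z = pair n a \<and> P a n)}"
  have "?T \<in> SS"
  proof (rule delta0_comprehension, intro delta0_intros)
    show "delta0 (\<lambda>e. P (e 0) (e (Suc 0)))" by (rule P)
  qed
  from hennessy_milner_projection[OF this HM] show ?thesis by simp
qed

text \<open>An unbounded quantifier over a bounded predicate of several variables is again bounded, with a new set
parameter. Comprehension handles one free variable; the others are folded into it with the pairing
function, one at a time, by induction on their number.\<close>

lemma delta0_unbounded_ex:
  assumes HM: hennessy_milner_image_finite and "delta0 P"
  shows "delta0 (\<lambda>e. \<exists>a. P (case_nat a e))"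
proof -
  have "delta0 P \<Longrightarrow> \<forall>e e'. (\<forall>i<Suc (Suc N). e i = e' i) \<longrightarrow> P e = P e' \<Longrightarrow> delta0 (\<lambda>e. \<exists>a. P (case_nat a e))" for P N
  proof (induction N arbitrary: P)
    case 0
    let ?X = "{n. \<exists>a. P (case_nat a (\<lambda>_. n))}"
    have "(\<lambda>i. e (case_nat 0 (\<lambda>_. Suc 0) i)) = case_nat (e 0) (\<lambda>_. e (Suc 0))" for e :: "nat \<Rightarrow> 'a"
      by (auto split: nat.splits)
    then have "?X \<in> SS"
      using delta0_rename[OF 0(1), of "case_nat 0 (\<lambda>_. Suc 0)"] by (intro sigma01_comprehension[OF HM]) simp
    then have "delta0 (\<lambda>e. e 0 \<in> ?X)" by (intro delta0_intros)
    moreover have "P (case_nat a e) = P (case_nat a (\<lambda>_. e 0))" for a e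
      using 0(2) by (auto simp: less_Suc_eq_0_disj)
    ultimately show ?case by simp
  next
    case (Suc N)
    \<comment> \<open>Entries 1 and 2 of the environment are replaced by their pair; entry 0 is the variable to be quantified.\<close>
    let ?P = "\<lambda>e. \<exists>x. x \<unlhd> e (Suc 0) \<and> (\<exists>y. y \<unlhd> e (Suc 0) \<and> e (Suc 0) = pair x y \<and>
      P (case_nat (e 0) (case_nat x (case_nat y (\<lambda>i. e (Suc (Suc i)))))))"
    have ren: "(\<lambda>i. e (case_nat (Suc (Suc 0)) (case_nat (Suc 0) (case_nat 0 (\<lambda>i. Suc (Suc (Suc (Suc i)))))) i)) =
        case_nat (e (Suc (Suc 0))) (case_nat (e (Suc 0)) (case_nat (e 0) (\<lambda>i. e (Suc (Suc (Suc (Suc i)))))))"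
      for e :: "nat \<Rightarrow> 'a" by (auto split: nat.splits)
    have "delta0 ?P"
      using delta0_rename[OF Suc.prems(1),
          of "case_nat (Suc (Suc 0)) (case_nat (Suc 0) (case_nat 0 (\<lambda>i. Suc (Suc (Suc (Suc i))))))"]
      unfolding ren by (intro delta0_intros)
    moreover have "\<forall>e e'. (\<forall>i<Suc (Suc N). e i = e' i) \<longrightarrow> ?P e = ?P e'"
    proof (intro allI impI)
      fix e e' :: "nat \<Rightarrow> 'a" assume e: "\<forall>i<Suc (Suc N). e i = e' i"
      have "P (case_nat (e 0) (case_nat x (case_nat y (\<lambda>i. e (Suc (Suc i)))))) =
          P (case_nat (e' 0) (case_nat x (case_nat y (\<lambda>i. e' (Suc (Suc i))))))" for x y
        using e by (intro Suc.prems(2)[rule_format]) (auto split: nat.splits)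
      then show "?P e = ?P e'" using e by simp
    qed
    ultimately have R: "delta0 (\<lambda>e. \<exists>a. ?P (case_nat a e))" by (rule Suc.IH)
    let ?R = "\<lambda>e. \<exists>a. ?P (case_nat a e)"
    have "(\<lambda>i. e (case_nat 0 (\<lambda>i. Suc (Suc (Suc i))) i)) = case_nat (e 0) (\<lambda>i. e (Suc (Suc (Suc i))))"
      for e :: "nat \<Rightarrow> 'a" by (auto split: nat.splits)
    then have "delta0 (\<lambda>e. ?R (case_nat (e 0) (\<lambda>i. e (Suc (Suc (Suc i))))))"
      using delta0_rename[OF R, of "case_nat 0 (\<lambda>i. Suc (Suc (Suc i)))"] by simp
    then have "delta0 (\<lambda>e. ?R (case_nat (pair (e 0) (e (Suc 0))) (\<lambda>i. e (Suc (Suc i)))))"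
      by (intro delta0_fn_subst[where Q = "\<lambda>x e. ?R (case_nat x (\<lambda>i. e (Suc (Suc i))))"] delta0_intros)
    moreover have "case_nat (e 0) (case_nat (e (Suc 0)) (\<lambda>i. e (Suc (Suc i)))) = e" for e :: "nat \<Rightarrow> 'a"
      by (auto split: nat.splits)
    ultimately show ?case by simp
  qed
  moreover obtain N where "\<forall>e e'. (\<forall>i<N. e i = e' i) \<longrightarrow> P e = P e'"
    using delta0_finite_support[OF \<open>delta0 P\<close>] unfolding finite_support_def by blast
  then have "\<forall>e e'. (\<forall>i<Suc (Suc N). e i = e' i) \<longrightarrow> P e = P e'" by (meson less_SucI)
  ultimately show ?thesis using \<open>delta0 P\<close> by blast
qed

lemma poly_eval_term: "poly_fun (\<lambda>e. eval_term e t)"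
  by (induction t) (simp_all add: poly_fun.intros)

lemma delta0_sat:
  assumes HM: hennessy_milner_image_finite and "range E \<subseteq> SS"
  shows "arithmetical \<phi> \<Longrightarrow> delta0 (\<lambda>e. sat e E \<phi>)"
proof -
  have ex: "delta0 (\<lambda>e. \<exists>a. P (e(x := a)))" if P: "delta0 P" for P :: "(nat \<Rightarrow> 'a) \<Rightarrow> bool" and x
  proof -
    have "(\<lambda>i. case_nat a e (if i = x then 0 else Suc i)) = e(x := a)" for a and e :: "nat \<Rightarrow> 'a"
      by auto
    then show ?thesis
      using delta0_unbounded_ex[OF HM delta0_rename[OF P, of "\<lambda>i. if i = x then 0 else Suc i"]] by simp
  qed
  show "arithmetical \<phi> \<Longrightarrow> delta0 (\<lambda>e. sat e E \<phi>)"
  proof (induction \<phi>)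
    case (ExN x \<phi>)
    then show ?case using ex by simp
  next
    case (AllN x \<phi>)
    have "delta0 (\<lambda>e. \<not> (\<exists>a. \<not> sat (e(x := a)) E \<phi>))"
      by (rule delta0_not[OF ex[OF delta0_not]]) (use AllN in simp)
    then show ?case by simp
  qed (use assms(2) in \<open>auto intro!: delta0_intros delta0_fun_poly poly_eval_term\<close>)
qed

lemma hennessy_milner_arithmetical_comprehension:
  assumes HM: hennessy_milner_image_finite
  shows arithmetical_comprehension
  unfolding arithmetical_comprehension_def
proof (intro allI impI)
  fix \<phi> and x :: nat and e and E :: "nat \<Rightarrow> 'a set" assume "arithmetical \<phi> \<and> range E \<subseteq> SS"
  then have \<phi>: "delta0 (\<lambda>e. sat e E \<phi>)" using delta0_sat[OF HM] by blast
  define \<sigma> :: "nat \<Rightarrow> (nat \<Rightarrow> 'a) \<Rightarrow> 'a"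
    where "\<sigma> = (\<lambda>i. if i = x then (\<lambda>e'. e' 0) else (\<lambda>_. e i))"
  have "poly_fun (\<sigma> i)" for i
    by (cases "i = x") (simp_all add: \<sigma>_def poly_fun.intros)
  then have "delta0 (\<lambda>e'. sat (\<lambda>i. \<sigma> i e') E \<phi>)"
    using delta0_subst_poly[OF \<phi>, of \<sigma>] by simp
  moreover have "(\<lambda>i. \<sigma> i e') = e(x := e' 0)" for e'
    by (rule ext) (simp add: \<sigma>_def)
  ultimately have "delta0 (\<lambda>e'. sat (e(x := e' 0)) E \<phi>)" by simp
  from delta0_comprehension[where P = "\<lambda>n. sat (e(x := n)) E \<phi>", OF this]
  show "\<exists>X\<in>SS. \<forall>n. (n \<in> X) = sat (e(x := n)) E \<phi>"
    by (intro bexI[of _ "{n. sat (e(x := n)) E \<phi>}"] allI mem_Collect_eq)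
qed

end

theorem theorem2p11:
  fixes M :: "'a l2_structure"
  assumes "l2.RCA0 M"
  shows "(l2.ACA0 M \<longleftrightarrow> l2.hennessy_milner_saturated M) \<and>
         (l2.hennessy_milner_saturated M \<longleftrightarrow> l2.hennessy_milner_image_finite M)"
proof -
  interpret rca0 M by unfold_locales (rule assms)
  show ?thesis
    using ACA_hennessy_milner_saturated saturated_image_finite
      hennessy_milner_arithmetical_comprehension RCA0
    unfolding ACA0_def by blast
qed

end
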